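(* Let $\pi:Y\to X$ be a fibered manifold with $\dim X=n$ and let $\lambda$ be a Lagrangian of order $r$, i.e. a horizontal $n$-form on $J^rY$. For any pair of $\pi$-vertical vector fields $\Xi_1,\Xi_2$ on $Y$ we have $$J^{2r+1}\Xi_2\rfloor\mathcal I\big(J^{2r+1}\Xi_1\rfloor d\,\mathcal I(d\lambda)\big)=0.$$ Moreover, along extremals of $\lambda$ the Jacobi morphism $\Xi\mapsto\mathcal J_\Xi(\lambda)=E_n(\Xi\rfloor E_n(\lambda))$ is self-adjoint.
   Context: Jets. $\pi:Y\to X$ is a fibered manifold (surjective submersion), $\dim X=n$, $\dim Y=n+m$, with fibered coordinates $(x^i,y^\sigma)$; $J^kY$ is the $k$-th jet space with induced coordinates $(x^i,y^\sigma_I)$, $|I|\le k$; $ds=dx^1\wedge\dots\wedge dx^n$; $d_i=\partial_{x^i}+\sum_I y^\sigma_{Ii}\,\partial/\partial y^\sigma_I$ is the total derivative and $d_I=d_{i_1}\cdots d_{i_s}$ for $I=(i_1,\dots,i_s)$. Sums run over all multi-indices, the operators $\partial/\partial y^\sigma_I$ being multiplied by the usual combinatorial factors that compensate for repetitions. All identities are understood up to pull-back by the jet projections; $J^k\Xi$ denotes the $k$-th prolongation of $\Xi$. Contact structure. $\omega^\sigma_J=dy^\sigma_J-y^\sigma_{Ji}dx^i$. Every $q$-form $\rho$ on $J^kY$ decomposes uniquely, after pull-back to $J^{k+1}Y$, as $\sum_{i=0}^q p_i\rho$, where $p_i\rho$ is generated by products containing exactly $i$ factors $\omega^\sigma_J$.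 Interior Euler operator. For an $(n+k)$-form $\rho$, $k\ge1$, $\mathcal I(\rho)=\frac1k\,\omega^\sigma\wedge\sum_{|I|\ge 0}(-1)^{|I|}d_I\big(\frac{\partial}{\partial y^\sigma_I}\rfloor p_k\rho\big)$, where $d_I$ acts on forms as iterated Lie derivative along the total derivatives. For a Lagrangian $\lambda$, $E_n(\lambda):=\mathcal I(d\lambda)=E_\sigma(\lambda)\,\omega^\sigma\wedge ds$ is its Euler--Lagrange form. An extremal (critical section) is a local section $\gamma$ of $\pi$ satisfying the Euler--Lagrange equations $E_\sigma(\lambda)\circ j^{2r+1}\gamma=0$. Jacobi morphism. It is the map $\lambda\mapsto \bullet\rfloor E_n(\bullet\rfloor E_n(\lambda))$, with vertical vector fields on $Y$ as arguments, and $\mathcal J_{\Xi}(\lambda):=E_n(\Xi\rfloor E_n(\lambda))$ for a vertical vector field $\Xi$ on $Y$. Self-adjointness. The adjoint of a linear differential operator on vertical vector fields with local expression $\nabla(\Xi)=\sum_J A^J_{\tau\sigma}\,d_J(\Xi^\tau)\,\omega^\sigma\otimes ds$ is $\nabla^*(\Xi)=\sum_J(-1)^{|J|}d_J(A^J_{\tau\sigma}\Xi^\sigma)\,\omega^\tau\otimes ds$. Along extremals, $\Xi\mapsto\mathcal J_\Xi(\lambda)$ is regarded as such an operator (identifying $\omega^\sigma\wedge ds$ with $\omega^\sigma\otimes ds$, and with the coefficients evaluated along the jet prolongation of the extremal); it is self-adjoint if it coincides with its adjoint. *)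

theory Defs
  imports "HOL-Analysis.Analysis" "HOL-Library.Multiset" "HOL-Library.Function_Algebras"
    "HOL-Library.Groups_Big_Fun"
begin

section \<open>Smooth maps\<close>

text \<open>Pointwise scaling, so that the model space of infinite jets below is a real vector space
  (its topology is the product topology).\<close>

instantiation "fun" :: (type, real_vector) real_vector
begin

definition scaleR_fun :: "real \<Rightarrow> ('a \<Rightarrow> 'b) \<Rightarrow> 'a \<Rightarrow> 'b"
  where "scaleR_fun r f = (\<lambda>x. r *\<^sub>R f x)"

instance
  by standard (simp_all add: scaleR_fun_def fun_eq_iff scaleR_add_right scaleR_add_left)

end

definition dirderiv :: "'a::real_vector \<Rightarrow> ('a \<Rightarrow> 'b::real_normed_vector) \<Rightarrow> 'a \<Rightarrow> 'b"
  where "dirderiv v f p = vector_derivative (\<lambda>t. f (p + t *\<^sub>R v)) (at 0)"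

text \<open>On an open subset of a Euclidean space this is the usual notion of class \<open>C\<^sup>k\<close> (all iterated
  directional derivatives up to order \<open>k\<close> exist and are continuous). It is also used on
  infinite jets, for functions that depend on finitely many coordinates only.\<close>

fun Ck_on :: "nat \<Rightarrow> 'a::{real_vector, topological_space} set \<Rightarrow> ('a \<Rightarrow> 'b::real_normed_vector) \<Rightarrow> bool"
  where
    "Ck_on 0 S f \<longleftrightarrow> continuous_on S f"
  | "Ck_on (Suc k) S f \<longleftrightarrow> continuous_on S f \<and>
      (\<forall>v. (\<forall>p\<in>S. (\<lambda>t::real. f (p + t *\<^sub>R v)) differentiable (at 0)) \<and> Ck_on k S (dirderiv v f))"

definition smooth_on :: "'a::{real_vector, topological_space} set \<Rightarrow> ('a \<Rightarrow> 'b::real_normed_vector) \<Rightarrow> bool"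
  where "smooth_on S f \<longleftrightarrow> (\<forall>k. Ck_on k S f)"


section \<open>Smooth manifolds and fibered manifolds\<close>

type_synonym ('a, 'e) chart = "'a set \<times> ('a \<Rightarrow> 'e)"

definition is_chart :: "'a topology \<Rightarrow> ('a, 'e::euclidean_space) chart \<Rightarrow> bool"
  where "is_chart X c \<longleftrightarrow> openin X (fst c) \<and> open (snd c ` fst c) \<and>
    homeomorphic_map (subtopology X (fst c)) (top_of_set (snd c ` fst c)) (snd c)"

definition transition :: "('a, 'e) chart \<Rightarrow> ('a, 'f) chart \<Rightarrow> 'e \<Rightarrow> 'f"
  where "transition c c' = snd c' \<circ> inv_into (fst c) (snd c)"

definition compatible :: "('a, 'e::euclidean_space) chart \<Rightarrow> ('a, 'e) chart \<Rightarrow> bool"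
  where "compatible c c' \<longleftrightarrow> smooth_on (snd c ` (fst c \<inter> fst c')) (transition c c') \<and>
    smooth_on (snd c' ` (fst c \<inter> fst c')) (transition c' c)"

text \<open>The smooth structure \<open>A\<close> is a maximal atlas.\<close>

definition smooth_manifold :: "'a topology \<Rightarrow> ('a, 'e::euclidean_space) chart set \<Rightarrow> bool"
  where "smooth_manifold X A \<longleftrightarrow>
    Hausdorff_space X \<and> second_countable X \<and>
    (\<forall>c\<in>A. is_chart X c) \<and> (\<Union>c\<in>A. fst c) = topspace X \<and>
    (\<forall>c\<in>A. \<forall>c'\<in>A. compatible c c') \<and>
    (\<forall>c. is_chart X c \<and> (\<forall>c'\<in>A. compatible c c') \<longrightarrow> c \<in> A)"

text \<open>A surjective submersion \<open>\<pi> : Y \<rightarrow> X\<close> with \<open>dim X = n\<close> and \<open>dim Y = n + m\<close>, where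
  \<open>n = CARD('n)\<close> and \<open>m = CARD('m)\<close>.\<close>

definition fibered_manifold ::
  "'x topology \<Rightarrow> ('x, real^'n) chart set \<Rightarrow> 'y topology \<Rightarrow> ('y, (real^'n) \<times> (real^'m)) chart set \<Rightarrow>
    ('y \<Rightarrow> 'x) \<Rightarrow> bool"
  where "fibered_manifold X AX Y AY \<pi> \<longleftrightarrow>
    smooth_manifold X AX \<and> smooth_manifold Y AY \<and>
    continuous_map Y X \<pi> \<and> \<pi> ` topspace Y = topspace X \<and>
    (\<forall>(V, \<psi>)\<in>AY. \<forall>(U, \<phi>)\<in>AX.
      let f = \<phi> \<circ> \<pi> \<circ> inv_into V \<psi>; S = \<psi> ` {y\<in>V. \<pi> y \<in> U}
      in smooth_on S f \<and> (\<forall>z\<in>S. surj (\<lambda>v. dirderiv v f z)))"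

type_synonym ('x, 'y, 'n, 'm) fchart =
  "('y, (real^'n) \<times> (real^'m)) chart \<times> ('x, real^'n) chart"

text \<open>Fibered charts, i.e. fibered coordinates \<open>(x\<^sup>i, y\<^sup>\<sigma>)\<close> on \<open>V\<close> over \<open>x\<^sup>i\<close> on \<open>U = \<pi>(V)\<close>.\<close>

definition fibered_charts ::
  "('x, real^'n) chart set \<Rightarrow> ('y, (real^'n) \<times> (real^'m)) chart set \<Rightarrow> ('y \<Rightarrow> 'x) \<Rightarrow>
    ('x, 'y, 'n::finite, 'm::finite) fchart set"
  where "fibered_charts AX AY \<pi> = {((V, \<psi>), (U, \<phi>)). (V, \<psi>) \<in> AY \<and> (U, \<phi>) \<in> AX \<and>
    \<pi> ` V = U \<and> (\<forall>y\<in>V. fst (\<psi> y) = \<phi> (\<pi> y))}"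

definition chart_image :: "('x, 'y, 'n::finite, 'm::finite) fchart \<Rightarrow> ((real^'n) \<times> (real^'m)) set"
  where "chart_image c = snd (fst c) ` fst (fst c)"


section \<open>Jets of sections\<close>

text \<open>Induced coordinates \<open>(x\<^sup>i, y\<^sup>\<sigma>\<^sub>I)\<close> of an infinite jet in a fibered chart. As \<open>y\<^sup>\<sigma>\<^sub>I\<close> is symmetric
  in \<open>I\<close>, it is indexed by the multiset of the entries of \<open>I\<close>. Working with infinite jets
  implements the convention that everything is understood up to pull-back by the jet
  projections; objects on the \<open>k\<close>-th jet space are those that involve only the \<open>y\<^sup>\<sigma>\<^sub>I\<close> with
  \<open>|I| \<le> k\<close>. Tangent vectors have the same shape as points.\<close>

type_synonym ('n, 'm) jet = "(real^'n) \<times> ('n multiset \<Rightarrow> real^'m)"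

definition jet_domain :: "('x, 'y, 'n::finite, 'm::finite) fchart \<Rightarrow> ('n, 'm) jet set"
  where "jet_domain c = {p. (fst p, snd p {#}) \<in> chart_image c}"

definition order_le :: "nat \<Rightarrow> ('n::finite, 'm::finite) jet set \<Rightarrow> (('n, 'm) jet \<Rightarrow> 'b) \<Rightarrow> bool"
  where "order_le r S F \<longleftrightarrow>
    (\<forall>p\<in>S. \<forall>q\<in>S. fst p = fst q \<and> (\<forall>M. size M \<le> r \<longrightarrow> snd p M = snd q M) \<longrightarrow> F p = F q)"

definition partial :: "'n::finite list \<Rightarrow> (real^'n \<Rightarrow> 'b::real_normed_vector) \<Rightarrow> real^'n \<Rightarrow> 'b"
  where "partial J f = foldr (\<lambda>i. dirderiv (axis i 1)) J f"

text \<open>An arbitrary enumeration of the entries of a multi-index; it is only used to iterate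
  commuting derivations.\<close>

definition list_of :: "'n multiset \<Rightarrow> 'n list"
  where "list_of M = (SOME J. mset J = M)"

definition jet_prolong :: "(real^'n \<Rightarrow> real^'m) \<Rightarrow> real^'n \<Rightarrow> ('n::finite, 'm::finite) jet"
  where "jet_prolong g x = (x, \<lambda>M. partial (list_of M) g x)"

text \<open>Coordinate expression of a local section \<open>\<gamma>\<close> on \<open>W\<close> in a fibered chart, and its domain.\<close>

definition section_rep :: "('x, 'y, 'n::finite, 'm::finite) fchart \<Rightarrow> ('x \<Rightarrow> 'y) \<Rightarrow> real^'n \<Rightarrow> real^'m"
  where "section_rep c \<gamma> = (\<lambda>x. snd (snd (fst c) (\<gamma> (inv_into (fst (snd c)) (snd (snd c)) x))))"

definition section_dom :: "('x, 'y, 'n::finite, 'm::finite) fchart \<Rightarrow> 'x set \<Rightarrow> ('x \<Rightarrow> 'y) \<Rightarrow> (real^'n) set"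
  where "section_dom c W \<gamma> = snd (snd c) ` {x \<in> W. \<gamma> x \<in> fst (fst c)}"

definition local_section ::
  "'x topology \<Rightarrow> ('x, real^'n) chart set \<Rightarrow> 'y topology \<Rightarrow> ('y, (real^'n) \<times> (real^'m)) chart set \<Rightarrow>
    ('y \<Rightarrow> 'x) \<Rightarrow> 'x set \<Rightarrow> ('x \<Rightarrow> 'y) \<Rightarrow> bool"
  where "local_section X AX Y AY \<pi> W \<gamma> \<longleftrightarrow>
    openin X W \<and> continuous_map (subtopology X W) Y \<gamma> \<and> (\<forall>x\<in>W. \<pi> (\<gamma> x) = x) \<and>
    (\<forall>c\<in>fibered_charts AX AY \<pi>. smooth_on (section_dom c W \<gamma>) (section_rep c \<gamma>))"


section \<open>Lagrangians and vertical vector fields\<close>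

text \<open>A horizontal \<open>n\<close>-form of order \<open>r\<close> is given by its components: in a fibered chart \<open>c\<close> it is
  \<open>L c ds\<close>, and \<open>L c ds = L c' ds'\<close> at every jet of a section in the domains of two charts
  \<open>c\<close> and \<open>c'\<close>. Every jet is the jet of some local section.\<close>

definition lagrangian ::
  "'x topology \<Rightarrow> ('x, real^'n) chart set \<Rightarrow> 'y topology \<Rightarrow> ('y, (real^'n) \<times> (real^'m)) chart set \<Rightarrow>
    ('y \<Rightarrow> 'x) \<Rightarrow> nat \<Rightarrow> (('x, 'y, 'n::finite, 'm::finite) fchart \<Rightarrow> ('n, 'm) jet \<Rightarrow> real) \<Rightarrow> bool"
  where "lagrangian X AX Y AY \<pi> r L \<longleftrightarrow>
    (\<forall>c\<in>fibered_charts AX AY \<pi>. smooth_on (jet_domain c) (L c) \<and> order_le r (jet_domain c) (L c)) \<and>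
    (\<forall>c\<in>fibered_charts AX AY \<pi>. \<forall>c'\<in>fibered_charts AX AY \<pi>. \<forall>W \<gamma>. local_section X AX Y AY \<pi> W \<gamma> \<longrightarrow>
      (\<forall>x\<in>W. \<gamma> x \<in> fst (fst c) \<inter> fst (fst c') \<longrightarrow>
        L c (jet_prolong (section_rep c \<gamma>) (snd (snd c) x)) =
        L c' (jet_prolong (section_rep c' \<gamma>) (snd (snd c') x)) *
          det (\<chi> i j. dirderiv (axis j 1) (transition (snd c) (snd c')) (snd (snd c) x) $ i)))"

text \<open>A vertical vector field on \<open>Y\<close>, given in each fibered chart by its components \<open>\<Xi>\<^sup>\<sigma>\<close>;
  the components transform by the differential of the coordinate change.\<close>

definition vertical_field ::
  "('x, real^'n) chart set \<Rightarrow> ('y, (real^'n) \<times> (real^'m)) chart set \<Rightarrow> ('y \<Rightarrow> 'x) \<Rightarrow>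
    (('x, 'y, 'n::finite, 'm::finite) fchart \<Rightarrow> (real^'n) \<times> (real^'m) \<Rightarrow> real^'m) \<Rightarrow> bool"
  where "vertical_field AX AY \<pi> \<Xi> \<longleftrightarrow>
    (\<forall>c\<in>fibered_charts AX AY \<pi>. smooth_on (chart_image c) (\<Xi> c)) \<and>
    (\<forall>c\<in>fibered_charts AX AY \<pi>. \<forall>c'\<in>fibered_charts AX AY \<pi>.
      \<forall>y \<in> fst (fst c) \<inter> fst (fst c').
        dirderiv (0, \<Xi> c (snd (fst c) y)) (transition (fst c) (fst c')) (snd (fst c) y)
          = (0, \<Xi> c' (snd (fst c') y)))"


section \<open>Differential forms in fibered coordinates\<close>

text \<open>A \<open>q\<close>-form is evaluated at a jet and a list of \<open>q\<close> tangent vectors.\<close>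

type_synonym ('n, 'm) form = "('n, 'm) jet \<Rightarrow> ('n, 'm) jet list \<Rightarrow> real"

type_synonym ('n, 'm) vfield = "('n, 'm) jet \<Rightarrow> ('n, 'm) jet"

definition omit :: "nat \<Rightarrow> 'a list \<Rightarrow> 'a list"
  where "omit j vs = take j vs @ drop (Suc j) vs"

definition dext :: "('n::finite, 'm::finite) form \<Rightarrow> ('n, 'm) form"
  where "dext \<rho> p vs = (\<Sum>j<length vs. (-1) ^ j * dirderiv (vs ! j) (\<lambda>q. \<rho> q (omit j vs)) p)"

text \<open>In \<open>dext\<close> the tangent vectors \<open>vs\<close> are regarded as constant (hence commuting) vector
  fields of the coordinate space.\<close>

definition contract :: "('n::finite, 'm::finite) vfield \<Rightarrow> ('n, 'm) form \<Rightarrow> ('n, 'm) form"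
  where "contract \<xi> \<rho> p vs = \<rho> p (\<xi> p # vs)"

text \<open>Exterior product of a 1-form (evaluated on a single vector) with a form.\<close>

definition wedge1 :: "(('n::finite, 'm::finite) jet \<Rightarrow> ('n, 'm) jet \<Rightarrow> real) \<Rightarrow> ('n, 'm) form \<Rightarrow> ('n, 'm) form"
  where "wedge1 \<alpha> \<rho> p vs = (\<Sum>j<length vs. (-1) ^ j * \<alpha> p (vs ! j) * \<rho> p (omit j vs))"

text \<open>Lie derivative, by Cartan's formula (total derivatives have no flow on infinite jets).\<close>

definition lie :: "('n::finite, 'm::finite) vfield \<Rightarrow> ('n, 'm) form \<Rightarrow> ('n, 'm) form"
  where "lie \<xi> \<rho> p vs = contract \<xi> (dext \<rho>) p vs + dext (contract \<xi> \<rho>) p vs"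

text \<open>The numbering \<open>x\<^sup>1, \<dots>, x\<^sup>n\<close> of the base coordinates. Its choice affects \<open>ds\<close> by a sign only.\<close>

definition coord_no :: "'n::finite \<Rightarrow> nat"
  where "coord_no = (SOME f. bij_betw f UNIV {..<CARD('n)})"

definition ds :: "('n::finite, 'm::finite) form"
  where "ds p vs = det (\<chi> i j. fst (vs ! coord_no j) $ i)"

definition lagrange_form :: "(('n::finite, 'm::finite) jet \<Rightarrow> real) \<Rightarrow> ('n, 'm) form"
  where "lagrange_form L p vs = L p * ds p vs"


section \<open>Contact structure\<close>

definition contact_form :: "'m::finite \<Rightarrow> 'n::finite multiset \<Rightarrow> ('n, 'm) jet \<Rightarrow> ('n, 'm) jet \<Rightarrow> real"
  where "contact_form \<sigma> J p v = snd v J $ \<sigma> - (\<Sum>i\<in>UNIV. snd p (add_mset i J) $ \<sigma> * fst v $ i)"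

definition total :: "'n::finite \<Rightarrow> ('n, 'm::finite) vfield"
  where "total i p = (axis i 1, \<lambda>J. snd p (add_mset i J))"

definition horiz :: "('n::finite, 'm::finite) jet \<Rightarrow> ('n, 'm) jet \<Rightarrow> ('n, 'm) jet"
  where "horiz p v = (\<Sum>i\<in>UNIV. (fst v $ i) *\<^sub>R total i p)"

definition vert :: "('n::finite, 'm::finite) jet \<Rightarrow> ('n, 'm) jet \<Rightarrow> ('n, 'm) jet"
  where "vert p v = (0, \<lambda>J. \<chi> \<sigma>. contact_form \<sigma> J p v)"

text \<open>The \<open>k\<close>-contact component \<open>p\<^sub>k \<rho>\<close>: substituting \<open>dy\<^sup>\<sigma>\<^sub>J = \<omega>\<^sup>\<sigma>\<^sub>J + y\<^sup>\<sigma>\<^sub>J\<^sub>i dx\<^sup>i\<close> in \<open>\<rho>\<close> amounts to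
  splitting each argument as \<open>v = vert p v + horiz p v\<close>, where \<open>vert p v\<close> involves \<open>v\<close> only
  through the \<open>\<omega>\<^sup>\<sigma>\<^sub>J(v)\<close> and \<open>horiz p v\<close> only through the \<open>dx\<^sup>i(v)\<close>; the terms with exactly \<open>k\<close>
  factors \<open>\<omega>\<^sup>\<sigma>\<^sub>J\<close> are those with \<open>k\<close> vertical arguments. See \<open>contact_decomposition\<close> and
  \<open>contact_component_pure\<close> below.\<close>

definition contact_component :: "nat \<Rightarrow> ('n::finite, 'm::finite) form \<Rightarrow> ('n, 'm) form"
  where "contact_component k \<rho> p vs =
    (\<Sum>S | S \<subseteq> {..<length vs} \<and> card S = k.
      \<rho> p (map (\<lambda>j. if j \<in> S then vert p (vs ! j) else horiz p (vs ! j)) [0..<length vs]))"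

definition multilinear_form :: "nat \<Rightarrow> ('n::finite, 'm::finite) form \<Rightarrow> bool"
  where "multilinear_form q \<rho> \<longleftrightarrow>
    (\<forall>p vs j. length vs = q \<and> j < q \<longrightarrow> linear (\<lambda>v. \<rho> p (vs[j := v])))"

lemma horiz_eq: "horiz p v = (fst v, \<lambda>J. \<chi> \<sigma>. \<Sum>i\<in>UNIV. snd p (add_mset i J) $ \<sigma> * fst v $ i)"
proof (rule prod_eqI)
  show "fst (horiz p v) = fst (fst v, \<lambda>J. \<chi> \<sigma>. \<Sum>i\<in>UNIV. snd p (add_mset i J) $ \<sigma> * fst v $ i)"
    by (simp add: horiz_def total_def fst_sum vec_eq_iff axis_def if_distrib cong: if_cong)
  have fun_sum: "(\<Sum>i\<in>A. f i) J = (\<Sum>i\<in>A. f i J)" if "finite A" for A :: "'a set" and f :: "'a \<Rightarrow> 'a multiset \<Rightarrow> real^'b" and J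
    using that by (induction rule: finite_induct) auto
  show "snd (horiz p v) = snd (fst v, \<lambda>J. \<chi> \<sigma>. \<Sum>i\<in>UNIV. snd p (add_mset i J) $ \<sigma> * fst v $ i)"
    by (simp add: horiz_def total_def snd_sum fun_eq_iff vec_eq_iff fun_sum scaleR_fun_def mult.commute)
qed

lemma vert_plus_horiz: "vert p v + horiz p v = v"
  by (rule prod_eqI)
     (simp_all add: vert_def horiz_eq contact_form_def fun_eq_iff vec_eq_iff)

lemma contact_decomposition:
  assumes "multilinear_form q \<rho>" and len: "length vs = q"
  shows "(\<Sum>k\<le>q. contact_component k \<rho> p vs) = \<rho> p vs"
proof -
  define us where "us S m = map (\<lambda>j. if j \<in> S then vert p (vs ! j) else if j < m then horiz p (vs ! j) else vs ! j) [0..<q]"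
    for S and m :: nat
  have us_len: "length (us S m) = q" for S m by (simp add: us_def)
  have add: "\<rho> p (ws[j := a + b]) = \<rho> p (ws[j := a]) + \<rho> p (ws[j := b])"
    if "length ws = q" "j < q" for ws j a b
  proof -
    have "linear (\<lambda>v. \<rho> p (ws[j := v]))"
      using assms(1) that unfolding multilinear_form_def by blast
    then show ?thesis by (rule linear_add)
  qed
  have main: "(\<Sum>S\<in>Pow {..<m}. \<rho> p (us S m)) = \<rho> p vs" if "m \<le> q" for m
    using that
  proof (induction m)
    case 0
    have "us {} 0 = vs" by (rule nth_equalityI) (simp_all add: us_def len)
    then show ?case by simp
  next
    case (Suc m)
    have split: "\<rho> p (us S m) = \<rho> p (us (insert m S) (Suc m)) + \<rho> p (us S (Suc m))"
      if S: "S \<subseteq> {..<m}" for S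
    proof -
      have m: "m \<notin> S" using S by auto
      have "us S m = (us S m)[m := vert p (vs ! m) + horiz p (vs ! m)]"
        using Suc.prems m unfolding vert_plus_horiz
        by (intro nth_equalityI) (auto simp: us_def nth_list_update)
      moreover have "(us S m)[m := vert p (vs ! m)] = us (insert m S) (Suc m)"
        using Suc.prems by (intro nth_equalityI) (auto simp: us_def nth_list_update)
      moreover have "(us S m)[m := horiz p (vs ! m)] = us S (Suc m)"
        using Suc.prems m by (intro nth_equalityI) (auto simp: us_def nth_list_update)
      ultimately show ?thesis
        using add[OF us_len, of m S m] Suc.prems by (metis Suc_le_lessD)
    qed
    have "(\<Sum>S\<in>Pow {..<Suc m}. \<rho> p (us S (Suc m))) =
      (\<Sum>S\<in>Pow {..<m}. \<rho> p (us S (Suc m))) + (\<Sum>S\<in>insert m ` Pow {..<m}. \<rho> p (us S (Suc m)))"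
      unfolding lessThan_Suc Pow_insert by (rule sum.union_disjoint) auto
    also have "(\<Sum>S\<in>insert m ` Pow {..<m}. \<rho> p (us S (Suc m))) =
      (\<Sum>S\<in>Pow {..<m}. \<rho> p (us (insert m S) (Suc m)))"
      by (rule sum.reindex[unfolded o_def]) (auto simp: inj_on_def)
    also have "(\<Sum>S\<in>Pow {..<m}. \<rho> p (us S (Suc m))) + (\<Sum>S\<in>Pow {..<m}. \<rho> p (us (insert m S) (Suc m)))
      = (\<Sum>S\<in>Pow {..<m}. \<rho> p (us S m))"
      by (simp add: sum.distrib[symmetric] split add.commute)
    finally show ?case using Suc by simp
  qed
  have "(\<Sum>k\<le>q. contact_component k \<rho> p vs) =
      (\<Sum>k\<le>q. \<Sum>S | S \<in> Pow {..<q} \<and> card S = k. \<rho> p (us S q))"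
    unfolding contact_component_def us_def len
    by (intro sum.cong refl arg_cong[where f = "\<rho> p"] map_cong) auto
  also have "\<dots> = (\<Sum>S\<in>Pow {..<q}. \<rho> p (us S q))"
    by (rule sum.group) (auto simp: subset_eq_atLeast0_lessThan_card lessThan_atLeast0)
  finally show ?thesis using main[of q] by simp
qed

lemma contact_component_pure:
  assumes "multilinear_form q \<rho>" and len: "length vs = q" and A: "A \<subseteq> {..<q}"
    and "\<And>j. j \<in> A \<Longrightarrow> horiz p (vs ! j) = 0" and "\<And>j. j < q \<Longrightarrow> j \<notin> A \<Longrightarrow> vert p (vs ! j) = 0"
  shows "contact_component k \<rho> p vs = (if card A = k then \<rho> p vs else 0)"
proof -
  define us where "us S = map (\<lambda>j. if j \<in> S then vert p (vs ! j) else horiz p (vs ! j)) [0..<q]" for S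
  have zero: "\<rho> p ws = 0" if "length ws = q" "j < q" "ws ! j = 0" for ws j
  proof -
    have "linear (\<lambda>v. \<rho> p (ws[j := v]))"
      using assms(1) that unfolding multilinear_form_def by blast
    from linear_0[OF this] show ?thesis using that(3) by (metis list_update_id)
  qed
  have "\<rho> p (us S) = 0" if S: "S \<subseteq> {..<q}" "S \<noteq> A" for S
  proof -
    obtain j where "j < q" "j \<in> S \<longleftrightarrow> j \<notin> A" using S A by blast
    then have "us S ! j = 0" using assms(4,5) by (auto simp: us_def)
    then show ?thesis using zero[of "us S" j] \<open>j < q\<close> by (simp add: us_def)
  qed
  moreover have "us A = vs"
  proof (rule nth_equalityI)
    fix j assume "j < length (us A)"
    then show "us A ! j = vs ! j"
      using assms(4,5) vert_plus_horiz[of p "vs ! j"] by (auto simp: us_def)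
  qed (simp add: us_def len)
  moreover have "finite {S. S \<subseteq> {..<q} \<and> card S = k}"
    by (rule finite_subset[of _ "Pow {..<q}"]) auto
  ultimately have "(\<Sum>S | S \<subseteq> {..<q} \<and> card S = k. \<rho> p (us S)) =
      (\<Sum>S | S \<subseteq> {..<q} \<and> card S = k. if S = A then \<rho> p vs else 0)"
    by (intro sum.cong) auto
  also have "\<dots> = (if card A = k then \<rho> p vs else 0)"
    using A \<open>finite {S. S \<subseteq> {..<q} \<and> card S = k}\<close> by simp
  finally show ?thesis by (simp add: contact_component_def us_def len)
qed


section \<open>The interior Euler operator\<close>

definition unit_vertical :: "'m::finite \<Rightarrow> 'n::finite multiset \<Rightarrow> ('n, 'm) jet"
  where "unit_vertical \<sigma> M = (0, \<lambda>N. if N = M then axis \<sigma> 1 else 0)"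

text \<open>\<open>\<partial>/\<partial>y\<^sup>\<sigma>\<^sub>I\<close> for an ordered multi-index \<open>I = (i\<^sub>1, \<dots>, i\<^sub>s)\<close>, multiplied by the factor
  \<open>I(1)! \<cdots> I(n)! / s!\<close>, with \<open>I(k)\<close> the number of entries \<open>k\<close>, which compensates for the
  repetitions in sums over all ordered multi-indices.\<close>

definition d_dy :: "'m::finite \<Rightarrow> 'n::finite list \<Rightarrow> ('n, 'm) vfield"
  where "d_dy \<sigma> I p =
    ((\<Prod>k\<in>UNIV. fact (count_list I k)) / fact (length I)) *\<^sub>R unit_vertical \<sigma> (mset I)"

definition lie_total :: "'n::finite list \<Rightarrow> ('n, 'm::finite) form \<Rightarrow> ('n, 'm) form"
  where "lie_total I \<rho> = foldr (\<lambda>i. lie (total i)) I \<rho>"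

text \<open>\<open>\<I>(\<rho>)\<close> for an \<open>(n + k)\<close>-form \<open>\<rho>\<close>. The first sum on the right-hand side runs over all lists
  (\<open>Sum_any\<close>); for forms of finite order only finitely many terms are nonzero.\<close>

definition interior_Euler :: "nat \<Rightarrow> ('n::finite, 'm::finite) form \<Rightarrow> ('n, 'm) form"
  where "interior_Euler k \<rho> p vs = 1 / real k *
    (\<Sum>\<sigma>\<in>UNIV. wedge1 (contact_form \<sigma> {#})
      (\<lambda>q ws. Sum_any (\<lambda>I. (-1) ^ length I * lie_total I (contract (d_dy \<sigma> I) (contact_component k \<rho>)) q ws))
      p vs)"

text \<open>The Euler--Lagrange form \<open>E\<^sub>n(\<lambda>)\<close>.\<close>

definition E_n :: "('n::finite, 'm::finite) form \<Rightarrow> ('n, 'm) form"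
  where "E_n \<mu> = interior_Euler 1 (dext \<mu>)"

text \<open>The coefficients \<open>\<eta>\<^sub>\<sigma>\<close> of \<open>\<eta> = \<eta>\<^sub>\<sigma> \<omega>\<^sup>\<sigma> \<and> ds\<close>.\<close>

definition source_coeff :: "('n::finite, 'm::finite) form \<Rightarrow> 'm \<Rightarrow> ('n, 'm) jet \<Rightarrow> real"
  where "source_coeff \<eta> \<sigma> p =
    \<eta> p (unit_vertical \<sigma> {#} # map (\<lambda>k. (axis (inv coord_no k) 1, 0)) [0..<CARD('n)])"


section \<open>Prolongation, extremals and the Jacobi morphism\<close>

definition total_deriv :: "'n::finite list \<Rightarrow> (('n, 'm::finite) jet \<Rightarrow> 'b::real_normed_vector) \<Rightarrow> ('n, 'm) jet \<Rightarrow> 'b"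
  where "total_deriv I F = foldr (\<lambda>i G p. dirderiv (total i p) G p) I F"

text \<open>The prolongation \<open>\<Sum>\<^sub>J d\<^sub>J \<Xi>\<^sup>\<sigma> \<partial>/\<partial>y\<^sup>\<sigma>\<^sub>J\<close> (\<open>J\<close> unordered) of a vertical vector field with
  components \<open>\<Xi>\<^sup>\<sigma>\<close>, to infinite order; it projects to \<open>J\<^sup>k\<Xi>\<close> for all \<open>k\<close>.\<close>

definition prolong :: "((real^'n) \<times> (real^'m) \<Rightarrow> real^'m) \<Rightarrow> ('n::finite, 'm::finite) vfield"
  where "prolong \<Xi> p = (0, \<lambda>M. total_deriv (list_of M) (\<lambda>q. \<Xi> (fst q, snd q {#})) p)"

definition extremal ::
  "'x topology \<Rightarrow> ('x, real^'n) chart set \<Rightarrow> 'y topology \<Rightarrow> ('y, (real^'n) \<times> (real^'m)) chart set \<Rightarrow>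
    ('y \<Rightarrow> 'x) \<Rightarrow> (('x, 'y, 'n::finite, 'm::finite) fchart \<Rightarrow> ('n, 'm) jet \<Rightarrow> real) \<Rightarrow> 'x set \<Rightarrow> ('x \<Rightarrow> 'y) \<Rightarrow> bool"
  where "extremal X AX Y AY \<pi> L W \<gamma> \<longleftrightarrow> local_section X AX Y AY \<pi> W \<gamma> \<and>
    (\<forall>c\<in>fibered_charts AX AY \<pi>. \<forall>x\<in>section_dom c W \<gamma>. \<forall>\<sigma>.
      source_coeff (E_n (lagrange_form (L c))) \<sigma> (jet_prolong (section_rep c \<gamma>) x) = 0)"

definition Jacobi_morphism ::
  "('n::finite, 'm::finite) form \<Rightarrow> ((real^'n) \<times> (real^'m) \<Rightarrow> real^'m) \<Rightarrow> ('n, 'm) form"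
  where "Jacobi_morphism \<mu> \<Xi> = E_n (contract (prolong \<Xi>) (E_n \<mu>))"

text \<open>Linear differential operators along a section with coordinate expression \<open>g\<close>:
  \<open>\<nabla>(\<Xi>) = \<Sum>\<^sub>J A\<^sup>J\<^sub>\<tau>\<^sub>\<sigma> d\<^sub>J(\<Xi>\<^sup>\<tau>) \<omega>\<^sup>\<sigma> \<otimes> ds\<close> and its adjoint
  \<open>\<nabla>\<^sup>*(\<Xi>) = \<Sum>\<^sub>J (-1)\<^sup>|\<^sup>J\<^sup>| d\<^sub>J(A\<^sup>J\<^sub>\<tau>\<^sub>\<sigma> \<Xi>\<^sup>\<sigma>) \<omega>\<^sup>\<tau> \<otimes> ds\<close>, by their components. The coefficients are functions
  of the base coordinates, being evaluated along the section, so that the total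
  derivatives become partial derivatives. \<open>A J \<tau> \<sigma>\<close> is \<open>A\<^sup>J\<^sub>\<tau>\<^sub>\<sigma>\<close>, and \<open>N\<close> is the order.\<close>

definition diffop ::
  "nat \<Rightarrow> ('n list \<Rightarrow> 'm \<Rightarrow> 'm \<Rightarrow> real^'n \<Rightarrow> real) \<Rightarrow> (real^'n \<Rightarrow> real^'m) \<Rightarrow>
    ((real^'n) \<times> (real^'m) \<Rightarrow> real^'m) \<Rightarrow> 'm::finite \<Rightarrow> real^'n::finite \<Rightarrow> real"
  where "diffop N A g \<Xi> \<sigma> x =
    (\<Sum>J | length J \<le> N. \<Sum>\<tau>\<in>UNIV. A J \<tau> \<sigma> x * partial J (\<lambda>z. \<Xi> (z, g z) $ \<tau>) x)"

definition adjoint_diffop ::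
  "nat \<Rightarrow> ('n list \<Rightarrow> 'm \<Rightarrow> 'm \<Rightarrow> real^'n \<Rightarrow> real) \<Rightarrow> (real^'n \<Rightarrow> real^'m) \<Rightarrow>
    ((real^'n) \<times> (real^'m) \<Rightarrow> real^'m) \<Rightarrow> 'm::finite \<Rightarrow> real^'n::finite \<Rightarrow> real"
  where "adjoint_diffop N A g \<Xi> \<tau> x =
    (\<Sum>J | length J \<le> N. (-1) ^ length J * (\<Sum>\<sigma>\<in>UNIV. partial J (\<lambda>z. A J \<tau> \<sigma> z * \<Xi> (z, g z) $ \<sigma>) x))"

text \<open>\<open>P\<close> acts on the vertical vector fields over a fibered chart with image \<open>S\<close> and is evaluated
  along the section \<open>g\<close> on \<open>D\<close>: it is a linear differential operator and coincides with its
  adjoint.\<close>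

definition self_adjoint_along ::
  "((real^'n) \<times> (real^'m)) set \<Rightarrow> (real^'n) set \<Rightarrow> (real^'n \<Rightarrow> real^'m) \<Rightarrow>
    (((real^'n) \<times> (real^'m) \<Rightarrow> real^'m) \<Rightarrow> 'm::finite \<Rightarrow> real^'n::finite \<Rightarrow> real) \<Rightarrow> bool"
  where "self_adjoint_along S D g P \<longleftrightarrow>
    (\<exists>N A. (\<forall>J \<tau> \<sigma>. smooth_on D (A J \<tau> \<sigma>)) \<and>
      (\<forall>\<Xi>. smooth_on S \<Xi> \<longrightarrow> (\<forall>\<sigma>. \<forall>x\<in>D. P \<Xi> \<sigma> x = diffop N A g \<Xi> \<sigma> x)) \<and>
      (\<forall>\<Xi>. smooth_on S \<Xi> \<longrightarrow> (\<forall>\<sigma>. \<forall>x\<in>D. diffop N A g \<Xi> \<sigma> x = adjoint_diffop N A g \<Xi> \<sigma> x)))"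

end

theory Submission
  imports Defs "HOL-Combinatorics.Multiset_Permutations"
begin

text \<open>Write \<open>D\<^sup>M\<^sub>\<sigma>\<close> for \<open>\<partial>/\<partial>y\<^sup>\<sigma>\<^sub>M\<close> and put \<open>P\<^sub>\<sigma>(Q; b) = \<Sum>\<^sub>M (-1)\<^sup>|\<^sup>M\<^sup>| d\<^sub>M (D\<^sup>M\<^sub>\<sigma> Q \<cdot> b)\<close>. The commutation rule
  \<open>D\<^sup>M\<^sub>\<sigma> d\<^sub>i = d\<^sub>i D\<^sup>M\<^sub>\<sigma> + D\<^sup>M\<^sup>-\<^sup>i\<^sub>\<sigma>\<close> gives \<open>P\<^sub>\<sigma>(d\<^sub>i Q; b) = - P\<^sub>\<sigma>(Q; d\<^sub>i b)\<close>. Applied to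
  \<open>E\<^sub>\<tau> = \<Sum>\<^sub>K (-1)\<^sup>|\<^sup>K\<^sup>| d\<^sub>K D\<^sup>K\<^sub>\<tau> L\<close> it yields, for arbitrary \<open>Q\<^sup>\<tau>\<close> and the evolutionary field
  \<open>X\<^sub>Q = \<Sum> d\<^sub>K Q\<^sup>\<tau> D\<^sup>K\<^sub>\<tau>\<close>, which commutes with the total derivatives,
  \<open>\<Sum>\<^sub>\<tau> P\<^sub>\<sigma>(E\<^sub>\<tau>; Q\<^sup>\<tau>) = \<Sum> P\<^sub>\<sigma>(D\<^sup>K\<^sub>\<tau> L; d\<^sub>K Q\<^sup>\<tau>) = \<Sum>\<^sub>M (-1)\<^sup>|\<^sup>M\<^sup>| d\<^sub>M X\<^sub>Q D\<^sup>M\<^sub>\<sigma> L = X\<^sub>Q E\<^sub>\<sigma>\<close>,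
  i.e. the linearization of the Euler--Lagrange operator is self-adjoint. The coefficient of
  \<open>\<I>(J\<Xi> \<rfloor> d\<I>(d\<lambda>))\<close> is \<open>X\<^sub>\<Xi> E\<^sub>\<sigma> - \<Sum>\<^sub>\<tau> P\<^sub>\<sigma>(E\<^sub>\<tau>; \<Xi>\<^sup>\<tau>)\<close>, hence zero, already before
  contracting with \<open>\<Xi>\<^sub>2\<close>. The coefficient of \<open>\<J>\<^sub>\<Xi>(\<lambda>)\<close> is
  \<open>\<Sum>\<^sub>\<tau> P\<^sub>\<sigma>(\<Xi>\<^sup>\<tau>; E\<^sub>\<tau>) + \<Sum>\<^sub>\<tau> P\<^sub>\<sigma>(E\<^sub>\<tau>; \<Xi>\<^sup>\<tau>)\<close>; since \<open>\<Xi>\<close> has order zero the first sum is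
  \<open>\<partial>\<Xi>\<^sup>\<tau>/\<partial>y\<^sup>\<sigma> E\<^sub>\<tau>\<close>, which vanishes along extremals, and the second is both \<open>X\<^sub>\<Xi> E\<^sub>\<sigma>\<close> and its
  adjoint.\<close>

section \<open>Calculus of directional derivatives\<close>

text \<open>Infinite jets carry the product topology and no norm, so the calculus rests on the one
  continuity property that lines need: \<open>a + c *\<^sub>R b\<close> is jointly continuous in
  \<open>a\<close> and \<open>c\<close> for fixed \<open>b\<close>. Normed spaces, products and
  function spaces have it, which covers the type of jets.\<close>

class real_tvs = real_vector + topological_space +
  assumes tendsto_add_scaleR_Pair:
    "((\<lambda>z. fst z + snd z *\<^sub>R b) \<longlongrightarrow> a + c *\<^sub>R b) (nhds a \<times>\<^sub>F nhds (c::real))"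

lemma tendsto_add_scaleR:
  fixes a b :: "'a::real_tvs"
  assumes "(f \<longlongrightarrow> a) F" "(c \<longlongrightarrow> k) F"
  shows "((\<lambda>t. f t + c t *\<^sub>R b) \<longlongrightarrow> a + k *\<^sub>R b) F"
  using filterlim_compose[OF tendsto_add_scaleR_Pair filterlim_Pair[OF assms]] by simp

instance real_normed_vector \<subseteq> real_tvs
proof
  fix a b :: 'a and c :: real
  have "((\<lambda>z::'a \<times> real. fst z + snd z *\<^sub>R b) \<longlongrightarrow> fst (a, c) + snd (a, c) *\<^sub>R b) (nhds (a, c))"
    by (intro tendsto_intros filterlim_ident)
  then show "((\<lambda>z::'a \<times> real. fst z + snd z *\<^sub>R b) \<longlongrightarrow> a + c *\<^sub>R b) (nhds a \<times>\<^sub>F nhds c)"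
    by (simp add: nhds_prod)
qed

instance prod :: (real_tvs, real_tvs) real_tvs
proof
  fix a b :: "'a \<times> 'b" and c :: real
  have 1: "filterlim (\<lambda>z. fst (fst z)) (nhds (fst a)) (nhds a \<times>\<^sub>F nhds c)"
    by (rule tendsto_fst) (rule filterlim_fst)
  have 2: "filterlim (\<lambda>z. snd (fst z)) (nhds (snd a)) (nhds a \<times>\<^sub>F nhds c)"
    by (rule tendsto_snd) (rule filterlim_fst)
  have "((\<lambda>z. (fst (fst z) + snd z *\<^sub>R fst b, snd (fst z) + snd z *\<^sub>R snd b)) \<longlongrightarrow>
     (fst a + c *\<^sub>R fst b, snd a + c *\<^sub>R snd b)) (nhds a \<times>\<^sub>F nhds c)"
    by (intro tendsto_Pair tendsto_add_scaleR 1 2 filterlim_snd)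
  then show "((\<lambda>z. fst z + snd z *\<^sub>R b) \<longlongrightarrow> a + c *\<^sub>R b) (nhds a \<times>\<^sub>F nhds c)"
    by (simp add: prod_eq_iff plus_prod_def scaleR_prod_def)
qed

lemma tendsto_fun_iff:
  fixes f :: "'c \<Rightarrow> 'i \<Rightarrow> 'b::topological_space"
  shows "(f \<longlongrightarrow> l) F \<longleftrightarrow> (\<forall>i. ((\<lambda>x. f x i) \<longlongrightarrow> l i) F)"
  using limitin_componentwise[of "\<lambda>_. euclidean" UNIV f l F]
  by (simp add: euclidean_product_topology)

instance "fun" :: (type, real_tvs) real_tvs
proof
  fix a b :: "'a \<Rightarrow> 'b" and c :: real
  show "((\<lambda>z. fst z + snd z *\<^sub>R b) \<longlongrightarrow> a + c *\<^sub>R b) (nhds a \<times>\<^sub>F nhds c)"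
    unfolding tendsto_fun_iff plus_fun_apply scaleR_fun_def
    using filterlim_fst[of "nhds a" "nhds c", unfolded tendsto_fun_iff]
    by (auto intro!: tendsto_add_scaleR filterlim_snd)
qed

lemma eventually_line_in:
  fixes S :: "'a::real_tvs set"
  assumes "open S" "p + t0 *\<^sub>R v \<in> S"
  shows "\<forall>\<^sub>F t in nhds t0. p + t *\<^sub>R v \<in> S"
proof -
  have "((\<lambda>t. p + t *\<^sub>R v) \<longlongrightarrow> p + t0 *\<^sub>R v) (nhds t0)"
    by (intro tendsto_add_scaleR tendsto_const filterlim_ident)
  then show ?thesis using assms by (rule topological_tendstoD)
qed

section \<open>Locality of directional derivatives and closure properties of smooth
  functions\<close>

lemma dirderiv_cong:
  fixes S :: "'a::real_tvs set"
  assumes "open S" "\<And>q. q \<in> S \<Longrightarrow> f q = g q" "p \<in> S"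
  shows "dirderiv v f p = dirderiv v g p"
proof -
  have "\<forall>\<^sub>F t in nhds 0. p + t *\<^sub>R v \<in> S"
    using eventually_line_in[OF assms(1), of p 0 v] assms(3) by simp
  then have "\<forall>\<^sub>F t in nhds 0. f (p + t *\<^sub>R v) = g (p + t *\<^sub>R v)"
    by eventually_elim (rule assms(2))
  then show ?thesis unfolding dirderiv_def
    by (intro vector_derivative_cong_eq) simp_all
qed

lemma differentiable_line_cong:
  fixes S :: "'a::real_tvs set" and f g :: "'a \<Rightarrow> 'b::real_normed_vector"
  assumes "open S" "\<And>q. q \<in> S \<Longrightarrow> f q = g q" "p \<in> S"
    and "(\<lambda>t::real. f (p + t *\<^sub>R v)) differentiable (at 0)"
  shows "(\<lambda>t::real. g (p + t *\<^sub>R v)) differentiable (at 0)"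
proof -
  have "\<forall>\<^sub>F t in nhds 0. p + t *\<^sub>R v \<in> S"
    using eventually_line_in[OF assms(1), of p 0 v] assms(3) by simp
  then have ev: "\<forall>\<^sub>F t in nhds 0. f (p + t *\<^sub>R v) = g (p + t *\<^sub>R v)"
    by eventually_elim (rule assms(2))
  obtain D where "((\<lambda>t::real. f (p + t *\<^sub>R v)) has_vector_derivative D) (at 0)"
    using assms(4) by (meson vector_derivative_works)
  then have "((\<lambda>t::real. g (p + t *\<^sub>R v)) has_vector_derivative D) (at 0)"
    using has_vector_derivative_cong_ev[of UNIV "\<lambda>t. f (p + t *\<^sub>R v)" "\<lambda>t. g (p + t *\<^sub>R v)" 0 D] ev
      assms(2,3) by simp
  then show ?thesis by (rule differentiableI_vector)
qed

text \<open>\<open>dirderiv v f\<close> is a total function, and the sum, product and linearity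
  rules for it are known on \<open>S\<close> only. The closure lemmas below replace it by such a
  formula through this congruence.\<close>

lemma Ck_on_cong:
  fixes S :: "'a::real_tvs set" and f g :: "'a \<Rightarrow> 'b::real_normed_vector"
  assumes "open S" "\<And>q. q \<in> S \<Longrightarrow> f q = g q" "Ck_on k S f"
  shows "Ck_on k S g"
  using assms(2,3)
proof (induction k arbitrary: f g)
  case 0
  then show ?case using continuous_on_cong[of S S f g] by simp
next
  case (Suc k)
  have "continuous_on S g" using Suc.prems continuous_on_cong[of S S f g] by simp
  moreover have "Ck_on k S (dirderiv v g)" for v
    using Suc.prems(2) Suc.IH[of "dirderiv v f" "dirderiv v g"] dirderiv_cong[OF assms(1) Suc.prems(1)]
    by simp
  ultimately show ?case
    using Suc.prems by (auto intro: differentiable_line_cong[OF assms(1), of f g])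
qed

lemma smooth_on_cong:
  fixes S :: "'a::real_tvs set"
  assumes "open S" "\<And>q. q \<in> S \<Longrightarrow> f q = g q" "smooth_on S f"
  shows "smooth_on S g"
  using assms Ck_on_cong unfolding smooth_on_def by blast

lemma Ck_on_Suc_imp: "Ck_on (Suc k) S f \<Longrightarrow> Ck_on k S f"
  by (induction k arbitrary: f) auto

lemma smooth_on_continuous_on: "smooth_on S f \<Longrightarrow> continuous_on S f"
  unfolding smooth_on_def by (metis Ck_on.simps(1))

lemma smooth_on_dirderiv: "smooth_on S f \<Longrightarrow> smooth_on S (dirderiv v f)"
  unfolding smooth_on_def by (metis Ck_on.simps(2))

lemma Ck_on_has_vector_derivative:
  "Ck_on (Suc k) S f \<Longrightarrow> p \<in> S \<Longrightarrow> ((\<lambda>t. f (p + t *\<^sub>R v)) has_vector_derivative dirderiv v f p) (at 0)"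
  unfolding dirderiv_def by (simp add: vector_derivative_works)

lemma smooth_on_has_vector_derivative:
  "smooth_on S f \<Longrightarrow> p \<in> S \<Longrightarrow> ((\<lambda>t. f (p + t *\<^sub>R v)) has_vector_derivative dirderiv v f p) (at 0)"
  unfolding smooth_on_def using Ck_on_has_vector_derivative by blast

lemma smooth_on_has_real_derivative:
  fixes f :: "'a::real_tvs \<Rightarrow> real"
  assumes "smooth_on S f" "p + t *\<^sub>R v \<in> S"
  shows "((\<lambda>t. f (p + t *\<^sub>R v)) has_real_derivative dirderiv v f (p + t *\<^sub>R v)) (at t)"
proof -
  have "((\<lambda>s. f ((p + t *\<^sub>R v) + s *\<^sub>R v)) has_real_derivative dirderiv v f (p + t *\<^sub>R v)) (at 0)"
    using smooth_on_has_vector_derivative[OF assms]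
    by (simp add: has_real_derivative_iff_has_vector_derivative)
  moreover have "(p + t *\<^sub>R v) + s *\<^sub>R v = p + (s + t) *\<^sub>R v" for s
    by (simp add: algebra_simps)
  ultimately have "((\<lambda>s. f (p + (s + t) *\<^sub>R v)) has_real_derivative dirderiv v f (p + t *\<^sub>R v)) (at 0)"
    by simp
  then show ?thesis
    using DERIV_shift[of "\<lambda>s. f (p + s *\<^sub>R v)" "dirderiv v f (p + t *\<^sub>R v)" 0 t] by (simp add: add.commute)
qed

lemma smooth_on_has_real_derivative0:
  fixes f :: "'a::real_tvs \<Rightarrow> real"
  assumes "smooth_on S f" "p \<in> S"
  shows "((\<lambda>t. f (p + t *\<^sub>R v)) has_real_derivative dirderiv v f p) (at 0)"
  using smooth_on_has_real_derivative[OF assms(1), of p 0 v] assms(2) by simp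

lemma dirderiv_eqI: "((\<lambda>t. f (p + t *\<^sub>R v)) has_vector_derivative d) (at 0) \<Longrightarrow> dirderiv v f p = d"
  unfolding dirderiv_def by (rule vector_derivative_at)

lemma dirderiv_const [simp]: "dirderiv v (\<lambda>_. c) = (\<lambda>_. 0)"
  by (intro ext dirderiv_eqI) simp

lemma Ck_on_const: "Ck_on k S (\<lambda>_. c)"
  by (induction k arbitrary: c) simp_all

lemma smooth_on_const [simp]: "smooth_on S (\<lambda>_. c)"
  by (simp add: smooth_on_def Ck_on_const)

lemma Ck_on_add:
  fixes S :: "'a::real_tvs set" and f g :: "'a \<Rightarrow> 'b::real_normed_vector"
  assumes "open S" "Ck_on k S f" "Ck_on k S g"
  shows "Ck_on k S (\<lambda>x. f x + g x)"
  using assms(2,3)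
proof (induction k arbitrary: f g)
  case 0
  then show ?case by (simp add: continuous_on_add)
next
  case (Suc k)
  have *: "((\<lambda>t. f (p + t *\<^sub>R v) + g (p + t *\<^sub>R v)) has_vector_derivative dirderiv v f p + dirderiv v g p) (at 0)"
    if "p \<in> S" for p v
    using Suc.prems that by (intro has_vector_derivative_add Ck_on_has_vector_derivative)
  have "Ck_on k S (dirderiv v (\<lambda>x. f x + g x))" for v
    by (rule Ck_on_cong[OF assms(1), of "\<lambda>x. dirderiv v f x + dirderiv v g x"])
      (use Suc * in \<open>auto simp: dirderiv_eqI[OF *]\<close>)
  then show ?case using Suc.prems *
    by (auto intro: continuous_on_add differentiableI_vector)
qed

lemma Ck_on_mult:
  fixes S :: "'a::real_tvs set" and f g :: "'a \<Rightarrow> real"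
  assumes "open S" "Ck_on k S f" "Ck_on k S g"
  shows "Ck_on k S (\<lambda>x. f x * g x)"
  using assms(2,3)
proof (induction k arbitrary: f g)
  case 0
  then show ?case by (simp add: continuous_on_mult)
next
  case (Suc k)
  have *: "((\<lambda>t. f (p + t *\<^sub>R v) * g (p + t *\<^sub>R v)) has_vector_derivative
      f p * dirderiv v g p + dirderiv v f p * g p) (at 0)"
    if "p \<in> S" for p v
    using has_vector_derivative_mult[OF Ck_on_has_vector_derivative[OF Suc.prems(1) that, of v]
      Ck_on_has_vector_derivative[OF Suc.prems(2) that, of v]] by simp
  have "Ck_on k S (dirderiv v (\<lambda>x. f x * g x))" for v
  proof (rule Ck_on_cong[OF assms(1)])
    \<comment> \<open>The factors that are not differentiated are of class \<open>Suc k\<close> and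
      are lowered to class \<open>k\<close> before the induction hypothesis applies.\<close>
    show "Ck_on k S (\<lambda>x. f x * dirderiv v g x + dirderiv v f x * g x)"
      using Suc.prems Ck_on_Suc_imp[OF Suc.prems(1)] Ck_on_Suc_imp[OF Suc.prems(2)]
      by (intro Ck_on_add[OF assms(1)] Suc.IH) auto
  qed (simp add: dirderiv_eqI[OF *])
  then show ?case using Suc.prems *
    by (auto intro: continuous_on_mult differentiableI_vector)
qed

lemma Ck_on_bounded_linear:
  fixes S :: "'a::real_tvs set"
  assumes "open S" "bounded_linear h" "Ck_on k S f"
  shows "Ck_on k S (\<lambda>x. h (f x))"
  using assms(3)
proof (induction k arbitrary: f)
  case 0
  then show ?case using bounded_linear.continuous_on[OF assms(2)] by simp
next
  case (Suc k)
  have *: "((\<lambda>t. h (f (p + t *\<^sub>R v))) has_vector_derivative h (dirderiv v f p)) (at 0)"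
    if "p \<in> S" for p v
    using Suc.prems that
    by (intro bounded_linear.has_vector_derivative[OF assms(2)] Ck_on_has_vector_derivative)
  have "Ck_on k S (dirderiv v (\<lambda>x. h (f x)))" for v
    by (rule Ck_on_cong[OF assms(1), of "\<lambda>x. h (dirderiv v f x)"])
      (use Suc * in \<open>auto simp: dirderiv_eqI[OF *]\<close>)
  then show ?case using Suc.prems *
    by (auto intro: bounded_linear.continuous_on[OF assms(2)] differentiableI_vector)
qed

lemma smooth_on_add: "open S \<Longrightarrow> smooth_on S f \<Longrightarrow> smooth_on S g \<Longrightarrow> smooth_on S (\<lambda>x. f x + g x)"
  for S :: "'a::real_tvs set"
  by (simp add: smooth_on_def Ck_on_add)

lemma smooth_on_mult: "open S \<Longrightarrow> smooth_on S f \<Longrightarrow> smooth_on S g \<Longrightarrow> smooth_on S (\<lambda>x. f x * g x)"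
  for S :: "'a::real_tvs set" and f g :: "'a \<Rightarrow> real"
  by (simp add: smooth_on_def Ck_on_mult)

lemma smooth_on_bounded_linear:
  "open S \<Longrightarrow> bounded_linear h \<Longrightarrow> smooth_on S f \<Longrightarrow> smooth_on S (\<lambda>x. h (f x))"
  for S :: "'a::real_tvs set"
  by (simp add: smooth_on_def Ck_on_bounded_linear)

lemma smooth_on_uminus: "open S \<Longrightarrow> smooth_on S f \<Longrightarrow> smooth_on S (\<lambda>x. - f x)"
  for S :: "'a::real_tvs set"
  by (rule smooth_on_bounded_linear[where h = uminus]) (auto intro: bounded_linear_minus bounded_linear_ident)

lemma dirderiv_add:
  "smooth_on S f \<Longrightarrow> smooth_on S g \<Longrightarrow> p \<in> S \<Longrightarrow>
    dirderiv v (\<lambda>x. f x + g x) p = dirderiv v f p + dirderiv v g p"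
  by (intro dirderiv_eqI has_vector_derivative_add smooth_on_has_vector_derivative)

lemma dirderiv_mult:
  fixes f g :: "'a::real_tvs \<Rightarrow> real"
  assumes "smooth_on S f" "smooth_on S g" "p \<in> S"
  shows "dirderiv v (\<lambda>x. f x * g x) p = dirderiv v f p * g p + f p * dirderiv v g p"
  using has_vector_derivative_mult[OF smooth_on_has_vector_derivative[OF assms(1,3)]
      smooth_on_has_vector_derivative[OF assms(2,3)], of v v]
  by (intro dirderiv_eqI) (simp add: add.commute)

lemma dirderiv_bounded_linear:
  assumes "bounded_linear h" "smooth_on S f" "p \<in> S"
  shows "dirderiv v (\<lambda>x. h (f x)) p = h (dirderiv v f p)"
  by (intro dirderiv_eqI bounded_linear.has_vector_derivative[OF assms(1)]
    smooth_on_has_vector_derivative[OF assms(2,3)])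

lemma dirderiv_component:
  fixes f :: "'a::real_tvs \<Rightarrow> real^'m::finite"
  assumes "\<And>\<sigma>. smooth_on S (\<lambda>x. f x $ \<sigma>)" "p \<in> S"
  shows "dirderiv v f p $ \<sigma> = dirderiv v (\<lambda>x. f x $ \<sigma>) p"
proof -
  have "((\<lambda>t. f (p + t *\<^sub>R v) $ \<sigma>) has_vector_derivative dirderiv v (\<lambda>x. f x $ \<sigma>) p) (at 0)" for \<sigma>
    using assms by (rule smooth_on_has_vector_derivative)
  then have "((\<lambda>t. f (p + t *\<^sub>R v)) has_vector_derivative (\<chi> \<sigma>. dirderiv v (\<lambda>x. f x $ \<sigma>) p)) (at 0)"
    unfolding has_vector_derivative_def
    by (subst has_derivative_componentwise_within)
      (auto simp: Basis_vec_def inner_axis)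
  then show ?thesis by (simp add: dirderiv_eqI)
qed

section \<open>Chain rule and linearity in the direction\<close>

lemma dirderiv_increment:
  fixes S :: "'a::real_tvs set" and f :: "'a \<Rightarrow> real"
  assumes "open S" "smooth_on S f" "p \<in> S" "0 < \<epsilon>"
  obtains \<delta> where "0 < \<delta>"
    "\<forall>\<^sub>F q in nhds p. \<forall>c. \<bar>c\<bar> < \<delta> \<longrightarrow> \<bar>f (q + c *\<^sub>R b) - f q - c * dirderiv b f p\<bar> \<le> \<epsilon> * \<bar>c\<bar>"
proof -
  let ?D = "dirderiv b f"
  have cont: "continuous_on S ?D"
    using assms(2) by (intro smooth_on_continuous_on smooth_on_dirderiv)
  have "open (S \<inter> ?D -` ball (?D p) \<epsilon>)"
    by (rule continuous_open_preimage[OF cont assms(1)]) simp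
  moreover have "p \<in> S \<inter> ?D -` ball (?D p) \<epsilon>" using assms by simp
  moreover have "((\<lambda>z. fst z + snd z *\<^sub>R b) \<longlongrightarrow> p) (nhds p \<times>\<^sub>F nhds (0::real))"
    using tendsto_add_scaleR_Pair[of b p 0] by simp
  \<comment> \<open>Continuity of the derivative is used jointly in base point and step, so that the
    final estimate is uniform for base points \<open>q\<close> near \<open>p\<close>; the chain rule
    evaluates it at a moving point.\<close>
  ultimately have "\<forall>\<^sub>F z in nhds p \<times>\<^sub>F nhds (0::real). fst z + snd z *\<^sub>R b \<in> S \<inter> ?D -` ball (?D p) \<epsilon>"
    by (rule topological_tendstoD[rotated])
  then obtain P Q where P: "eventually P (nhds p)" and Q: "eventually Q (nhds (0::real))"
    and PQ: "\<And>q c. P q \<Longrightarrow> Q c \<Longrightarrow> q + c *\<^sub>R b \<in> S \<inter> ?D -` ball (?D p) \<epsilon>"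
    unfolding eventually_prod_filter by auto
  from Q obtain \<delta> where \<delta>: "0 < \<delta>" "\<And>c. \<bar>c\<bar> < \<delta> \<Longrightarrow> Q c"
    unfolding eventually_nhds_metric dist_real_def by auto
  have "\<bar>f (q + c *\<^sub>R b) - f q - c * ?D p\<bar> \<le> \<epsilon> * \<bar>c\<bar>" if q: "P q" and c: "\<bar>c\<bar> < \<delta>" for q c
  proof -
    \<comment> \<open>Subtracting the linear term leaves a function whose derivative is at most
      \<open>\<epsilon>\<close> in absolute value; the mean value inequality from 0 to
      \<open>c\<close> then gives the bound.\<close>
    let ?\<phi> = "\<lambda>s. f (q + s *\<^sub>R b) - s * ?D p"
    have D: "(?\<phi> has_real_derivative ?D (q + s *\<^sub>R b) - ?D p) (at s within {-\<delta><..<\<delta>})"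
      if "s \<in> {-\<delta><..<\<delta>}" for s
    proof -
      have "q + s *\<^sub>R b \<in> S" using PQ[OF q \<delta>(2)] that by auto
      from smooth_on_has_real_derivative[OF assms(2) this]
      have "(?\<phi> has_real_derivative ?D (q + s *\<^sub>R b) - ?D p) (at s)"
        by (auto intro!: derivative_eq_intros)
      then show ?thesis by (rule has_field_derivative_at_within)
    qed
    have B: "norm (?D (q + s *\<^sub>R b) - ?D p) \<le> \<epsilon>" if "s \<in> {-\<delta><..<\<delta>}" for s
    proof -
      have "\<bar>s\<bar> < \<delta>" using that by auto
      then show ?thesis using PQ[OF q \<delta>(2), of s] by (simp add: dist_real_def abs_minus_commute)
    qed
    have "norm (?\<phi> c - ?\<phi> 0) \<le> \<epsilon> * norm (c - 0)"
      by (rule field_differentiable_bound[OF _ D B]) (use c \<delta>(1) in auto)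
    then show ?thesis by (simp add: algebra_simps)
  qed
  then have "\<forall>\<^sub>F q in nhds p. \<forall>c. \<bar>c\<bar> < \<delta> \<longrightarrow> \<bar>f (q + c *\<^sub>R b) - f q - c * ?D p\<bar> \<le> \<epsilon> * \<bar>c\<bar>"
    using P by (auto elim: eventually_mono)
  with \<delta>(1) show ?thesis by (rule that)
qed

lemma tendsto_add_sum_scaleR:
  fixes p :: "'a::real_tvs"
  assumes "finite K" "\<And>k. k \<in> K \<Longrightarrow> (c k \<longlongrightarrow> l k) F"
  shows "((\<lambda>t. p + (\<Sum>k\<in>K. c k t *\<^sub>R d k)) \<longlongrightarrow> p + (\<Sum>k\<in>K. l k *\<^sub>R d k)) F"
  using assms
proof (induction K)
  case (insert k K)
  then have "((\<lambda>t. p + (\<Sum>k\<in>K. c k t *\<^sub>R d k) + c k t *\<^sub>R d k) \<longlongrightarrow>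
      p + (\<Sum>k\<in>K. l k *\<^sub>R d k) + l k *\<^sub>R d k) F"
    by (intro tendsto_add_scaleR) auto
  then show ?case using insert by (simp add: add_ac)
qed simp

text \<open>Only directional derivatives are at hand, so the induction over \<open>K\<close> adds
  one direction at a time. The new increment starts at the moving point \<open>?q t\<close> built
  from the earlier directions, which is why \<open>dirderiv_increment\<close> is uniform near
  \<open>p\<close>.\<close>

lemma has_real_derivative_chain:
  fixes S :: "'a::real_tvs set" and f :: "'a \<Rightarrow> real"
  assumes S: "open S" and f: "smooth_on S f" and p: "p \<in> S" and K: "finite K"
    and "\<And>k. k \<in> K \<Longrightarrow> (c k has_real_derivative c' k) (at 0)" "\<And>k. k \<in> K \<Longrightarrow> c k 0 = 0"
  shows "((\<lambda>t. f (p + (\<Sum>k\<in>K. c k t *\<^sub>R d k))) has_real_derivative (\<Sum>k\<in>K. c' k * dirderiv (d k) f p)) (at 0)"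
  using K assms(5,6)
proof (induction K)
  case (insert k K)
  let ?q = "\<lambda>t. p + (\<Sum>k\<in>K. c k t *\<^sub>R d k)" and ?D = "dirderiv (d k) f p"
  have c: "(c k has_real_derivative c' k) (at 0)" "c k 0 = 0" using insert by auto
  then have lim: "((\<lambda>t. c k t / t) \<longlongrightarrow> c' k) (at 0)" by (simp add: has_field_derivative_iff)
  have lim0: "(c k \<longlongrightarrow> 0) (at 0)"
    using DERIV_isCont[OF c(1)] c(2) by (simp add: isCont_def)
  have "(?q \<longlongrightarrow> p + (\<Sum>k\<in>K. 0 *\<^sub>R d k)) (at 0)"
  proof (rule tendsto_add_sum_scaleR)
    fix j assume "j \<in> K"
    then have "(c j has_real_derivative c' j) (at 0)" "c j 0 = 0" using insert by auto
    then show "(c j \<longlongrightarrow> 0) (at 0)" using DERIV_isCont[of "c j"] by (force simp: isCont_def)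
  qed (use insert in auto)
  then have q: "(?q \<longlongrightarrow> p) (at 0)" by simp
  have rem: "((\<lambda>t. (f (?q t + c k t *\<^sub>R d k) - f (?q t) - c k t * ?D) / t) \<longlongrightarrow> 0) (at 0)"
  proof (rule tendstoI)
    fix e :: real assume e: "0 < e"
    \<comment> \<open>Eventually \<open>c k t / t\<close> is smaller than
      \<open>\<bar>c' k\<bar> + 1\<close> in absolute value, so this \<open>\<epsilon>\<close>
      brings the remainder quotient below \<open>e\<close>.\<close>
    define \<epsilon> where "\<epsilon> = e / (\<bar>c' k\<bar> + 1)"
    have \<epsilon>: "0 < \<epsilon>" using e by (simp add: \<epsilon>_def)
    obtain \<delta> where \<delta>: "0 < \<delta>"
      "\<forall>\<^sub>F q in nhds p. \<forall>a. \<bar>a\<bar> < \<delta> \<longrightarrow> \<bar>f (q + a *\<^sub>R d k) - f q - a * ?D\<bar> \<le> \<epsilon> * \<bar>a\<bar>"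
      using dirderiv_increment[OF S f p \<epsilon>] by blast
    have "\<forall>\<^sub>F t in at 0. \<forall>a. \<bar>a\<bar> < \<delta> \<longrightarrow> \<bar>f (?q t + a *\<^sub>R d k) - f (?q t) - a * ?D\<bar> \<le> \<epsilon> * \<bar>a\<bar>"
      using \<delta>(2) q by (rule eventually_compose_filterlim)
    moreover have "\<forall>\<^sub>F t in at 0. \<bar>c k t\<bar> < \<delta>"
      using tendstoD[OF lim0 \<delta>(1)] by (simp add: dist_real_def)
    moreover have "\<forall>\<^sub>F t in at 0. dist (c k t / t) (c' k) < 1"
      using lim by (rule tendstoD) simp
    moreover have "\<forall>\<^sub>F t in at 0. t \<noteq> (0::real)" by (simp add: eventually_at_filter)
    ultimately show "\<forall>\<^sub>F t in at 0. dist ((f (?q t + c k t *\<^sub>R d k) - f (?q t) - c k t * ?D) / t) 0 < e"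
    proof eventually_elim
      case (elim t)
      have "\<bar>(f (?q t + c k t *\<^sub>R d k) - f (?q t) - c k t * ?D) / t\<bar> \<le> \<epsilon> * \<bar>c k t\<bar> / \<bar>t\<bar>"
        using elim by (simp add: divide_right_mono)
      also have "\<dots> = \<epsilon> * \<bar>c k t / t\<bar>" by simp
      also have "\<dots> < \<epsilon> * (\<bar>c' k\<bar> + 1)"
        using elim(3) \<epsilon> by (intro mult_strict_left_mono) (auto simp: dist_real_def)
      also have "\<dots> = e" by (simp add: \<epsilon>_def)
      finally show ?case by (simp add: dist_real_def)
    qed
  qed
  have "((\<lambda>t. (f (?q t + c k t *\<^sub>R d k) - f (?q t) - c k t * ?D) / t + c k t / t * ?D) \<longlongrightarrow> 0 + c' k * ?D) (at 0)"
    by (intro tendsto_intros rem lim)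
  then have "((\<lambda>t. f (?q t + c k t *\<^sub>R d k) - f (?q t)) has_real_derivative c' k * ?D) (at 0)"
    using c(2) by (simp add: has_field_derivative_iff diff_divide_distrib)
  from DERIV_add[OF this insert.IH]
  have "((\<lambda>t. f (?q t + c k t *\<^sub>R d k)) has_real_derivative c' k * ?D + (\<Sum>k\<in>K. c' k * dirderiv (d k) f p)) (at 0)"
    using insert.prems by simp
  moreover have "?q t + c k t *\<^sub>R d k = p + (\<Sum>k\<in>insert k K. c k t *\<^sub>R d k)" for t
    using insert by (simp add: add_ac)
  ultimately show ?case using insert by simp
qed simp

corollary dirderiv_sum_direction:
  fixes S :: "'a::real_tvs set" and f :: "'a \<Rightarrow> real"
  assumes "open S" "smooth_on S f" "p \<in> S" "finite K"
  shows "dirderiv (\<Sum>k\<in>K. a k *\<^sub>R d k) f p = (\<Sum>k\<in>K. a k * dirderiv (d k) f p)"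
proof -
  have "((\<lambda>t. f (p + (\<Sum>k\<in>K. (t * a k) *\<^sub>R d k))) has_real_derivative (\<Sum>k\<in>K. a k * dirderiv (d k) f p)) (at 0)"
    by (rule has_real_derivative_chain[OF assms]) (auto intro!: derivative_eq_intros)
  then show ?thesis
    by (intro dirderiv_eqI) (simp add: has_real_derivative_iff_has_vector_derivative scaleR_sum_right)
qed

section \<open>Symmetry of second directional derivatives\<close>

lemma continuous_on_plane_ball:
  fixes S :: "'a::real_tvs set" and f :: "'a \<Rightarrow> real"
  assumes "open S" "continuous_on S f" "p \<in> S" "0 < \<epsilon>"
  obtains \<delta> where "0 < \<delta>"
    "\<And>s t. \<bar>s\<bar> < \<delta> \<Longrightarrow> \<bar>t\<bar> < \<delta> \<Longrightarrow> p + s *\<^sub>R a + t *\<^sub>R b \<in> S \<and> \<bar>f (p + s *\<^sub>R a + t *\<^sub>R b) - f p\<bar> < \<epsilon>"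
proof -
  have "open (S \<inter> f -` ball (f p) \<epsilon>)"
    by (rule continuous_open_preimage[OF assms(2,1)]) simp
  moreover have "p \<in> S \<inter> f -` ball (f p) \<epsilon>" using assms by simp
  moreover have "((\<lambda>z. p + fst z *\<^sub>R a + snd z *\<^sub>R b) \<longlongrightarrow> p) (nhds (0::real) \<times>\<^sub>F nhds (0::real))"
  proof -
    have "((\<lambda>z. p + fst z *\<^sub>R a + snd z *\<^sub>R b) \<longlongrightarrow> p + 0 *\<^sub>R a + 0 *\<^sub>R b) (nhds (0::real) \<times>\<^sub>F nhds (0::real))"
      by (intro tendsto_add_scaleR tendsto_const filterlim_fst filterlim_snd)
    then show ?thesis by simp
  qed
  ultimately have "\<forall>\<^sub>F z in nhds 0 \<times>\<^sub>F nhds (0::real). p + fst z *\<^sub>R a + snd z *\<^sub>R b \<in> S \<inter> f -` ball (f p) \<epsilon>"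
    by (rule topological_tendstoD[rotated])
  then obtain P Q where P: "eventually P (nhds (0::real))" and Q: "eventually Q (nhds (0::real))"
    and PQ: "\<And>s t. P s \<Longrightarrow> Q t \<Longrightarrow> p + s *\<^sub>R a + t *\<^sub>R b \<in> S \<inter> f -` ball (f p) \<epsilon>"
    unfolding eventually_prod_filter by auto
  have "\<forall>\<^sub>F x in nhds 0. P x \<and> Q x" using P Q by (rule eventually_conj)
  then obtain \<delta> where "0 < \<delta>" "\<And>c. \<bar>c\<bar> < \<delta> \<Longrightarrow> P c \<and> Q c"
    unfolding eventually_nhds_metric dist_real_def by auto
  then show ?thesis using that PQ by (fastforce simp: dist_real_def abs_minus_commute)
qed

text \<open>The mean value theorem is applied in direction \<open>a\<close> to the difference of
  \<open>f\<close> on the two sides of the parallelogram, then in direction \<open>b\<close> to the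
  resulting derivative.\<close>

lemma second_difference_mvt:
  fixes S :: "'a::real_tvs set" and f :: "'a \<Rightarrow> real"
  assumes f: "smooth_on S f" and h: "0 < h"
    and S: "\<And>s t. 0 \<le> s \<Longrightarrow> s \<le> h \<Longrightarrow> 0 \<le> t \<Longrightarrow> t \<le> h \<Longrightarrow> p + s *\<^sub>R a + t *\<^sub>R b \<in> S"
  obtains s t where "0 < s" "s < h" "0 < t" "t < h"
    "f (p + h *\<^sub>R a + h *\<^sub>R b) - f (p + h *\<^sub>R a) - (f (p + h *\<^sub>R b) - f p) =
      h * h * dirderiv b (dirderiv a f) (p + s *\<^sub>R a + t *\<^sub>R b)"
proof -
  let ?\<phi> = "\<lambda>s. f (p + h *\<^sub>R b + s *\<^sub>R a) - f (p + s *\<^sub>R a)"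
  have "(?\<phi> has_real_derivative dirderiv a f (p + h *\<^sub>R b + s *\<^sub>R a) - dirderiv a f (p + s *\<^sub>R a)) (at s)"
    if "0 \<le> s" "s \<le> h" for s
    using S[of s h] S[of s 0] that h
    by (intro DERIV_diff smooth_on_has_real_derivative[OF f]) (auto simp: add_ac)
  from MVT2[OF h this] obtain s where s: "0 < s" "s < h"
    "?\<phi> h - ?\<phi> 0 = (h - 0) * (dirderiv a f (p + h *\<^sub>R b + s *\<^sub>R a) - dirderiv a f (p + s *\<^sub>R a))"
    by blast
  let ?\<psi> = "\<lambda>t. dirderiv a f (p + s *\<^sub>R a + t *\<^sub>R b)"
  have "(?\<psi> has_real_derivative dirderiv b (dirderiv a f) (p + s *\<^sub>R a + t *\<^sub>R b)) (at t)"
    if "0 \<le> t" "t \<le> h" for t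
    using S[of s t] that s by (intro smooth_on_has_real_derivative[OF smooth_on_dirderiv[OF f]]) auto
  from MVT2[OF h this] obtain t where t: "0 < t" "t < h"
    "?\<psi> h - ?\<psi> 0 = (h - 0) * dirderiv b (dirderiv a f) (p + s *\<^sub>R a + t *\<^sub>R b)"
    by blast
  show ?thesis
    by (rule that[OF s(1,2) t(1,2)]) (use s(3) t(3) in \<open>simp add: add_ac algebra_simps\<close>)
qed

text \<open>Schwarz's theorem: the second difference is symmetric in the two directions, so the two
  mixed derivatives take the same value, each at its own point of a small parallelogram at
  \<open>p\<close>. Continuity then excludes different values at \<open>p\<close>.\<close>

theorem dirderiv_commute:
  fixes S :: "'a::real_tvs set" and f :: "'a \<Rightarrow> real"
  assumes S: "open S" and f: "smooth_on S f" and p: "p \<in> S"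
  shows "dirderiv a (dirderiv b f) p = dirderiv b (dirderiv a f) p"
proof (rule ccontr)
  let ?F = "dirderiv a (dirderiv b f)" and ?G = "dirderiv b (dirderiv a f)"
  assume "?F p \<noteq> ?G p"
  then have \<epsilon>: "0 < \<bar>?F p - ?G p\<bar> / 2" (is "0 < ?\<epsilon>") by simp
  have cF: "continuous_on S ?F" and cG: "continuous_on S ?G"
    using f by (auto intro: smooth_on_continuous_on smooth_on_dirderiv)
  obtain \<delta>1 where \<delta>1: "0 < \<delta>1"
    "\<And>s t. \<bar>s\<bar> < \<delta>1 \<Longrightarrow> \<bar>t\<bar> < \<delta>1 \<Longrightarrow> p + s *\<^sub>R a + t *\<^sub>R b \<in> S \<and> \<bar>?F (p + s *\<^sub>R a + t *\<^sub>R b) - ?F p\<bar> < ?\<epsilon>"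
    using continuous_on_plane_ball[OF S cF p \<epsilon>] by metis
  obtain \<delta>2 where \<delta>2: "0 < \<delta>2"
    "\<And>s t. \<bar>s\<bar> < \<delta>2 \<Longrightarrow> \<bar>t\<bar> < \<delta>2 \<Longrightarrow> p + s *\<^sub>R a + t *\<^sub>R b \<in> S \<and> \<bar>?G (p + s *\<^sub>R a + t *\<^sub>R b) - ?G p\<bar> < ?\<epsilon>"
    using continuous_on_plane_ball[OF S cG p \<epsilon>] by metis
  define h where "h = min \<delta>1 \<delta>2 / 2"
  have h: "0 < h" "h < \<delta>1" "h < \<delta>2" using \<delta>1(1) \<delta>2(1) by (auto simp: h_def)
  obtain s t where st: "0 < s" "s < h" "0 < t" "t < h"
    "f (p + h *\<^sub>R a + h *\<^sub>R b) - f (p + h *\<^sub>R a) - (f (p + h *\<^sub>R b) - f p) = h * h * ?G (p + s *\<^sub>R a + t *\<^sub>R b)"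
    by (rule second_difference_mvt[OF f h(1), of p a b]) (use \<delta>1(2) h in auto)
  obtain t' s' where st': "0 < t'" "t' < h" "0 < s'" "s' < h"
    "f (p + h *\<^sub>R b + h *\<^sub>R a) - f (p + h *\<^sub>R b) - (f (p + h *\<^sub>R a) - f p) = h * h * ?F (p + t' *\<^sub>R b + s' *\<^sub>R a)"
  proof (rule second_difference_mvt[OF f h(1), of p b a])
    fix s t assume "0 \<le> s" "s \<le> h" "0 \<le> t" "t \<le> h"
    then show "p + s *\<^sub>R b + t *\<^sub>R a \<in> S" using \<delta>1(2)[of t s] h by (simp add: add_ac)
  qed
  have swap: "p + y *\<^sub>R b + x *\<^sub>R a = p + x *\<^sub>R a + y *\<^sub>R b" for x y by (simp add: add_ac)
  have "h * h * ?G (p + s *\<^sub>R a + t *\<^sub>R b) = h * h * ?F (p + s' *\<^sub>R a + t' *\<^sub>R b)"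
    using st(5) st'(5)[unfolded swap] by linarith
  then have eq: "?F (p + s' *\<^sub>R a + t' *\<^sub>R b) = ?G (p + s *\<^sub>R a + t *\<^sub>R b)" using h by simp
  have gap: False if "\<bar>z - x\<bar> < \<bar>x - y\<bar> / 2" "\<bar>z - y\<bar> < \<bar>x - y\<bar> / 2" for x y z :: real
    using that by argo
  show False
  proof (rule gap)
    show "\<bar>?G (p + s *\<^sub>R a + t *\<^sub>R b) - ?F p\<bar> < ?\<epsilon>"
      using \<delta>1(2)[of s' t'] st' h unfolding eq by simp
    show "\<bar>?G (p + s *\<^sub>R a + t *\<^sub>R b) - ?G p\<bar> < ?\<epsilon>"
      using \<delta>2(2)[of s t] st h by simp
  qed
qed

section \<open>Smooth functions of finite order on jets\<close>

lemma finite_multisets_size_le: "finite {M :: 'a::finite multiset. size M \<le> r}"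
proof (rule finite_subset)
  show "{M :: 'a multiset. size M \<le> r} \<subseteq> mset ` {xs. set xs \<subseteq> UNIV \<and> length xs \<le> r}"
  proof
    fix M :: "'a multiset"
    assume "M \<in> {M. size M \<le> r}"
    then show "M \<in> mset ` {xs. set xs \<subseteq> UNIV \<and> length xs \<le> r}"
      using ex_mset[of M] by (auto simp: image_iff)
  qed
qed (intro finite_imageI finite_lists_length_le finite)

lemma sum_fun_apply: "(\<Sum>i\<in>I. f i) x = (\<Sum>i\<in>I. f i x)"
  by (induction I rule: infinite_finite_induct) auto

lemma order_le_mono: "order_le r S F \<Longrightarrow> r \<le> r' \<Longrightarrow> order_le r' S F"
  unfolding order_le_def by (meson le_trans)

lemma order_leD:
  "order_le r S F \<Longrightarrow> p \<in> S \<Longrightarrow> q \<in> S \<Longrightarrow> fst p = fst q \<Longrightarrow>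
    (\<And>M. size M \<le> r \<Longrightarrow> snd p M = snd q M) \<Longrightarrow> F p = F q"
  unfolding order_le_def by blast

lemma order_le_comp2:
  "order_le r S F \<Longrightarrow> order_le r S G \<Longrightarrow> order_le r S (\<lambda>p. h (F p) (G p))"
  unfolding order_le_def by (intro ballI impI arg_cong2[where f = h]) blast+

text \<open>\<open>U\<close> will be the image of a fibered chart; \<open>S\<close> is then the set
  of infinite jets over it.\<close>

locale jets =
  fixes U :: "((real^'n::finite) \<times> (real^'m::finite)) set"
  assumes open_U: "open U"
begin

definition S :: "('n, 'm) jet set"
  where "S = {p. (fst p, snd p {#}) \<in> U}"

text \<open>Functions are extended by zero outside \<open>S\<close>, so that identities on \<open>S\<close> become equations in the
  ring of all functions.\<close>

definition restr :: "(('n, 'm) jet \<Rightarrow> real) \<Rightarrow> ('n, 'm) jet \<Rightarrow> real"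
  where "restr F = (\<lambda>p. if p \<in> S then F p else 0)"

text \<open>The order is existentially quantified because \<open>d\<^sub>i\<close> raises it. The
  set is closed under sums, products and all the derivations used below.\<close>

definition jet_fns :: "(('n, 'm) jet \<Rightarrow> real) set"
  where "jet_fns = {F. smooth_on S F \<and> (\<exists>r. order_le r S F) \<and> (\<forall>p. p \<notin> S \<longrightarrow> F p = 0)}"

text \<open>The vector field may vary with the point but is frozen at \<open>p\<close> while
  differentiating. Fibre, base, total and evolutionary derivatives are all instances, so the Leibniz
  rule is proved once.\<close>

definition deriv_along :: "('n, 'm) vfield \<Rightarrow> (('n, 'm) jet \<Rightarrow> real) \<Rightarrow> ('n, 'm) jet \<Rightarrow> real"
  where "deriv_along \<xi> F = restr (\<lambda>p. dirderiv (\<xi> p) F p)"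

abbreviation D :: "'m \<Rightarrow> 'n multiset \<Rightarrow> (('n, 'm) jet \<Rightarrow> real) \<Rightarrow> ('n, 'm) jet \<Rightarrow> real"
  where "D \<sigma> M \<equiv> deriv_along (\<lambda>_. unit_vertical \<sigma> M)"

abbreviation DX :: "'n \<Rightarrow> (('n, 'm) jet \<Rightarrow> real) \<Rightarrow> ('n, 'm) jet \<Rightarrow> real"
  where "DX i \<equiv> deriv_along (\<lambda>_. (axis i 1, 0))"

abbreviation T :: "'n \<Rightarrow> (('n, 'm) jet \<Rightarrow> real) \<Rightarrow> ('n, 'm) jet \<Rightarrow> real"
  where "T i \<equiv> deriv_along (total i)"

definition coordinate :: "'n multiset \<Rightarrow> 'm \<Rightarrow> ('n, 'm) jet \<Rightarrow> real"
  where "coordinate M \<sigma> = restr (\<lambda>p. snd p M $ \<sigma>)"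

lemma continuous_on_jet_coordinate: "continuous_on X (\<lambda>p :: ('n, 'm) jet. snd p M)"
  by (rule continuous_on_product_then_coordinatewise) (intro continuous_intros)

lemma open_S: "open S"
proof -
  have "open ((\<lambda>p :: ('n, 'm) jet. (fst p, snd p {#})) -` U)"
    by (intro open_vimage open_U continuous_intros continuous_on_jet_coordinate)
  then show ?thesis by (simp add: S_def vimage_def)
qed

lemma restr_in [simp]: "p \<in> S \<Longrightarrow> restr F p = F p"
  and restr_out [simp]: "p \<notin> S \<Longrightarrow> restr F p = 0"
  by (simp_all add: restr_def)

lemma jet_fnsD: "F \<in> jet_fns \<Longrightarrow> smooth_on S F" "F \<in> jet_fns \<Longrightarrow> p \<notin> S \<Longrightarrow> F p = 0"
  unfolding jet_fns_def by blast+

lemma jet_fns_order: assumes "F \<in> jet_fns" obtains r where "order_le r S F"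
  using assms by (auto simp: jet_fns_def)

lemma jet_fns_order2:
  assumes "F \<in> jet_fns" "G \<in> jet_fns" obtains r where "order_le r S F" "order_le r S G"
proof -
  obtain a where "order_le a S F" by (rule jet_fns_order[OF assms(1)])
  moreover obtain b where "order_le b S G" by (rule jet_fns_order[OF assms(2)])
  ultimately show ?thesis by (intro that[of "max a b"]) (auto intro: order_le_mono)
qed

lemma jet_fnsI: "smooth_on S F \<Longrightarrow> order_le r S F \<Longrightarrow> (\<And>p. p \<notin> S \<Longrightarrow> F p = 0) \<Longrightarrow> F \<in> jet_fns"
  unfolding jet_fns_def by blast

lemma order_le_cong: "(\<And>p. p \<in> S \<Longrightarrow> F p = G p) \<Longrightarrow> order_le r S F \<Longrightarrow> order_le r S G"
  unfolding order_le_def by metis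

lemma restr_jet_fns: assumes "smooth_on S F" "order_le r S F" shows "restr F \<in> jet_fns"
proof (rule jet_fnsI)
  show "smooth_on S (restr F)" using assms(1) by (rule smooth_on_cong[OF open_S, rotated]) simp
  show "order_le r S (restr F)" using assms(2) by (rule order_le_cong[rotated]) simp
qed simp

lemma deriv_along_in: "p \<in> S \<Longrightarrow> deriv_along \<xi> F p = dirderiv (\<xi> p) F p"
  and deriv_along_out: "p \<notin> S \<Longrightarrow> deriv_along \<xi> F p = 0"
  by (simp_all add: deriv_along_def)

lemma zero_jet_fns [intro]: "0 \<in> jet_fns"
  by (intro jet_fnsI[of _ 0]) (simp_all add: zero_fun_def order_le_def)

lemma add_jet_fns [intro]: "F \<in> jet_fns \<Longrightarrow> G \<in> jet_fns \<Longrightarrow> F + G \<in> jet_fns"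
proof -
  assume FG: "F \<in> jet_fns" "G \<in> jet_fns"
  then obtain r where r: "order_le r S F" "order_le r S G" by (rule jet_fns_order2)
  from FG show "F + G \<in> jet_fns"
    using smooth_on_add[OF open_S jet_fnsD(1) jet_fnsD(1), of F G] order_le_comp2[OF r, of "(+)"]
    by (intro jet_fnsI[of _ r]) (simp_all add: plus_fun_def jet_fnsD(2))
qed

lemma mult_jet_fns [intro]: "F \<in> jet_fns \<Longrightarrow> G \<in> jet_fns \<Longrightarrow> F * G \<in> jet_fns"
proof -
  assume FG: "F \<in> jet_fns" "G \<in> jet_fns"
  then obtain r where r: "order_le r S F" "order_le r S G" by (rule jet_fns_order2)
  from FG show "F * G \<in> jet_fns"
    using smooth_on_mult[OF open_S jet_fnsD(1) jet_fnsD(1), of F G] order_le_comp2[OF r, of "(*)"]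
    by (intro jet_fnsI[of _ r]) (simp_all add: times_fun_def jet_fnsD(2))
qed

lemma uminus_jet_fns [intro]: "F \<in> jet_fns \<Longrightarrow> - F \<in> jet_fns"
proof -
  assume F: "F \<in> jet_fns"
  then obtain r where r: "order_le r S F" by (rule jet_fns_order)
  from F show "- F \<in> jet_fns"
    using smooth_on_uminus[OF open_S jet_fnsD(1), of F] order_le_comp2[OF r r, of "\<lambda>x y. - x"]
    by (intro jet_fnsI[of _ r]) (simp_all add: fun_Compl_def jet_fnsD(2))
qed

lemma sum_jet_fns [intro]: "(\<And>i. i \<in> I \<Longrightarrow> F i \<in> jet_fns) \<Longrightarrow> (\<Sum>i\<in>I. F i) \<in> jet_fns"
  by (induction I rule: infinite_finite_induct) auto

text \<open>Adding the same \<open>t *\<^sub>R v\<close> to two jets that agree up to order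
  \<open>r\<close> keeps them in agreement, and inside or outside \<open>S\<close> together; the
  zero extension settles the case outside.\<close>

lemma deriv_along_const_order: "F \<in> jet_fns \<Longrightarrow> order_le r S F \<Longrightarrow> order_le r S (deriv_along (\<lambda>_. v) F)"
  unfolding order_le_def
proof (intro ballI impI)
  fix p q
  assume F: "F \<in> jet_fns" and r: "\<forall>p\<in>S. \<forall>q\<in>S. fst p = fst q \<and> (\<forall>M. size M \<le> r \<longrightarrow> snd p M = snd q M) \<longrightarrow> F p = F q"
    and pq: "p \<in> S" "q \<in> S" "fst p = fst q \<and> (\<forall>M. size M \<le> r \<longrightarrow> snd p M = snd q M)"
  have "F (p + t *\<^sub>R v) = F (q + t *\<^sub>R v)" for t
  proof -
    have "p + t *\<^sub>R v \<in> S \<longleftrightarrow> q + t *\<^sub>R v \<in> S"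
      using pq(3) by (simp add: S_def)
    moreover have "fst (p + t *\<^sub>R v) = fst (q + t *\<^sub>R v) \<and>
        (\<forall>M. size M \<le> r \<longrightarrow> snd (p + t *\<^sub>R v) M = snd (q + t *\<^sub>R v) M)"
      using pq(3) by simp
    ultimately show ?thesis using r jet_fnsD(2)[OF F] by metis
  qed
  then show "deriv_along (\<lambda>_. v) F p = deriv_along (\<lambda>_. v) F q"
    by (simp add: deriv_along_in pq(1,2) dirderiv_def)
qed

lemma deriv_along_const_jet_fns [intro]: "F \<in> jet_fns \<Longrightarrow> deriv_along (\<lambda>_. v) F \<in> jet_fns"
proof -
  assume F: "F \<in> jet_fns"
  then obtain r where r: "order_le r S F" by (rule jet_fns_order)
  have "smooth_on S (deriv_along (\<lambda>_. v) F)"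
    by (rule smooth_on_cong[OF open_S _ smooth_on_dirderiv[OF jet_fnsD(1)[OF F]]]) (simp add: deriv_along_in)
  then show "deriv_along (\<lambda>_. v) F \<in> jet_fns"
    by (rule jet_fnsI[OF _ deriv_along_const_order[OF F r] deriv_along_out])
qed

lemma deriv_along_add: "F \<in> jet_fns \<Longrightarrow> G \<in> jet_fns \<Longrightarrow> deriv_along \<xi> (F + G) = deriv_along \<xi> F + deriv_along \<xi> G"
  by (rule ext) (auto simp: deriv_along_def restr_def plus_fun_def dirderiv_add[OF jet_fnsD(1) jet_fnsD(1)])

lemma deriv_along_mult: "F \<in> jet_fns \<Longrightarrow> G \<in> jet_fns \<Longrightarrow> deriv_along \<xi> (F * G) = deriv_along \<xi> F * G + F * deriv_along \<xi> G"
  by (rule ext) (auto simp: deriv_along_def restr_def plus_fun_def times_fun_def dirderiv_mult[OF jet_fnsD(1) jet_fnsD(1)])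

lemma deriv_along_uminus: "F \<in> jet_fns \<Longrightarrow> deriv_along \<xi> (- F) = - deriv_along \<xi> F"
  by (rule ext) (auto simp: deriv_along_def restr_def fun_Compl_def
    dirderiv_bounded_linear[OF bounded_linear_minus[OF bounded_linear_ident] jet_fnsD(1)])

lemma deriv_along_zero [simp]: "deriv_along \<xi> 0 = 0"
  by (rule ext) (simp add: deriv_along_def restr_def zero_fun_def)

lemma deriv_along_sum: "(\<And>i. i \<in> I \<Longrightarrow> F i \<in> jet_fns) \<Longrightarrow> deriv_along \<xi> (\<Sum>i\<in>I. F i) = (\<Sum>i\<in>I. deriv_along \<xi> (F i))"
  by (induction I rule: infinite_finite_induct) (auto simp: deriv_along_add sum_jet_fns)

lemma deriv_along_deriv_along: "p \<in> S \<Longrightarrow> deriv_along \<xi> (deriv_along (\<lambda>_. w) F) p = dirderiv (\<xi> p) (dirderiv w F) p"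
  by (simp add: deriv_along_in dirderiv_cong[OF open_S, of "deriv_along (\<lambda>_. w) F" "dirderiv w F"])

lemma deriv_along_const_commute: "F \<in> jet_fns \<Longrightarrow> deriv_along (\<lambda>_. v) (deriv_along (\<lambda>_. w) F) = deriv_along (\<lambda>_. w) (deriv_along (\<lambda>_. v) F)"
  by (rule ext) (metis deriv_along_deriv_along deriv_along_out dirderiv_commute jet_fnsD(1) open_S)

section \<open>Coordinate expansion of derivatives of finite-order functions\<close>

lemma has_real_derivative_jet_curve:
  assumes F: "F \<in> jet_fns" and r: "order_le r S F" and u: "u 0 \<in> S"
    and x: "\<And>i. ((\<lambda>t. fst (u t) $ i) has_real_derivative fst w $ i) (at 0)"
    and y: "\<And>M \<sigma>. size M \<le> r \<Longrightarrow> ((\<lambda>t. snd (u t) M $ \<sigma>) has_real_derivative snd w M $ \<sigma>) (at 0)"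
  shows "((\<lambda>t. F (u t)) has_real_derivative
    (\<Sum>i\<in>UNIV. fst w $ i * DX i F (u 0)) +
    (\<Sum>(\<sigma>, M)\<in>UNIV \<times> {M. size M \<le> r}. snd w M $ \<sigma> * D \<sigma> M F (u 0))) (at 0)"
proof -
  \<comment> \<open>\<open>F\<close> sees only the coordinates indexed by \<open>K\<close>: those of
    the base, and those of the fibre up to order \<open>r\<close>. So \<open>u\<close> may be
    replaced by a curve moving in finitely many constant directions, to which the chain rule
    applies.\<close>
  define K where "K = (UNIV :: 'n set) <+> ((UNIV :: 'm set) \<times> {M :: 'n multiset. size M \<le> r})"
  have fin: "finite {M :: 'n multiset. size M \<le> r}" by (rule finite_multisets_size_le)
  define d :: "'n + 'm \<times> 'n multiset \<Rightarrow> ('n, 'm) jet" where "d = (\<lambda>k. case k of Inl i \<Rightarrow> (axis i 1, 0) | Inr (\<sigma>, M) \<Rightarrow> unit_vertical \<sigma> M)"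
  define c :: "'n + 'm \<times> 'n multiset \<Rightarrow> real \<Rightarrow> real" where "c = (\<lambda>k t. case k of Inl i \<Rightarrow> fst (u t) $ i - fst (u 0) $ i
    | Inr (\<sigma>, M) \<Rightarrow> snd (u t) M $ \<sigma> - snd (u 0) M $ \<sigma>)"
  define c' :: "'n + 'm \<times> 'n multiset \<Rightarrow> real" where "c' = (\<lambda>k. case k of Inl i \<Rightarrow> fst w $ i | Inr (\<sigma>, M) \<Rightarrow> snd w M $ \<sigma>)"
  have sumK: "sum f K = (\<Sum>i\<in>UNIV. f (Inl i)) + (\<Sum>k\<in>UNIV \<times> {M. size M \<le> r}. f (Inr k))"
    for f :: "_ \<Rightarrow> 'z::comm_monoid_add"
    unfolding K_def by (subst sum.Plus) (simp_all add: fin)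
  have "((\<lambda>t. F (u 0 + (\<Sum>k\<in>K. c k t *\<^sub>R d k))) has_real_derivative (\<Sum>k\<in>K. c' k * dirderiv (d k) F (u 0))) (at 0)"
  proof (rule has_real_derivative_chain[OF open_S jet_fnsD(1)[OF F] u])
    show "finite K" by (simp add: K_def fin)
    fix k assume "k \<in> K"
    then show "(c k has_real_derivative c' k) (at 0)"
      using DERIV_diff[OF x DERIV_const] DERIV_diff[OF y DERIV_const]
      by (auto simp: K_def c_def c'_def)
    show "c k 0 = 0" by (auto simp: c_def split: sum.split)
  qed
  moreover have "F (u 0 + (\<Sum>k\<in>K. c k t *\<^sub>R d k)) = F (u t)" for t
  proof -
    let ?q = "u 0 + (\<Sum>k\<in>K. c k t *\<^sub>R d k)"
    have 1: "fst ?q = fst (u t)"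
      by (simp add: sumK c_def d_def fst_sum vec_eq_iff unit_vertical_def split_beta
          axis_def if_distrib cong: if_cong)
    have 2: "snd ?q M = snd (u t) M" if "size M \<le> r" for M
    proof (subst vec_eq_iff, intro allI)
      fix \<sigma>
      have "(\<Sum>k\<in>UNIV \<times> {M. size M \<le> r}. (c (Inr k) t *\<^sub>R snd (d (Inr k)) M) $ \<sigma>) =
        (\<Sum>k\<in>UNIV \<times> {M. size M \<le> r}. if k = (\<sigma>, M) then snd (u t) M $ \<sigma> - snd (u 0) M $ \<sigma> else 0)"
        by (intro sum.cong refl) (auto simp: c_def d_def unit_vertical_def axis_def split: if_splits)
      also have "\<dots> = snd (u t) M $ \<sigma> - snd (u 0) M $ \<sigma>"
        using that fin by simp
      finally have "(\<Sum>k\<in>UNIV \<times> {M. size M \<le> r}. (c (Inr k) t *\<^sub>R snd (d (Inr k)) M) $ \<sigma>) =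
        snd (u t) M $ \<sigma> - snd (u 0) M $ \<sigma>" .
      moreover have "snd (d (Inl i)) N = 0" for i N by (simp add: d_def)
      ultimately show "snd ?q M $ \<sigma> = snd (u t) M $ \<sigma>"
        by (simp add: sumK snd_sum sum_fun_apply scaleR_fun_def)
    qed
    have "?q \<in> S \<longleftrightarrow> u t \<in> S" using 1 2[of "{#}"] by (simp add: S_def)
    then show ?thesis
      using order_leD[OF r _ _ 1 2] jet_fnsD(2)[OF F] by (cases "u t \<in> S") simp_all
  qed
  ultimately show ?thesis
    by (simp add: sumK c'_def d_def deriv_along_in u split_beta)
qed

lemma dirderiv_expand:
  assumes F: "F \<in> jet_fns" and r: "order_le r S F" and p: "p \<in> S"
  shows "dirderiv w F p = (\<Sum>i\<in>UNIV. fst w $ i * DX i F p) +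
    (\<Sum>(\<sigma>, M)\<in>UNIV \<times> {M. size M \<le> r}. snd w M $ \<sigma> * D \<sigma> M F p)"
proof -
  have "((\<lambda>t. F (p + t *\<^sub>R w)) has_real_derivative
    (\<Sum>i\<in>UNIV. fst w $ i * DX i F (p + 0 *\<^sub>R w)) +
    (\<Sum>(\<sigma>, M)\<in>UNIV \<times> {M. size M \<le> r}. snd w M $ \<sigma> * D \<sigma> M F (p + 0 *\<^sub>R w))) (at 0)"
    by (rule has_real_derivative_jet_curve[OF F r])
      (use p in \<open>auto intro!: derivative_eq_intros simp: scaleR_fun_def\<close>)
  then show ?thesis
    by (intro dirderiv_eqI) (simp add: has_real_derivative_iff_has_vector_derivative)
qed

lemma D_high_order: "order_le r S F \<Longrightarrow> F \<in> jet_fns \<Longrightarrow> r < size M \<Longrightarrow> D \<sigma> M F = 0"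
proof
  fix p assume r: "order_le r S F" and F: "F \<in> jet_fns" and M: "r < size M"
  have "dirderiv (unit_vertical \<sigma> M) F p = 0" if "p \<in> S"
    using dirderiv_expand[OF F r that, of "unit_vertical \<sigma> M"] M
    by (auto simp: unit_vertical_def intro!: sum.neutral)
  then show "D \<sigma> M F p = 0 p" by (cases "p \<in> S") (auto simp: deriv_along_in deriv_along_out)
qed

lemma coordinate_jet_fns [intro]: "coordinate M \<sigma> \<in> jet_fns"
proof -
  have lin: "((\<lambda>t. snd (p + t *\<^sub>R v) M $ \<sigma>) has_vector_derivative snd v M $ \<sigma>) (at 0)"
    for p v :: "('n, 'm) jet"
    unfolding has_real_derivative_iff_has_vector_derivative[symmetric]
    by (auto intro!: derivative_eq_intros simp: scaleR_fun_def)
  then have dir: "dirderiv v (\<lambda>p :: ('n, 'm) jet. snd p M $ \<sigma>) = (\<lambda>_. snd v M $ \<sigma>)" for v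
    by (intro ext dirderiv_eqI)
  have "Ck_on k S (\<lambda>p. snd p M $ \<sigma>)" for k
  proof (cases k)
    case (Suc l)
    show ?thesis unfolding Suc Ck_on.simps dir
      by (intro conjI allI ballI Ck_on_const differentiableI_vector[OF lin]
        continuous_intros continuous_on_jet_coordinate)
  qed (auto intro!: continuous_intros continuous_on_jet_coordinate)
  then show ?thesis unfolding coordinate_def
    by (intro restr_jet_fns[of _ "size M"]) (auto simp: smooth_on_def order_le_def)
qed

lemma deriv_along_coordinate: "deriv_along \<xi> (coordinate M \<sigma>) = restr (\<lambda>p. snd (\<xi> p) M $ \<sigma>)"
proof
  fix p
  have "((\<lambda>t. snd (p + t *\<^sub>R v) M $ \<sigma>) has_vector_derivative snd v M $ \<sigma>) (at 0)" for v :: "('n, 'm) jet"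
    unfolding has_real_derivative_iff_has_vector_derivative[symmetric]
    by (auto intro!: derivative_eq_intros simp: scaleR_fun_def)
  then have "dirderiv v (\<lambda>p :: ('n, 'm) jet. snd p M $ \<sigma>) p = snd v M $ \<sigma>" for v
    by (rule dirderiv_eqI)
  then show "deriv_along \<xi> (coordinate M \<sigma>) p = restr (\<lambda>p. snd (\<xi> p) M $ \<sigma>) p"
    by (cases "p \<in> S") (simp_all add: deriv_along_in deriv_along_out coordinate_def
      dirderiv_cong[OF open_S, of "restr (\<lambda>p. snd p M $ \<sigma>)" "\<lambda>p. snd p M $ \<sigma>"])
qed

section \<open>Total derivatives and their commutation rules\<close>

lemma T_expand:
  assumes "F \<in> jet_fns" "order_le r S F"
  shows "T i F = DX i F + (\<Sum>(\<sigma>, M)\<in>UNIV \<times> {M. size M \<le> r}. coordinate (add_mset i M) \<sigma> * D \<sigma> M F)"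
proof
  fix p
  show "T i F p = (DX i F + (\<Sum>(\<sigma>, M)\<in>UNIV \<times> {M. size M \<le> r}. coordinate (add_mset i M) \<sigma> * D \<sigma> M F)) p"
  proof (cases "p \<in> S")
    case True
    have "(\<Sum>j\<in>UNIV. fst (total i p) $ j * DX j F p) = DX i F p"
      by (simp add: total_def axis_def if_distrib[of "\<lambda>x. x * _"] cong: if_cong)
    then show ?thesis
      using dirderiv_expand[OF assms True, of "total i p"] True
      by (simp add: deriv_along_in[of p "total i"] total_def coordinate_def sum_fun_apply split_beta)
  qed (simp add: deriv_along_out sum_fun_apply split_beta)
qed

lemma T_jet_fns [intro]: "F \<in> jet_fns \<Longrightarrow> T i F \<in> jet_fns"
proof -
  assume F: "F \<in> jet_fns"
  then obtain r where "order_le r S F" by (rule jet_fns_order)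
  with F show "T i F \<in> jet_fns" by (subst T_expand) (auto simp: split_beta)
qed

text \<open>Fibre derivatives commute with \<open>\<partial>/\<partial>x\<^sup>i\<close> and with
  each other, so the only extra term comes from differentiating the coefficients
  \<open>y\<^sup>\<tau>\<^sub>N\<^sub>i\<close> in \<open>T_expand\<close>.\<close>

lemma D_T:
  assumes F: "F \<in> jet_fns"
  shows "D \<sigma> M (T i F) = T i (D \<sigma> M F) + (if i \<in># M then D \<sigma> (M - {#i#}) F else 0)"
proof -
  obtain r where r: "order_le r S F" by (rule jet_fns_order[OF F])
  let ?K = "(UNIV :: 'm set) \<times> {M :: 'n multiset. size M \<le> r}"
  have fin: "finite ?K" by (simp add: finite_multisets_size_le)
  \<comment> \<open>On \<open>S\<close> the derivative of
    \<open>coordinate (add_mset i N) \<tau>\<close> is 1 exactly when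
    \<open>\<tau> = \<sigma>\<close> and \<open>add_mset i N = M\<close>, and 0 otherwise. Since
    \<open>M - {#i#}\<close> is \<open>M\<close> itself if \<open>i\<close> does not occur in it,
    membership is tested separately.\<close>
  have coordinate: "D \<sigma> M (coordinate (add_mset i N) \<tau>) * D \<tau> N F =
    (if (\<tau>, N) = (\<sigma>, M - {#i#}) then if i \<in># M then D \<sigma> (M - {#i#}) F else 0 else 0)" for \<tau> N
    by (rule ext) (auto simp: deriv_along_coordinate unit_vertical_def axis_def restr_def deriv_along_out)
  have "D \<sigma> M (T i F) = D \<sigma> M (DX i F) +
      (\<Sum>(\<tau>, N)\<in>?K. D \<sigma> M (coordinate (add_mset i N) \<tau>) * D \<tau> N F + coordinate (add_mset i N) \<tau> * D \<sigma> M (D \<tau> N F))"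
    unfolding T_expand[OF F r] using F
    by (subst deriv_along_add) (auto simp: deriv_along_sum split_beta deriv_along_mult mult_jet_fns coordinate_jet_fns deriv_along_const_jet_fns intro!: sum_jet_fns)
  also have "\<dots> = (DX i (D \<sigma> M F) + (\<Sum>(\<tau>, N)\<in>?K. coordinate (add_mset i N) \<tau> * D \<tau> N (D \<sigma> M F))) +
      (\<Sum>(\<tau>, N)\<in>?K. D \<sigma> M (coordinate (add_mset i N) \<tau>) * D \<tau> N F)"
    by (simp add: split_beta sum.distrib deriv_along_const_commute[OF F, of "unit_vertical \<sigma> M"] add_ac)
  also have "DX i (D \<sigma> M F) + (\<Sum>(\<tau>, N)\<in>?K. coordinate (add_mset i N) \<tau> * D \<tau> N (D \<sigma> M F)) = T i (D \<sigma> M F)"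
    by (rule T_expand[symmetric]) (use F r in \<open>auto intro: deriv_along_const_order\<close>)
  also have "(\<Sum>(\<tau>, N)\<in>?K. D \<sigma> M (coordinate (add_mset i N) \<tau>) * D \<tau> N F) =
      (\<Sum>k\<in>?K. if k = (\<sigma>, M - {#i#}) then if i \<in># M then D \<sigma> (M - {#i#}) F else 0 else 0)"
    unfolding coordinate by (intro sum.cong refl) (simp add: split_beta prod_eq_iff)
  \<comment> \<open>If \<open>M - {#i#}\<close> lies outside the summation range, the corresponding
    derivative of \<open>F\<close> is 0 by \<open>D_high_order\<close>, so no term is lost.\<close>
  also have "\<dots> = (if i \<in># M then D \<sigma> (M - {#i#}) F else 0)"
    using fin D_high_order[OF r F, of "M - {#i#}" \<sigma>] by (auto simp: sum.delta)
  finally show ?thesis .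
qed

text \<open>Expanding both operators gives five kinds of terms. Exchanging \<open>i\<close> and
  \<open>j\<close> swaps the two mixed sums and preserves the others; for the derivatives of the
  coefficients this holds because \<open>T i\<close> maps \<open>y\<^sub>j\<^sub>M\<close> to
  \<open>y\<^sub>i\<^sub>j\<^sub>M\<close>.\<close>

lemma T_commute:
  assumes F: "F \<in> jet_fns"
  shows "T i (T j F) = T j (T i F)"
proof -
  obtain r where r: "order_le r S F" by (rule jet_fns_order[OF F])
  let ?K = "(UNIV :: 'm set) \<times> {M :: 'n multiset. size M \<le> r}"
  let ?c = "\<lambda>i (\<sigma>, M). coordinate (add_mset i M) \<sigma>" and ?D = "\<lambda>(\<sigma>, M). D \<sigma> M"
  have Tc: "T i (?c j k) = (case k of (\<sigma>, M) \<Rightarrow> coordinate (add_mset i (add_mset j M)) \<sigma>)" for i j k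
    by (cases k) (simp add: deriv_along_coordinate, simp add: total_def coordinate_def)
  have exp: "T i G = DX i G + (\<Sum>k\<in>?K. ?c i k * ?D k G)" if "G \<in> jet_fns" "order_le r S G" for i G
    using T_expand[OF that] by (simp add: split_beta)
  have jet_fns: "?D k F \<in> jet_fns" "order_le r S (?D k F)" "?c i k \<in> jet_fns" for i k
    using F r by (auto simp: split_beta intro: deriv_along_const_order)
  have comm: "?D k (DX i F) = DX i (?D k F)" "DX i (DX j F) = DX j (DX i F)" "?D k (?D l F) = ?D l (?D k F)" for i j k l
    by (simp_all add: split_beta deriv_along_const_commute[OF F])
  have "T i (T j F) = T i (DX j F) + (\<Sum>k\<in>?K. T i (?c j k) * ?D k F + ?c j k * T i (?D k F))" for i j
    unfolding exp[OF F r, of j]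
    by (subst deriv_along_add) (use F jet_fns in \<open>auto simp: deriv_along_sum deriv_along_mult mult_jet_fns intro!: sum_jet_fns\<close>)
  also have "T i (DX j F) + (\<Sum>k\<in>?K. T i (?c j k) * ?D k F + ?c j k * T i (?D k F)) =
    DX i (DX j F) + (\<Sum>k\<in>?K. ?c i k * DX j (?D k F)) + (\<Sum>k\<in>?K. T i (?c j k) * ?D k F)
     + (\<Sum>k\<in>?K. ?c j k * DX i (?D k F)) + (\<Sum>k\<in>?K. \<Sum>l\<in>?K. ?c j k * ?c i l * ?D l (?D k F))" for i j
    unfolding exp[OF jet_fns(1,2)]
    by (subst exp) (use F r in \<open>auto intro: deriv_along_const_order
        simp: comm sum.distrib distrib_left sum_distrib_left mult_ac add_ac\<close>)
  finally have *: "T i (T j F) = 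
    DX i (DX j F) + (\<Sum>k\<in>?K. ?c i k * DX j (?D k F)) + (\<Sum>k\<in>?K. T i (?c j k) * ?D k F)
     + (\<Sum>k\<in>?K. ?c j k * DX i (?D k F)) + (\<Sum>k\<in>?K. \<Sum>l\<in>?K. ?c j k * ?c i l * ?D l (?D k F))" for i j .
  have "(\<Sum>k\<in>?K. \<Sum>l\<in>?K. ?c j k * ?c i l * ?D l (?D k F)) = (\<Sum>k\<in>?K. \<Sum>l\<in>?K. ?c i k * ?c j l * ?D l (?D k F))"
    by (subst sum.swap) (simp add: comm(3) mult_ac)
  moreover have "T i (?c j k) = T j (?c i k)" for k
    unfolding Tc by (simp add: add_mset_commute)
  ultimately show ?thesis
    unfolding *[of i j] *[of j i] by (simp add: comm add_ac)
qed

end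

section \<open>Self-adjointness of the linearized Euler-Lagrange operator\<close>

lemma mset_list_of [simp]: "mset (list_of M) = M"
  unfolding list_of_def by (rule someI_ex) (rule ex_mset)

lemma list_of_empty [simp]: "list_of {#} = []"
  using mset_list_of[of "{#}"] by (metis mset_zero_iff)

lemma foldr_closed: "F \<in> A \<Longrightarrow> (\<And>i F. F \<in> A \<Longrightarrow> g i F \<in> A) \<Longrightarrow> foldr g I F \<in> A"
  by (induction I) auto

text \<open>Each index of \<open>I\<close> is pulled to the front of \<open>J\<close> past its
  predecessors. The set \<open>A\<close> confines commutation to functions where it holds; the
  operators below are \<open>d\<^sub>i\<close>, \<open>- d\<^sub>i\<close> and partial derivatives
  on an open set.\<close>

lemma foldr_mset_cong:
  assumes closed: "\<And>i F. F \<in> A \<Longrightarrow> g i F \<in> A"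
    and comm: "\<And>i j F. F \<in> A \<Longrightarrow> g i (g j F) = g j (g i F)"
    and F: "F \<in> A" and "mset I = mset J"
  shows "foldr g I F = foldr g J F"
  using assms(4)
proof (induction I arbitrary: J)
  case (Cons i I)
  have front: "foldr g (K @ i # K') F = g i (foldr g (K @ K') F)" for K K'
  proof (induction K)
    case (Cons k K)
    have "foldr g (K @ K') F \<in> A" using F closed by (rule foldr_closed)
    then show ?case using Cons comm[of "foldr g (K @ K') F" k i] by simp
  qed simp
  obtain J1 J2 where J: "J = J1 @ i # J2"
    using Cons.prems by (metis list.set_intros(1) set_mset_mset split_list)
  have "mset I = mset (J1 @ J2)" using Cons.prems by (simp add: J)
  from Cons.IH[OF this] show ?case unfolding J front by simp
qed simp

section \<open>Iterated total derivatives and Euler expressions\<close>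

context jets
begin

text \<open>Arithmetic of functions is kept unevaluated from here on, so that simplification handles
  equations between functions; \<open>pointwise\<close> is supplied where values are needed.\<close>

lemmas pointwise = plus_fun_apply times_fun_apply uminus_apply minus_apply zero_fun_apply

declare pointwise [simp del]

lemma minus_jet_fns: "F \<in> jet_fns \<Longrightarrow> G \<in> jet_fns \<Longrightarrow> F - G \<in> jet_fns"
  using add_jet_fns[of F "- G"] uminus_jet_fns[of G] by simp

definition total_mset :: "'n multiset \<Rightarrow> (('n, 'm) jet \<Rightarrow> real) \<Rightarrow> ('n, 'm) jet \<Rightarrow> real"
  where "total_mset M = foldr T (list_of M)"

text \<open>The sign \<open>(-1)\<^sup>|\<^sup>M\<^sup>|\<close> of \<open>d\<^sub>M\<close> is built into the iteration.\<close>

definition neg_total_mset :: "'n multiset \<Rightarrow> (('n, 'm) jet \<Rightarrow> real) \<Rightarrow> ('n, 'm) jet \<Rightarrow> real"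
  where "neg_total_mset M = foldr (\<lambda>i F. - T i F) (list_of M)"

lemma T_uminus: "F \<in> jet_fns \<Longrightarrow> T i (- F) = - T i F"
  by (rule deriv_along_uminus)

lemma NT_jet_fns: "F \<in> jet_fns \<Longrightarrow> - T i F \<in> jet_fns"
  by auto

lemma NT_commute: "F \<in> jet_fns \<Longrightarrow> - T i (- T j F) = - T j (- T i F)"
  by (simp add: T_uminus T_jet_fns T_commute)

lemma foldr_T_eq_total_mset: "F \<in> jet_fns \<Longrightarrow> foldr T I F = total_mset (mset I) F"
  unfolding total_mset_def by (rule foldr_mset_cong[where A = jet_fns]) (auto simp: T_commute)

lemma foldr_NT_eq_neg_total_mset: "F \<in> jet_fns \<Longrightarrow> foldr (\<lambda>i F. - T i F) I F = neg_total_mset (mset I) F"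
  unfolding neg_total_mset_def by (rule foldr_mset_cong[where A = jet_fns]) (auto simp: NT_jet_fns NT_commute)

lemma total_mset_jet_fns [intro]: "F \<in> jet_fns \<Longrightarrow> total_mset M F \<in> jet_fns"
  unfolding total_mset_def by (rule foldr_closed) auto

lemma neg_total_mset_jet_fns [intro]: "F \<in> jet_fns \<Longrightarrow> neg_total_mset M F \<in> jet_fns"
  unfolding neg_total_mset_def by (rule foldr_closed) auto

lemma total_mset_empty [simp]: "total_mset {#} F = F"
  and neg_total_mset_empty [simp]: "neg_total_mset {#} F = F"
  by (simp_all add: total_mset_def neg_total_mset_def)

text \<open>A further index may be applied last or, by commutativity, first. The first form drives
  inductions on the multi-index, the primed form pushes a derivative onto the argument.\<close>

lemma total_mset_add_mset: "F \<in> jet_fns \<Longrightarrow> total_mset (add_mset i M) F = T i (total_mset M F)"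
  using foldr_T_eq_total_mset[of F "i # list_of M"] foldr_T_eq_total_mset[of F "list_of M"] by simp

lemma total_mset_add_mset': "F \<in> jet_fns \<Longrightarrow> total_mset (add_mset i M) F = total_mset M (T i F)"
  using foldr_T_eq_total_mset[of F "list_of M @ [i]"] foldr_T_eq_total_mset[of "T i F" "list_of M"] by auto

lemma neg_total_mset_add_mset: "F \<in> jet_fns \<Longrightarrow> neg_total_mset (add_mset i M) F = - T i (neg_total_mset M F)"
  using foldr_NT_eq_neg_total_mset[of F "i # list_of M"] foldr_NT_eq_neg_total_mset[of F "list_of M"] by simp

lemma neg_total_mset_add_mset': "F \<in> jet_fns \<Longrightarrow> neg_total_mset (add_mset i M) F = neg_total_mset M (- T i F)"
  using foldr_NT_eq_neg_total_mset[of F "list_of M @ [i]"] foldr_NT_eq_neg_total_mset[of "- T i F" "list_of M"] by auto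

lemma neg_total_mset_add: "F \<in> jet_fns \<Longrightarrow> G \<in> jet_fns \<Longrightarrow> neg_total_mset M (F + G) = neg_total_mset M F + neg_total_mset M G"
proof (induction M)
  case (add i M)
  then show ?case by (simp add: neg_total_mset_add_mset deriv_along_add add_jet_fns neg_total_mset_jet_fns)
qed simp

lemma neg_total_mset_uminus: "F \<in> jet_fns \<Longrightarrow> neg_total_mset M (- F) = - neg_total_mset M F"
proof (induction M)
  case (add i M)
  then show ?case by (simp add: neg_total_mset_add_mset uminus_jet_fns deriv_along_uminus neg_total_mset_jet_fns T_jet_fns)
qed simp

lemma neg_total_mset_zero [simp]: "neg_total_mset M 0 = 0"
  using neg_total_mset_add[of 0 0 M] by (simp add: zero_jet_fns)

lemma neg_total_mset_sum: "(\<And>i. i \<in> I \<Longrightarrow> F i \<in> jet_fns) \<Longrightarrow> neg_total_mset M (\<Sum>i\<in>I. F i) = (\<Sum>i\<in>I. neg_total_mset M (F i))"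
  by (induction I rule: infinite_finite_induct) (auto simp: neg_total_mset_add sum_jet_fns)

text \<open>This bounds the multi-indices of nonzero fibre derivatives, which is what truncated sums
  need. Its growth under \<open>T i\<close> follows algebraically from \<open>D_T\<close>.\<close>

definition vertical_order :: "nat \<Rightarrow> (('n, 'm) jet \<Rightarrow> real) \<Rightarrow> bool"
  where "vertical_order N F \<longleftrightarrow> (\<forall>\<sigma> M. N < size M \<longrightarrow> D \<sigma> M F = 0)"

lemma vertical_orderD: "vertical_order N F \<Longrightarrow> N < size M \<Longrightarrow> D \<sigma> M F = 0"
  by (simp add: vertical_order_def)

lemma order_le_vertical_order: "F \<in> jet_fns \<Longrightarrow> order_le r S F \<Longrightarrow> vertical_order r F"
  by (simp add: vertical_order_def D_high_order)

lemma vertical_order_mono: "vertical_order N F \<Longrightarrow> N \<le> N' \<Longrightarrow> vertical_order N' F"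
  by (simp add: vertical_order_def)

lemma vertical_order_exists: assumes "F \<in> jet_fns" obtains N where "vertical_order N F"
proof -
  obtain r where "order_le r S F" by (rule jet_fns_order[OF assms])
  then show ?thesis using order_le_vertical_order[OF assms] that by blast
qed

lemma vertical_order_D: "F \<in> jet_fns \<Longrightarrow> vertical_order N F \<Longrightarrow> vertical_order N (D \<sigma> M F)"
  unfolding vertical_order_def by (subst deriv_along_const_commute) auto

lemma vertical_order_T: "F \<in> jet_fns \<Longrightarrow> vertical_order N F \<Longrightarrow> vertical_order (Suc N) (T i F)"
  by (auto simp: vertical_order_def D_T size_Diff_singleton)

lemma vertical_order_uminus: "F \<in> jet_fns \<Longrightarrow> vertical_order N F \<Longrightarrow> vertical_order N (- F)"
  by (simp add: vertical_order_def deriv_along_uminus)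

lemma vertical_order_mult: "F \<in> jet_fns \<Longrightarrow> G \<in> jet_fns \<Longrightarrow> vertical_order N F \<Longrightarrow> vertical_order N G \<Longrightarrow> vertical_order N (F * G)"
  by (simp add: vertical_order_def deriv_along_mult)

lemma vertical_order_sum: "(\<And>i. i \<in> I \<Longrightarrow> F i \<in> jet_fns) \<Longrightarrow> (\<And>i. i \<in> I \<Longrightarrow> vertical_order N (F i)) \<Longrightarrow> vertical_order N (\<Sum>i\<in>I. F i)"
  by (simp add: vertical_order_def deriv_along_sum)

lemma vertical_order_neg_total_mset: "F \<in> jet_fns \<Longrightarrow> vertical_order N F \<Longrightarrow> vertical_order (N + size M) (neg_total_mset M F)"
proof (induction M)
  case (add i M)
  then show ?case by (simp add: neg_total_mset_add_mset neg_total_mset_jet_fns T_jet_fns vertical_order_uminus vertical_order_T)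
qed simp

text \<open>This is \<open>P\<^sub>\<sigma>(Q; b)\<close>, the formal adjoint of the linearization
  of \<open>Q\<close> applied to \<open>b\<close>. The cutoff \<open>N\<close> has no effect on the
  value once it bounds the vertical order of \<open>Q\<close>, see
  \<open>Euler_pairing_mono\<close>.\<close>

definition Euler_pairing :: "nat \<Rightarrow> 'm \<Rightarrow> (('n, 'm) jet \<Rightarrow> real) \<Rightarrow> (('n, 'm) jet \<Rightarrow> real) \<Rightarrow> ('n, 'm) jet \<Rightarrow> real"
  where "Euler_pairing N \<sigma> Q b = (\<Sum>M | size M \<le> N. neg_total_mset M (D \<sigma> M Q * b))"

definition Euler_expr :: "nat \<Rightarrow> 'm \<Rightarrow> (('n, 'm) jet \<Rightarrow> real) \<Rightarrow> ('n, 'm) jet \<Rightarrow> real"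
  where "Euler_expr N \<sigma> F = (\<Sum>M | size M \<le> N. neg_total_mset M (D \<sigma> M F))"

lemma Euler_expr_jet_fns [intro]: "F \<in> jet_fns \<Longrightarrow> Euler_expr N \<sigma> F \<in> jet_fns"
  unfolding Euler_expr_def by (auto intro!: sum_jet_fns)

lemma sum_size_le_mono:
  assumes "\<And>M :: 'n multiset. N < size M \<Longrightarrow> f M = (0 :: 'z::comm_monoid_add)" "N \<le> N'"
  shows "(\<Sum>M | size M \<le> N'. f M) = (\<Sum>M | size M \<le> N. f M)"
  by (rule sum.mono_neutral_right) (use assms in \<open>auto simp: finite_multisets_size_le not_le\<close>)

lemma Euler_pairing_mono: "vertical_order N Q \<Longrightarrow> N \<le> N' \<Longrightarrow> Euler_pairing N' \<sigma> Q b = Euler_pairing N \<sigma> Q b"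
  unfolding Euler_pairing_def by (rule sum_size_le_mono) (simp_all add: vertical_orderD)

text \<open>Fibre derivatives obey the Leibniz rule and \<open>neg_total_mset\<close> is additive.
  Applied to the products \<open>\<Xi>\<^sup>\<tau> E\<^sub>\<tau>\<close>, this splits the
  coefficient of the Jacobi morphism into its two sums.\<close>

lemma Euler_expr_mult: "F \<in> jet_fns \<Longrightarrow> G \<in> jet_fns \<Longrightarrow> Euler_expr N \<sigma> (F * G) = Euler_pairing N \<sigma> F G + Euler_pairing N \<sigma> G F"
  unfolding Euler_expr_def Euler_pairing_def sum.distrib[symmetric]
  by (intro sum.cong refl) (simp add: deriv_along_mult neg_total_mset_add mult_jet_fns deriv_along_const_jet_fns mult.commute)

lemma Euler_expr_sum: "(\<And>i. i \<in> I \<Longrightarrow> F i \<in> jet_fns) \<Longrightarrow> Euler_expr N \<sigma> (\<Sum>i\<in>I. F i) = (\<Sum>i\<in>I. Euler_expr N \<sigma> (F i))"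
  unfolding Euler_expr_def by (subst sum.swap) (simp add: deriv_along_sum neg_total_mset_sum deriv_along_const_jet_fns)

lemma Euler_pairing_sum:
  "(\<And>i. i \<in> I \<Longrightarrow> F i \<in> jet_fns) \<Longrightarrow> b \<in> jet_fns \<Longrightarrow> Euler_pairing N \<sigma> (\<Sum>i\<in>I. F i) b = (\<Sum>i\<in>I. Euler_pairing N \<sigma> (F i) b)"
  unfolding Euler_pairing_def by (subst sum.swap) (simp add: deriv_along_sum sum_distrib_right neg_total_mset_sum deriv_along_const_jet_fns mult_jet_fns)

text \<open>Adding \<open>i\<close> is a bijection onto the multisets that contain \<open>i\<close>;
  it reindexes the shifted term of \<open>D_T\<close>.\<close>

lemma sum_size_add_mset:
  "(\<Sum>M | size M \<le> Suc N. if i \<in># M then f M else 0) = (\<Sum>M | size M \<le> N. f (add_mset i M))"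
  for f :: "'n multiset \<Rightarrow> 'z::comm_monoid_add"
proof -
  have "(\<Sum>M | size M \<le> N. f (add_mset i M)) = sum f (add_mset i ` {M. size M \<le> N})"
    by (subst sum.reindex) (simp_all add: inj_on_def)
  also have "add_mset i ` {M. size M \<le> N} = {M. size M \<le> Suc N \<and> i \<in># M}"
    by (auto simp: image_iff dest!: multi_member_split)
  also have "sum f \<dots> = (\<Sum>M | size M \<le> Suc N. if i \<in># M then f M else 0)"
    using sum.inter_filter[OF finite_multisets_size_le, of f "Suc N" "\<lambda>M. i \<in># M"]
    by simp
  finally show ?thesis by simp
qed

text \<open>Reindexing the shifted term of \<open>D_T\<close> produces
  \<open>- T i (D \<sigma> M Q * b)\<close>. By the Leibniz rule its part with
  \<open>T i (D \<sigma> M Q)\<close> cancels the other term, which leaves one integration by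
  parts.\<close>

lemma Euler_pairing_T:
  assumes Q: "Q \<in> jet_fns" "vertical_order N Q" and b: "b \<in> jet_fns"
  shows "Euler_pairing (Suc N) \<sigma> (T i Q) b = Euler_pairing N \<sigma> Q (- T i b)"
proof -
  have "Euler_pairing (Suc N) \<sigma> (T i Q) b = (\<Sum>M | size M \<le> Suc N. neg_total_mset M (T i (D \<sigma> M Q) * b)) +
      (\<Sum>M | size M \<le> Suc N. if i \<in># M then neg_total_mset M (D \<sigma> (M - {#i#}) Q * b) else 0)"
    unfolding Euler_pairing_def sum.distrib[symmetric]
    by (intro sum.cong refl)
      (use Q b in \<open>simp add: D_T distrib_right neg_total_mset_add mult_jet_fns T_jet_fns deriv_along_const_jet_fns\<close>)
  also have "(\<Sum>M | size M \<le> Suc N. neg_total_mset M (T i (D \<sigma> M Q) * b)) = (\<Sum>M | size M \<le> N. neg_total_mset M (T i (D \<sigma> M Q) * b))"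
    by (rule sum_size_le_mono) (simp_all add: vertical_orderD[OF Q(2)])
  also have "(\<Sum>M | size M \<le> Suc N. if i \<in># M then neg_total_mset M (D \<sigma> (M - {#i#}) Q * b) else 0) =
      (\<Sum>M | size M \<le> N. neg_total_mset M (- T i (D \<sigma> M Q * b)))"
    unfolding sum_size_add_mset using Q b by (simp add: neg_total_mset_add_mset' mult_jet_fns deriv_along_const_jet_fns)
  also have "(\<Sum>M | size M \<le> N. neg_total_mset M (T i (D \<sigma> M Q) * b)) + \<dots> = Euler_pairing N \<sigma> Q (- T i b)"
    unfolding Euler_pairing_def sum.distrib[symmetric]
    using Q b by (intro sum.cong refl)
      (subst neg_total_mset_add[symmetric]; simp add: mult_jet_fns deriv_along_const_jet_fns T_jet_fns uminus_jet_fns minus_jet_fns deriv_along_mult)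
  finally show ?thesis .
qed

lemma Euler_pairing_NT:
  assumes Q: "Q \<in> jet_fns" "vertical_order N Q" and b: "b \<in> jet_fns"
  shows "Euler_pairing (Suc N) \<sigma> (- T i Q) b = Euler_pairing N \<sigma> Q (T i b)"
  using Euler_pairing_T[of "- Q" N b \<sigma> i] assms
  by (simp add: uminus_jet_fns vertical_order_uminus T_uminus Euler_pairing_def deriv_along_uminus neg_total_mset_uminus mult_jet_fns deriv_along_const_jet_fns T_jet_fns)

text \<open>The signs inside \<open>neg_total_mset\<close> cancel those of the integrations by
  parts. Each step transfers one derivative to \<open>b\<close>, hence the induction for arbitrary
  \<open>b\<close>.\<close>

lemma Euler_pairing_neg_total_mset:
  assumes Q: "Q \<in> jet_fns" "vertical_order N Q" and b: "b \<in> jet_fns"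
  shows "Euler_pairing (N + size K) \<sigma> (neg_total_mset K Q) b = Euler_pairing N \<sigma> Q (total_mset K b)"
  using b
proof (induction K arbitrary: b)
  case (add i K)
  then show ?case using Q
    by (simp add: neg_total_mset_add_mset Euler_pairing_NT neg_total_mset_jet_fns vertical_order_neg_total_mset total_mset_add_mset' T_jet_fns)
qed simp

section \<open>Evolutionary fields and the Helmholtz condition\<close>

definition evolutionary :: "('m \<Rightarrow> ('n, 'm) jet \<Rightarrow> real) \<Rightarrow> ('n, 'm) vfield"
  where "evolutionary Q p = (0, \<lambda>K. \<chi> \<tau>. total_mset K (Q \<tau>) p)"

lemma evolutionary_expand:
  assumes F: "F \<in> jet_fns" "vertical_order N F"
  shows "deriv_along (evolutionary Q) F = (\<Sum>\<tau>\<in>UNIV. \<Sum>K | size K \<le> N. total_mset K (Q \<tau>) * D \<tau> K F)"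
proof -
  obtain r where r: "order_le r S F" by (rule jet_fns_order[OF F(1)])
  have "deriv_along (evolutionary Q) F = (\<Sum>\<tau>\<in>UNIV. \<Sum>K | size K \<le> r. total_mset K (Q \<tau>) * D \<tau> K F)"
  proof
    fix p
    show "deriv_along (evolutionary Q) F p = (\<Sum>\<tau>\<in>UNIV. \<Sum>K | size K \<le> r. total_mset K (Q \<tau>) * D \<tau> K F) p"
      using dirderiv_expand[OF F(1) r, of p "evolutionary Q p"]
      by (cases "p \<in> S") (auto simp: deriv_along_in[of p "evolutionary Q"] evolutionary_def deriv_along_out sum_fun_apply sum.cartesian_product
          pointwise split_beta)
  qed
  \<comment> \<open>\<open>r\<close> bounds the coordinates that occur in \<open>F\<close>, and
    \<open>N\<close> its nonzero fibre derivatives. Either may be the larger one, so the sum is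
    extended to the maximum and then cut at \<open>N\<close>.\<close>
  also have "\<dots> = (\<Sum>\<tau>\<in>UNIV. \<Sum>K | size K \<le> max N r. total_mset K (Q \<tau>) * D \<tau> K F)"
    by (intro sum.cong refl sum_size_le_mono[symmetric]) (auto simp: D_high_order[OF r F(1)])
  also have "\<dots> = (\<Sum>\<tau>\<in>UNIV. \<Sum>K | size K \<le> N. total_mset K (Q \<tau>) * D \<tau> K F)"
    by (intro sum.cong refl sum_size_le_mono) (auto simp: vertical_orderD[OF F(2)])
  finally show ?thesis .
qed

lemma evolutionary_jet_fns: "F \<in> jet_fns \<Longrightarrow> (\<And>\<tau>. Q \<tau> \<in> jet_fns) \<Longrightarrow> deriv_along (evolutionary Q) F \<in> jet_fns"
proof -
  assume F: "F \<in> jet_fns" and Q: "\<And>\<tau>. Q \<tau> \<in> jet_fns"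
  obtain N where "vertical_order N F" by (rule vertical_order_exists[OF F])
  then show ?thesis using F Q by (auto simp: evolutionary_expand intro!: sum_jet_fns mult_jet_fns)
qed

text \<open>The shifted term of \<open>D_T\<close>, once reindexed, carries \<open>T i\<close> on
  the coefficient \<open>total_mset K (Q \<tau>)\<close>; this is the half of the Leibniz rule that
  the other term lacks.\<close>

lemma evolutionary_T:
  assumes F: "F \<in> jet_fns" and Q: "\<And>\<tau>. Q \<tau> \<in> jet_fns"
  shows "deriv_along (evolutionary Q) (T i F) = T i (deriv_along (evolutionary Q) F)"
proof -
  obtain N where N: "vertical_order N F" by (rule vertical_order_exists[OF F])
  have "deriv_along (evolutionary Q) (T i F) = (\<Sum>\<tau>\<in>UNIV. (\<Sum>K | size K \<le> Suc N. total_mset K (Q \<tau>) * T i (D \<tau> K F)) +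
    (\<Sum>K | size K \<le> Suc N. if i \<in># K then total_mset K (Q \<tau>) * D \<tau> (K - {#i#}) F else 0))"
    unfolding evolutionary_expand[OF T_jet_fns[OF F] vertical_order_T[OF F N]] sum.distrib[symmetric]
    by (intro sum.cong refl) (simp add: D_T F distrib_left)
  also have "\<dots> = (\<Sum>\<tau>\<in>UNIV. (\<Sum>K | size K \<le> N. total_mset K (Q \<tau>) * T i (D \<tau> K F)) +
    (\<Sum>K | size K \<le> N. T i (total_mset K (Q \<tau>)) * D \<tau> K F))"
    unfolding sum_size_add_mset using Q
    by (intro sum.cong refl arg_cong2[where f = "(+)"] sum_size_le_mono)
      (simp_all add: vertical_orderD[OF N] total_mset_add_mset)
  also have "\<dots> = T i (deriv_along (evolutionary Q) F)"
    unfolding evolutionary_expand[OF F N] using F Q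
    by (simp add: deriv_along_sum deriv_along_mult sum_jet_fns mult_jet_fns total_mset_jet_fns deriv_along_const_jet_fns sum.distrib add.commute)
  finally show ?thesis .
qed

lemma evolutionary_neg_total_mset:
  assumes "F \<in> jet_fns" and Q: "\<And>\<tau>. Q \<tau> \<in> jet_fns"
  shows "deriv_along (evolutionary Q) (neg_total_mset M F) = neg_total_mset M (deriv_along (evolutionary Q) F)"
  using assms(1)
proof (induction M)
  case (add i M)
  then show ?case
    by (simp add: neg_total_mset_add_mset deriv_along_uminus[OF T_jet_fns] evolutionary_T[OF neg_total_mset_jet_fns Q] neg_total_mset_jet_fns evolutionary_jet_fns Q)
qed simp

theorem Helmholtz:
  assumes L: "L \<in> jet_fns" "vertical_order R L" and Q: "\<And>\<tau>. Q \<tau> \<in> jet_fns" and N: "2 * R \<le> N"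
  shows "deriv_along (evolutionary Q) (Euler_expr R \<sigma> L) = (\<Sum>\<tau>\<in>UNIV. Euler_pairing N \<sigma> (Euler_expr R \<tau> L) (Q \<tau>))"
proof -
  have "deriv_along (evolutionary Q) (Euler_expr R \<sigma> L) = (\<Sum>M | size M \<le> R. neg_total_mset M (deriv_along (evolutionary Q) (D \<sigma> M L)))"
    unfolding Euler_expr_def using L by (simp add: deriv_along_sum neg_total_mset_jet_fns deriv_along_const_jet_fns evolutionary_neg_total_mset Q)
  \<comment> \<open>The two fibre derivatives of \<open>L\<close> are exchanged, so that for fixed
    \<open>\<tau>\<close> and \<open>K\<close> the sum over \<open>M\<close> is a pairing with first
    argument \<open>D \<tau> K L\<close>.\<close>
  also have "\<dots> = (\<Sum>M | size M \<le> R. \<Sum>\<tau>\<in>UNIV. \<Sum>K | size K \<le> R. neg_total_mset M (D \<sigma> M (D \<tau> K L) * total_mset K (Q \<tau>)))"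
    using L Q by (intro sum.cong refl)
      (simp add: evolutionary_expand[where N = R] deriv_along_const_jet_fns vertical_order_D neg_total_mset_sum sum_jet_fns mult_jet_fns total_mset_jet_fns
        deriv_along_const_commute[of L "unit_vertical \<sigma> _"] mult.commute)
  also have "\<dots> = (\<Sum>\<tau>\<in>UNIV. \<Sum>K | size K \<le> R. Euler_pairing R \<sigma> (D \<tau> K L) (total_mset K (Q \<tau>)))"
    unfolding Euler_pairing_def by (subst sum.swap, rule sum.cong[OF refl], rule sum.swap)
  \<comment> \<open>Integration by parts runs backwards here: \<open>d\<^sub>K\<close> returns from
    \<open>Q \<tau>\<close> to \<open>D \<tau> K L\<close>. This raises the vertical order to at
    most \<open>2 * R\<close>, whence the bound on \<open>N\<close>.\<close>
  also have "\<dots> = (\<Sum>\<tau>\<in>UNIV. \<Sum>K | size K \<le> R. Euler_pairing N \<sigma> (neg_total_mset K (D \<tau> K L)) (Q \<tau>))"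
  proof (intro sum.cong refl)
    fix \<tau> and K :: "'n multiset" assume "K \<in> {K. size K \<le> R}"
    then have "R + size K \<le> N" using N by simp
    then show "Euler_pairing R \<sigma> (D \<tau> K L) (total_mset K (Q \<tau>)) = Euler_pairing N \<sigma> (neg_total_mset K (D \<tau> K L)) (Q \<tau>)"
      using L Q by (subst Euler_pairing_mono[of "R + size K"]) (simp_all add: vertical_order_neg_total_mset vertical_order_D deriv_along_const_jet_fns Euler_pairing_neg_total_mset)
  qed
  also have "\<dots> = (\<Sum>\<tau>\<in>UNIV. Euler_pairing N \<sigma> (Euler_expr R \<tau> L) (Q \<tau>))"
    unfolding Euler_expr_def using L Q by (simp add: Euler_pairing_sum neg_total_mset_jet_fns deriv_along_const_jet_fns)
  finally show ?thesis .
qed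

end

section \<open>Source forms\<close>

lemma coord_no_bij: "bij_betw (coord_no :: 'n::finite \<Rightarrow> nat) UNIV {..<CARD('n)}"
  unfolding coord_no_def
proof (rule someI_ex[where P = "\<lambda>f. bij_betw f UNIV {..<CARD('n)}"])
  show "\<exists>f :: 'n \<Rightarrow> nat. bij_betw f UNIV {..<CARD('n)}"
    using ex_bij_betw_finite_nat[of "UNIV :: 'n set"] by (simp add: atLeast0LessThan)
qed

lemma coord_no_less: "coord_no (j :: 'n::finite) < CARD('n)"
  using bij_betwE[OF coord_no_bij] by blast

lemma ds_cong:
  fixes p q :: "('n::finite, 'm::finite) jet"
  assumes "\<And>k. k < CARD('n) \<Longrightarrow> fst (vs ! k) = fst (ws ! k)"
  shows "ds p vs = ds q ws"
  by (simp add: ds_def assms coord_no_less)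

lemma ds_vertical:
  fixes p :: "('n::finite, 'm::finite) jet"
  assumes "k < CARD('n)" "fst (vs ! k) = 0"
  shows "ds p vs = 0"
proof -
  obtain j :: 'n where j: "coord_no j = k"
    using assms(1) bij_betw_imp_surj_on[OF coord_no_bij] by (metis imageE lessThan_iff)
  have "det (transpose (\<chi> i j. fst (vs ! coord_no j) $ i :: real^'n^'n)) = 0"
    by (rule det_zero_row(1)[of j])
      (simp add: row_def transpose_def j assms(2) vec_eq_iff)
  then show ?thesis by (simp add: ds_def)
qed

lemma ds_vertical_Cons: "fst u = 0 \<Longrightarrow> ds (p :: ('n::finite, 'm::finite) jet) (u # vs) = 0"
  by (rule ds_vertical[of 0]) simp_all

text \<open>\<open>source_coeff\<close> evaluates at these vectors; \<open>inv coord_no\<close>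
  makes their matrix the identity for whichever numbering \<open>coord_no\<close> is.\<close>

lemma ds_basis: "ds (p :: ('n::finite, 'm::finite) jet) (map (\<lambda>k. (axis (inv coord_no k) 1, 0)) [0..<CARD('n)]) = 1"
proof -
  have inj: "inj (coord_no :: 'n \<Rightarrow> nat)" using coord_no_bij by (rule bij_betw_imp_inj_on)
  have "(\<chi> i j. fst (map (\<lambda>k. (axis (inv coord_no k) 1, 0 :: 'n multiset \<Rightarrow> real^'m)) [0..<CARD('n)] ! coord_no j) $ i)
      = (mat 1 :: real^'n^'n)"
    using inj by (auto simp: vec_eq_iff mat_def coord_no_less axis_def)
  then show ?thesis by (simp add: ds_def)
qed

lemma omit_Cons_0 [simp]: "omit 0 (v # vs) = vs"
  and omit_Cons_Suc [simp]: "omit (Suc j) (v # vs) = v # omit j vs"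
  by (simp_all add: omit_def)

lemma length_omit: "j < length vs \<Longrightarrow> length (omit j vs) = length vs - 1"
  by (simp add: omit_def)

lemma sum_Cons_shift:
  "(\<Sum>j<Suc n. (-1) ^ j * f j) = f 0 - (\<Sum>j<n. (-1) ^ j * (f (Suc j) :: real))"
  unfolding sum.lessThan_Suc_shift by (simp add: sum_negf)

lemma dext_Cons:
  "dext \<rho> p (v # vs) = dirderiv v (\<lambda>q. \<rho> q vs) p -
    (\<Sum>j<length vs. (-1) ^ j * dirderiv (vs ! j) (\<lambda>q. \<rho> q (v # omit j vs)) p)"
  unfolding dext_def length_Cons sum_Cons_shift by simp

lemma wedge1_Cons:
  "wedge1 \<alpha> \<rho> p (v # vs) = \<alpha> p v * \<rho> p vs - (\<Sum>j<length vs. (-1) ^ j * (\<alpha> p (vs ! j) * \<rho> p (v # omit j vs)))"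
  unfolding wedge1_def length_Cons mult.assoc sum_Cons_shift by simp

lemma fst_horiz [simp]: "fst (horiz p v) = fst v"
  by (simp add: horiz_eq)

lemma fst_vert [simp]: "fst (vert p v) = 0"
  by (simp add: vert_def)

lemma vert_vertical: "fst v = 0 \<Longrightarrow> vert p v = v"
  by (simp add: vert_def contact_form_def prod_eq_iff)

lemma horiz_vertical: "fst v = 0 \<Longrightarrow> horiz p v = 0"
  by (simp add: horiz_eq prod_eq_iff fun_eq_iff vec_eq_iff)

lemma contact_component_1:
  "contact_component 1 \<rho> p us = (\<Sum>j<length us. \<rho> p
    (map (\<lambda>k. if k = j then vert p (us ! k) else horiz p (us ! k)) [0..<length us]))"
proof -
  have "{S. S \<subseteq> {..<length us} \<and> card S = 1} = (\<lambda>j. {j}) ` {..<length us}"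
    by (auto simp: card_1_singleton_iff)
  then show ?thesis
    unfolding contact_component_def by (simp add: sum.reindex inj_on_def)
qed

text \<open>The horizontal part of a vertical \<open>u\<close> is 0, so every choice of contact slot
  other than the first puts 0 into the first slot. These terms are kept, as \<open>\<rho>\<close> is
  not assumed linear; their vanishing is checked for each form separately.\<close>

lemma contact_component_1_vertical:
  assumes "fst u = 0"
  shows "\<exists>ws. (\<forall>j. length (ws j) = length vs) \<and>
    contact_component 1 \<rho> p (u # vs) = \<rho> p (u # map (horiz p) vs) + (\<Sum>j<length vs. \<rho> p (0 # ws j))"
proof -
  define ws where "ws j = map (\<lambda>k. if k = j then vert p (vs ! k) else horiz p (vs ! k)) [0..<length vs]" for j
  have upt: "[0..<length (u # vs)] = 0 # map Suc [0..<length vs]"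
    by (simp add: map_Suc_upt upt_conv_Cons del: upt_Suc)
  have 0: "map (\<lambda>k. if k = 0 then vert p ((u # vs) ! k) else horiz p ((u # vs) ! k)) [0..<length (u # vs)]
      = u # map (horiz p) vs"
    unfolding upt by (simp add: vert_vertical[OF assms] comp_def map_equality_iff)
  have Suc: "map (\<lambda>k. if k = Suc j then vert p ((u # vs) ! k) else horiz p ((u # vs) ! k)) [0..<length (u # vs)]
      = 0 # ws j" for j
    unfolding upt by (simp add: horiz_vertical[OF assms] comp_def ws_def)
  have "contact_component 1 \<rho> p (u # vs) = \<rho> p (u # map (horiz p) vs) + (\<Sum>j<length vs. \<rho> p (0 # ws j))"
    unfolding contact_component_1 length_Cons[of u vs] sum.lessThan_Suc_shift
    using 0 Suc by simp
  then show ?thesis by (intro exI[of _ ws]) (simp add: ws_def)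
qed

text \<open>The weight of \<open>I\<close> is the reciprocal of the number of enumerations of
  \<open>mset I\<close>, which is the factorial of its size divided by the factorials of its
  multiplicities.\<close>

lemma sum_lists_by_mset:
  fixes h :: "'n::finite multiset \<Rightarrow> real"
  shows "(\<Sum>I | length I \<le> N. (\<Prod>k\<in>UNIV. fact (count_list I k)) / fact (length I) * h (mset I)) =
    (\<Sum>M | size M \<le> N. h M)"
proof -
  have fin: "finite {I :: 'n list. length I \<le> N}"
    using finite_lists_length_le[of "UNIV :: 'n set" N] by simp
  have "(\<Sum>I | length I \<le> N. (\<Prod>k\<in>UNIV. fact (count_list I k)) / fact (length I) * h (mset I)) =
    (\<Sum>M | size M \<le> N. \<Sum>I | I \<in> {I. length I \<le> N} \<and> mset I = M. (\<Prod>k\<in>UNIV. fact (count_list I k)) / fact (length I) * h (mset I))"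
    by (rule sum.group[symmetric]) (auto simp: fin finite_multisets_size_le)
  also have "\<dots> = (\<Sum>M | size M \<le> N. h M)"
  proof (rule sum.cong[OF refl])
    fix M :: "'n multiset" assume "M \<in> {M. size M \<le> N}"
    then have "{I. I \<in> {I. length I \<le> N} \<and> mset I = M} = permutations_of_multiset M"
      by (auto simp: permutations_of_multiset_def)
    then have "(\<Sum>I | I \<in> {I. length I \<le> N} \<and> mset I = M. (\<Prod>k\<in>UNIV. fact (count_list I k)) / fact (length I) * h (mset I))
      = (\<Sum>I\<in>permutations_of_multiset M. (\<Prod>k\<in>UNIV. fact (count M k)) / fact (size M) * h M)"
      by (intro sum.cong) (auto simp: permutations_of_multiset_def count_mset)
    also have "\<dots> = real (card (permutations_of_multiset M)) * (\<Prod>k\<in>UNIV. fact (count M k)) / fact (size M) * h M"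
      by simp
    also have "(\<Prod>k\<in>UNIV. fact (count M k) :: real) = (\<Prod>k\<in>set_mset M. fact (count M k))"
      by (rule prod.mono_neutral_right) (auto simp: not_in_iff)
    also have "real (card (permutations_of_multiset M)) * \<dots> = fact (size M)"
      using arg_cong[OF card_permutations_of_multiset_aux[of M], of real] by simp
    finally show "(\<Sum>I | I \<in> {I. length I \<le> N} \<and> mset I = M. (\<Prod>k\<in>UNIV. fact (count_list I k)) / fact (length I) * h (mset I)) = h M"
      by simp
  qed
  finally show ?thesis .
qed

section \<open>Coordinate form of the interior Euler operator\<close>

context jets
begin

text \<open>Forms are functions on lists of any length and may take any values off \<open>S\<close>,
  so equality with \<open>F ds\<close> is asked on \<open>S\<close> and for lists of the right
  length. The same holds for \<open>is_source_form\<close>.\<close>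

definition is_horizontal :: "(('n, 'm) jet \<Rightarrow> real) \<Rightarrow> ('n, 'm) form \<Rightarrow> bool"
  where "is_horizontal F \<rho> \<longleftrightarrow> (\<forall>p\<in>S. \<forall>vs. length vs = CARD('n) \<longrightarrow> \<rho> p vs = F p * ds p vs)"

definition is_source_form :: "('m \<Rightarrow> ('n, 'm) jet \<Rightarrow> real) \<Rightarrow> ('n, 'm) form \<Rightarrow> bool"
  where "is_source_form E \<epsilon> \<longleftrightarrow> (\<forall>p\<in>S. \<forall>vs. length vs = Suc CARD('n) \<longrightarrow>
    \<epsilon> p vs = (\<Sum>\<sigma>\<in>UNIV. wedge1 (contact_form \<sigma> {#}) (\<lambda>q ws. E \<sigma> q * ds q ws) p vs))"

lemma is_horizontalD: "is_horizontal F \<rho> \<Longrightarrow> p \<in> S \<Longrightarrow> length vs = CARD('n) \<Longrightarrow> \<rho> p vs = F p * ds p vs"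
  by (simp add: is_horizontal_def)

lemma dirderiv_cmult: "F \<in> jet_fns \<Longrightarrow> p \<in> S \<Longrightarrow> dirderiv v (\<lambda>q. F q * c) p = dirderiv v F p * c"
  by (rule dirderiv_bounded_linear[OF bounded_linear_mult_left jet_fnsD(1)])

lemma dirderiv_zero: "F \<in> jet_fns \<Longrightarrow> p \<in> S \<Longrightarrow> dirderiv 0 F p = 0"
  using dirderiv_sum_direction[OF open_S jet_fnsD(1), of F p "{}" "\<lambda>_. 0" "\<lambda>_. 0"] by simp

lemma dirderiv_scaleR: "F \<in> jet_fns \<Longrightarrow> p \<in> S \<Longrightarrow> dirderiv (c *\<^sub>R v) F p = c * dirderiv v F p"
  using dirderiv_sum_direction[OF open_S jet_fnsD(1), of F p "{()}" "\<lambda>_. c" "\<lambda>_. v"] by simp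

lemma dirderiv_rep:
  assumes F: "F \<in> jet_fns" and \<rho>: "\<And>q. q \<in> S \<Longrightarrow> \<rho> q = F q * c" and p: "p \<in> S"
  shows "dirderiv v \<rho> p = dirderiv v F p * c"
  using dirderiv_cong[OF open_S \<rho> p] dirderiv_cmult[OF F p] by simp

text \<open>The Lie derivative of \<open>ds\<close> along a total derivative is 0. In Cartan's
  formula the terms that differentiate \<open>F\<close> along the arguments occur with opposite
  signs and cancel.\<close>

lemma lie_total_rep_step:
  assumes F: "F \<in> jet_fns" and \<rho>: "is_horizontal F \<rho>"
  shows "is_horizontal (T i F) (lie (total i) \<rho>)"
  unfolding is_horizontal_def
proof (intro ballI allI impI)
  fix p and vs :: "('n, 'm) jet list" assume p: "p \<in> S" and len: "length vs = CARD('n)"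
  have a: "dirderiv v (\<lambda>q. \<rho> q ws) p = dirderiv v F p * ds p ws" if "length ws = CARD('n)" for v ws
    by (rule dirderiv_rep[OF F _ p]) (use is_horizontalD[OF \<rho> _ that] in \<open>auto intro: ds_cong\<close>)
  have b: "dirderiv v (\<lambda>q. \<rho> q (total i q # ws)) p = dirderiv v F p * ds p (total i p # ws)"
    if "length ws = CARD('n) - 1" for v ws
  proof (rule dirderiv_rep[OF F _ p])
    fix q assume "q \<in> S"
    then have "\<rho> q (total i q # ws) = F q * ds q (total i q # ws)"
      using that by (intro is_horizontalD[OF \<rho>]) simp_all
    \<comment> \<open>\<open>total i q\<close> depends on \<open>q\<close>, but \<open>ds\<close>
      sees only its base part, the constant vector \<open>axis i 1\<close>.\<close>
    also have "ds q (total i q # ws) = ds p (total i p # ws)"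
      by (rule ds_cong) (auto simp: nth_Cons total_def split: nat.split)
    finally show "\<rho> q (total i q # ws) = F q * ds p (total i p # ws)" .
  qed
  have "contract (total i) (dext \<rho>) p vs = dirderiv (total i p) F p * ds p vs -
      (\<Sum>j<CARD('n). (-1) ^ j * (dirderiv (vs ! j) F p * ds p (total i p # omit j vs)))"
    unfolding contract_def dext_Cons len a[OF len]
    by (intro arg_cong2[where f = minus] refl sum.cong arg_cong2[where f = "(*)"] a)
      (simp add: length_omit len)
  moreover have "dext (contract (total i) \<rho>) p vs =
      (\<Sum>j<CARD('n). (-1) ^ j * (dirderiv (vs ! j) F p * ds p (total i p # omit j vs)))"
    unfolding dext_def contract_def len
    by (intro refl sum.cong arg_cong2[where f = "(*)"] b) (simp add: length_omit len)
  ultimately show "lie (total i) \<rho> p vs = T i F p * ds p vs"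
    by (simp add: lie_def deriv_along_in p)
qed

lemma lie_total_rep:
  assumes "F \<in> jet_fns" "is_horizontal F \<rho>"
  shows "is_horizontal (foldr T I F) (lie_total I \<rho>)"
  unfolding lie_total_def
proof (induction I)
  case (Cons i I)
  have "foldr T I F \<in> jet_fns" using assms(1) by (rule foldr_closed) auto
  with Cons show ?case by (simp add: lie_total_rep_step)
qed (simp add: assms)

lemma cmult_jet_fns: "F \<in> jet_fns \<Longrightarrow> (\<lambda>p. c * F p) \<in> jet_fns"
proof -
  assume F: "F \<in> jet_fns"
  obtain r where r: "order_le r S F" by (rule jet_fns_order[OF F])
  show ?thesis
  proof (rule jet_fnsI)
    show "smooth_on S (\<lambda>p. c * F p)"
      by (rule smooth_on_mult[OF open_S smooth_on_const jet_fnsD(1)[OF F]])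
    show "order_le r S (\<lambda>p. c * F p)" by (rule order_le_comp2[OF r r])
  qed (simp add: jet_fnsD(2)[OF F])
qed

lemma deriv_along_cmult: "F \<in> jet_fns \<Longrightarrow> deriv_along \<xi> (\<lambda>p. c * F p) = (\<lambda>p. c * deriv_along \<xi> F p)"
proof
  fix p assume F: "F \<in> jet_fns"
  show "deriv_along \<xi> (\<lambda>p. c * F p) p = c * deriv_along \<xi> F p"
    using dirderiv_cmult[OF F, of p "\<xi> p" c] by (cases "p \<in> S") (simp_all add: deriv_along_in deriv_along_out mult.commute)
qed

lemma foldr_T_cmult: "F \<in> jet_fns \<Longrightarrow> foldr T I (\<lambda>p. c * F p) = (\<lambda>p. c * foldr T I F p)"
proof (induction I)
  case (Cons i I)
  have "foldr T I F \<in> jet_fns" using Cons.prems by (rule foldr_closed) auto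
  with Cons show ?case by (simp add: deriv_along_cmult)
qed simp

lemma neg_total_mset_eq_foldr_T: "F \<in> jet_fns \<Longrightarrow> neg_total_mset (mset I) F p = (-1) ^ length I * foldr T I F p"
proof -
  assume F: "F \<in> jet_fns"
  have "foldr (\<lambda>i F. - T i F) I F = (\<lambda>p. (-1) ^ length I * foldr T I F p)"
  proof (induction I)
    case (Cons i I)
    have "foldr T I F \<in> jet_fns" using F by (rule foldr_closed) auto
    then show ?case by (simp add: Cons deriv_along_cmult) (simp add: fun_eq_iff pointwise)
  qed simp
  then show ?thesis unfolding foldr_NT_eq_neg_total_mset[OF F] by simp
qed

text \<open>The weights in \<open>d_dy\<close> turn the sum over lists into an unweighted sum over
  multisets. The scalar \<open>c\<close> in the last hypothesis absorbs these weights, because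
  \<open>\<rho>\<close> is not assumed linear.\<close>

lemma interior_Euler_source:
  assumes G: "\<And>\<sigma> M. G \<sigma> M \<in> jet_fns" and N: "\<And>\<sigma> M. N < size M \<Longrightarrow> G \<sigma> M = 0"
    and \<rho>: "\<And>\<sigma> M c p vs. p \<in> S \<Longrightarrow> length vs = CARD('n) \<Longrightarrow>
      contact_component 1 \<rho> p ((c *\<^sub>R unit_vertical \<sigma> M) # vs) = c * G \<sigma> M p * ds p vs"
  shows "is_source_form (\<lambda>\<sigma>. \<Sum>M | size M \<le> N. neg_total_mset M (G \<sigma> M)) (interior_Euler 1 \<rho>)"
  unfolding is_source_form_def
proof (intro ballI allI impI)
  fix p and vs :: "('n, 'm) jet list" assume p: "p \<in> S" and len: "length vs = Suc CARD('n)"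
  define w where "w I = (\<Prod>k\<in>UNIV. fact (count_list I k)) / (fact (length I) :: real)" for I :: "'n list"
  have fin: "finite {I :: 'n list. length I \<le> N}"
    using finite_lists_length_le[of "UNIV :: 'n set" N] by simp
  have inner: "Sum_any (\<lambda>I. (-1) ^ length I * lie_total I (contract (d_dy \<sigma> I) (contact_component 1 \<rho>)) p ws) =
      (\<Sum>M | size M \<le> N. neg_total_mset M (G \<sigma> M)) p * ds p ws" if ws: "length ws = CARD('n)" for \<sigma> ws
  proof -
    have "(-1) ^ length I * lie_total I (contract (d_dy \<sigma> I) (contact_component 1 \<rho>)) p ws =
        w I * (neg_total_mset (mset I) (G \<sigma> (mset I)) p * ds p ws)" for I
    proof -
      have "is_horizontal (\<lambda>p. w I * G \<sigma> (mset I) p) (contract (d_dy \<sigma> I) (contact_component 1 \<rho>))"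
        unfolding is_horizontal_def contract_def d_dy_def w_def using \<rho> by blast
      from is_horizontalD[OF lie_total_rep[OF cmult_jet_fns[OF G] this] p ws]
      show ?thesis by (simp add: foldr_T_cmult[OF G] neg_total_mset_eq_foldr_T[OF G])
    qed
    then have "Sum_any (\<lambda>I. (-1) ^ length I * lie_total I (contract (d_dy \<sigma> I) (contact_component 1 \<rho>)) p ws) =
       Sum_any (\<lambda>I. w I * (neg_total_mset (mset I) (G \<sigma> (mset I)) p * ds p ws))" by simp
    \<comment> \<open>For longer lists the coefficient \<open>G\<close> is 0, so
      \<open>Sum_any\<close> is an honest finite sum.\<close>
    also have "\<dots> = (\<Sum>I | length I \<le> N. w I * (neg_total_mset (mset I) (G \<sigma> (mset I)) p * ds p ws))"
    proof (rule Sum_any.expand_superset[OF fin], rule subsetI)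
      fix I assume "I \<in> {I. w I * (neg_total_mset (mset I) (G \<sigma> (mset I)) p * ds p ws) \<noteq> 0}"
      then show "I \<in> {I. length I \<le> N}"
        using N[of "mset I" \<sigma>] by (auto simp: pointwise intro: leI)
    qed
    also have "\<dots> = (\<Sum>M | size M \<le> N. neg_total_mset M (G \<sigma> M) p * ds p ws)"
      unfolding w_def by (rule sum_lists_by_mset)
    also have "\<dots> = (\<Sum>M | size M \<le> N. neg_total_mset M (G \<sigma> M)) p * ds p ws"
      by (simp add: sum_fun_apply sum_distrib_right)
    finally show ?thesis .
  qed
  show "interior_Euler 1 \<rho> p vs = (\<Sum>\<sigma>\<in>UNIV. wedge1 (contact_form \<sigma> {#})
      (\<lambda>q ws. (\<Sum>M | size M \<le> N. neg_total_mset M (G \<sigma> M)) q * ds q ws) p vs)"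
    unfolding interior_Euler_def wedge1_def len of_nat_1 div_by_1 mult_1_left
    by (intro sum.cong refl arg_cong2[where f = "(*)"] inner) (simp add: length_omit len)
qed

text \<open>Every term of the wedge product that leaves \<open>u\<close> inside \<open>ds\<close> is
  0; in the remaining one \<open>contact_form \<sigma> {#}\<close> reads off the order-zero
  component of \<open>u\<close>.\<close>

lemma is_source_form_vertical:
  assumes "is_source_form E \<epsilon>" "p \<in> S" "length vs = CARD('n)" "fst u = 0"
  shows "\<epsilon> p (u # vs) = (\<Sum>\<sigma>\<in>UNIV. snd u {#} $ \<sigma> * E \<sigma> p) * ds p vs"
proof -
  have "\<epsilon> p (u # vs) = (\<Sum>\<sigma>\<in>UNIV. wedge1 (contact_form \<sigma> {#}) (\<lambda>q ws. E \<sigma> q * ds q ws) p (u # vs))"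
    using assms by (simp add: is_source_form_def)
  then show ?thesis
    by (simp add: wedge1_Cons ds_vertical_Cons[OF assms(4)] contact_form_def assms(4) sum_distrib_right mult.assoc)
qed

lemma source_coeff_source:
  assumes "is_source_form E \<epsilon>" "p \<in> S"
  shows "source_coeff \<epsilon> \<sigma> p = E \<sigma> p"
proof -
  have "(\<Sum>\<tau>\<in>UNIV. snd (unit_vertical \<sigma> {#} :: ('n, 'm) jet) {#} $ \<tau> * E \<tau> p) = (\<Sum>\<tau>\<in>UNIV. if \<tau> = \<sigma> then E \<tau> p else 0)"
    by (intro sum.cong refl) (simp add: unit_vertical_def axis_def)
  then show ?thesis
    unfolding source_coeff_def
    by (subst is_source_form_vertical[OF assms]) (simp_all add: ds_basis, simp add: unit_vertical_def)
qed

lemma contract_source: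
  assumes "is_source_form E \<epsilon>" "\<And>p. p \<in> S \<Longrightarrow> \<xi> p = evolutionary Q p"
  shows "is_horizontal (\<Sum>\<sigma>\<in>UNIV. Q \<sigma> * E \<sigma>) (contract \<xi> \<epsilon>)"
  unfolding is_horizontal_def contract_def
  using is_source_form_vertical[OF assms(1)] by (auto simp: assms(2) evolutionary_def sum_fun_apply pointwise)

text \<open>\<open>interior_Euler_source\<close> applies with \<open>D \<sigma> M F\<close> for
  \<open>G \<sigma> M\<close>. The remainder terms of \<open>contact_component_1_vertical\<close>
  are derivatives of \<open>F\<close> along the zero vector.\<close>

lemma E_n_rep:
  assumes F: "F \<in> jet_fns" "vertical_order N F" and \<mu>: "is_horizontal F \<mu>"
  shows "is_source_form (\<lambda>\<sigma>. Euler_expr N \<sigma> F) (E_n \<mu>)"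
  unfolding E_n_def Euler_expr_def
proof (rule interior_Euler_source)
  fix \<sigma> :: 'm and M :: "'n multiset" and c p and vs :: "('n, 'm) jet list"
  assume p: "p \<in> S" and len: "length vs = CARD('n)"
  \<comment> \<open>Only the derivative along the vertical \<open>u\<close> survives; all other
    terms leave \<open>u\<close> inside \<open>ds\<close>.\<close>
  have dext: "dext \<mu> p (u # hs) = dirderiv u F p * ds p hs" if "length hs = CARD('n)" "fst u = 0" for u hs
  proof -
    have "dirderiv v (\<lambda>q. \<mu> q ws) p = dirderiv v F p * ds p ws" if "length ws = CARD('n)" for v ws
      by (rule dirderiv_rep[OF F(1) _ p]) (use is_horizontalD[OF \<mu> _ that] in \<open>auto intro: ds_cong\<close>)
    then show ?thesis using that by (simp add: dext_Cons length_omit ds_vertical_Cons)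
  qed
  let ?u = "c *\<^sub>R unit_vertical \<sigma> M"
  have u: "fst ?u = 0" by (simp add: unit_vertical_def)
  obtain ws where ws: "\<And>j. length (ws j) = length vs" "contact_component 1 (dext \<mu>) p (?u # vs) =
      dext \<mu> p (?u # map (horiz p) vs) + (\<Sum>j<length vs. dext \<mu> p (0 # ws j))"
    using contact_component_1_vertical[OF u, where vs = vs and \<rho> = "dext \<mu>" and p = p] by blast
  have "ds p (map (horiz p) vs) = ds p vs" by (rule ds_cong) (simp add: len)
  then show "contact_component 1 (dext \<mu>) p (?u # vs) = c * D \<sigma> M F p * ds p vs"
    using ws u len p F by (simp add: dext dirderiv_zero dirderiv_scaleR deriv_along_in)
qed (use F in \<open>auto simp: vertical_orderD\<close>)

lemma interior_Euler_contract_dext_source: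
  assumes E: "\<And>\<sigma>. E \<sigma> \<in> jet_fns" "\<And>\<sigma>. vertical_order N (E \<sigma>)" and \<epsilon>: "is_source_form E \<epsilon>"
    and Q: "\<And>\<tau>. Q \<tau> \<in> jet_fns" and \<xi>: "\<And>p. p \<in> S \<Longrightarrow> \<xi> p = evolutionary Q p"
  shows "is_source_form (\<lambda>\<sigma>. deriv_along (evolutionary Q) (E \<sigma>) - (\<Sum>\<tau>\<in>UNIV. Euler_pairing N \<sigma> (E \<tau>) (Q \<tau>)))
    (interior_Euler 1 (contract \<xi> (dext \<epsilon>)))"
proof -
  \<comment> \<open>These are the 1-contact coefficients of
    \<open>\<xi> \<rfloor> d\<epsilon>\<close>. Differentiating along \<open>\<xi>\<close>, with the
    other argument in \<open>\<omega>\<^sup>\<sigma>\<close>, contributes for empty \<open>M\<close>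
    only; the term with the roles exchanged contributes for every \<open>M\<close>, with a minus
    sign.\<close>
  define G where "G \<sigma> M = (if M = {#} then deriv_along (evolutionary Q) (E \<sigma>) else 0) - (\<Sum>\<tau>\<in>UNIV. D \<sigma> M (E \<tau>) * Q \<tau>)" for \<sigma> and M :: "'n multiset"
  have "is_source_form (\<lambda>\<sigma>. \<Sum>M | size M \<le> N. neg_total_mset M (G \<sigma> M)) (interior_Euler 1 (contract \<xi> (dext \<epsilon>)))"
  proof (rule interior_Euler_source)
    show "G \<sigma> M \<in> jet_fns" for \<sigma> M
      unfolding G_def by (intro minus_jet_fns sum_jet_fns mult_jet_fns Q deriv_along_const_jet_fns E) (simp add: evolutionary_jet_fns E Q zero_jet_fns)
    show "G \<sigma> M = 0" if "N < size M" for \<sigma> M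
      using that by (auto simp: G_def vertical_orderD[OF E(2)])
    fix \<sigma> :: 'm and M :: "'n multiset" and c p and vs :: "('n, 'm) jet list"
    assume p: "p \<in> S" and len: "length vs = CARD('n)"
    have dext: "dext \<epsilon> p (x # y # hs) = (\<Sum>\<sigma>\<in>UNIV. snd y {#} $ \<sigma> * dirderiv x (E \<sigma>) p -
        snd x {#} $ \<sigma> * dirderiv y (E \<sigma>) p) * ds p hs"
      if hs: "length hs = CARD('n)" and x: "fst x = 0" and y: "fst y = 0" for x y hs
    proof -
      have 1: "dirderiv v (\<lambda>q. \<epsilon> q (u # hs)) p = (\<Sum>\<sigma>\<in>UNIV. snd u {#} $ \<sigma> * dirderiv v (E \<sigma>) p) * ds p hs"
        if "fst u = 0" for u v
      proof -
        let ?F = "\<Sum>\<sigma>\<in>UNIV. (\<lambda>q. snd u {#} $ \<sigma> * E \<sigma> q)"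
        have F: "?F \<in> jet_fns" by (intro sum_jet_fns cmult_jet_fns E)
        have "dirderiv v (\<lambda>q. \<epsilon> q (u # hs)) p = dirderiv v ?F p * ds p hs"
          by (rule dirderiv_rep[OF F _ p])
            (use is_source_form_vertical[OF \<epsilon> _ hs that] in \<open>auto simp: sum_fun_apply intro: ds_cong\<close>)
        also have "dirderiv v ?F p = deriv_along (\<lambda>_. v) ?F p" by (simp add: deriv_along_in p)
        also have "\<dots> = (\<Sum>\<sigma>\<in>UNIV. snd u {#} $ \<sigma> * dirderiv v (E \<sigma>) p)"
          by (subst deriv_along_sum) (simp_all add: cmult_jet_fns E deriv_along_cmult sum_fun_apply deriv_along_in p)
        finally show ?thesis .
      qed
      \<comment> \<open>Derivatives along the remaining arguments leave both \<open>x\<close> and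
        \<open>y\<close> inside \<open>\<epsilon>\<close>, and a source form vanishes on two
        vertical arguments.\<close>
      have 2: "dirderiv v (\<lambda>q. \<epsilon> q (x # y # ws)) p = 0" if "length ws = CARD('n) - 1" for v ws
      proof -
        have "\<epsilon> q (x # y # ws) = 0" if "q \<in> S" for q
          using is_source_form_vertical[OF \<epsilon> that, of "y # ws" x] x ds_vertical_Cons[OF y] \<open>length ws = _\<close> by simp
        then show ?thesis using dirderiv_cong[OF open_S _ p, of "\<lambda>q. \<epsilon> q (x # y # ws)" "\<lambda>_. 0" v] by simp
      qed
      have "dext \<epsilon> p (x # y # hs) = dirderiv x (\<lambda>q. \<epsilon> q (y # hs)) p - (dirderiv y (\<lambda>q. \<epsilon> q (x # hs)) p -
         (\<Sum>j<length hs. (-1) ^ j * dirderiv (hs ! j) (\<lambda>q. \<epsilon> q (x # y # omit j hs)) p))"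
        unfolding dext_Cons length_Cons sum_Cons_shift by simp
      also have "(\<Sum>j<length hs. (-1) ^ j * dirderiv (hs ! j) (\<lambda>q. \<epsilon> q (x # y # omit j hs)) p) = 0"
        by (rule sum.neutral) (simp add: 2 length_omit hs)
      finally show ?thesis unfolding 1[OF x] 1[OF y]
        by (simp add: sum_subtractf left_diff_distrib)
    qed
    let ?u = "c *\<^sub>R unit_vertical \<sigma> M" and ?\<rho> = "contract \<xi> (dext \<epsilon>)"
    have u: "fst ?u = 0" "fst (unit_vertical \<sigma> M) = 0" by (simp_all add: unit_vertical_def)
    have \<xi>p: "\<xi> p = evolutionary Q p" "fst (evolutionary Q p) = 0" "snd (evolutionary Q p) {#} $ \<tau> = Q \<tau> p" for \<tau>
      by (simp_all add: \<xi> p evolutionary_def)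
    obtain ws where ws: "\<And>j. length (ws j) = length vs" "contact_component 1 ?\<rho> p (?u # vs) =
        ?\<rho> p (?u # map (horiz p) vs) + (\<Sum>j<length vs. ?\<rho> p (0 # ws j))"
      using contact_component_1_vertical[OF u(1), where vs = vs and \<rho> = ?\<rho> and p = p] by blast
    have ds: "ds p (map (horiz p) vs) = ds p vs" by (rule ds_cong) (simp add: len)
    have "?\<rho> p (0 # ws j) = 0" for j
      by (simp add: contract_def \<xi>p dext ws(1) len dirderiv_zero E p zero_fun_apply)
    then have "contact_component 1 ?\<rho> p (?u # vs) = (\<Sum>\<tau>\<in>UNIV. snd ?u {#} $ \<tau> * deriv_along (evolutionary Q) (E \<tau>) p -
        c * (D \<sigma> M (E \<tau>) * Q \<tau>) p) * ds p vs"
      unfolding ws(2) contract_def \<xi>p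
      by (subst dext) (simp_all add: u \<xi>p len ds deriv_along_in p dirderiv_scaleR E pointwise mult_ac)
    also have "(\<Sum>\<tau>\<in>UNIV. snd ?u {#} $ \<tau> * deriv_along (evolutionary Q) (E \<tau>) p) =
        (\<Sum>\<tau>\<in>UNIV. if \<tau> = \<sigma> then c * (if M = {#} then deriv_along (evolutionary Q) (E \<sigma>) p else 0) else 0)"
      by (intro sum.cong refl) (auto simp: unit_vertical_def axis_def scaleR_fun_def pointwise)
    then have "(\<Sum>\<tau>\<in>UNIV. snd ?u {#} $ \<tau> * deriv_along (evolutionary Q) (E \<tau>) p - c * (D \<sigma> M (E \<tau>) * Q \<tau>) p) = c * G \<sigma> M p"
      by (simp add: sum_subtractf G_def pointwise sum_fun_apply sum_distrib_left right_diff_distrib)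
    finally show "contact_component 1 ?\<rho> p (?u # vs) = c * G \<sigma> M p * ds p vs" .
  qed
  moreover have "(\<Sum>M | size M \<le> N. neg_total_mset M (G \<sigma> M)) = deriv_along (evolutionary Q) (E \<sigma>) - (\<Sum>\<tau>\<in>UNIV. Euler_pairing N \<sigma> (E \<tau>) (Q \<tau>))" for \<sigma>
  proof -
    have "neg_total_mset M (G \<sigma> M) = (if M = {#} then deriv_along (evolutionary Q) (E \<sigma>) else 0) - (\<Sum>\<tau>\<in>UNIV. neg_total_mset M (D \<sigma> M (E \<tau>) * Q \<tau>))" for M
    proof -
      have "neg_total_mset M (G \<sigma> M) = neg_total_mset M (if M = {#} then deriv_along (evolutionary Q) (E \<sigma>) else 0) +
          neg_total_mset M (- (\<Sum>\<tau>\<in>UNIV. D \<sigma> M (E \<tau>) * Q \<tau>))"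
        unfolding G_def diff_conv_add_uminus
        by (rule neg_total_mset_add) (auto simp: evolutionary_jet_fns E Q intro!: uminus_jet_fns sum_jet_fns mult_jet_fns)
      then show ?thesis
        by (subst (asm) neg_total_mset_uminus) (auto simp: neg_total_mset_sum mult_jet_fns deriv_along_const_jet_fns E Q intro!: sum_jet_fns mult_jet_fns)
    qed
    then have "(\<Sum>M | size M \<le> N. neg_total_mset M (G \<sigma> M)) = (\<Sum>M :: 'n multiset | size M \<le> N. if M = {#} then deriv_along (evolutionary Q) (E \<sigma>) else 0) -
        (\<Sum>M | size M \<le> N. \<Sum>\<tau>\<in>UNIV. neg_total_mset M (D \<sigma> M (E \<tau>) * Q \<tau>))"
      by (simp add: sum_subtractf)
    also have "(\<Sum>M :: 'n multiset | size M \<le> N. if M = {#} then deriv_along (evolutionary Q) (E \<sigma>) else 0) = deriv_along (evolutionary Q) (E \<sigma>)"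
      by (subst sum.delta) (simp_all add: finite_multisets_size_le)
    finally show ?thesis unfolding Euler_pairing_def by (subst (asm) sum.swap)
  qed
  ultimately show ?thesis by simp
qed

end

section \<open>Sections and the main theorem\<close>

lemma smooth_on_partial: "smooth_on X f \<Longrightarrow> smooth_on X (partial J f)"
  by (induction J) (simp_all add: partial_def smooth_on_dirderiv)

lemma partial_Nil [simp]: "partial [] f = f"
  and partial_Cons: "partial (i # J) f = dirderiv (axis i 1) (partial J f)"
  by (simp_all add: partial_def)

lemma partial_cong:
  assumes "open X" "\<And>x. x \<in> X \<Longrightarrow> f x = f' x" "x \<in> X"
  shows "partial J f x = partial J f' x"
  using assms(3)
proof (induction J arbitrary: x)
  case (Cons i J)
  then show ?case unfolding partial_Cons by (intro dirderiv_cong[OF assms(1)]) auto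
qed (simp add: assms(2))

lemma partial_component:
  fixes f :: "real^'n::finite \<Rightarrow> real^'m::finite"
  assumes X: "open X" and f: "\<And>\<sigma>. smooth_on X (\<lambda>x. f x $ \<sigma>)" and "x \<in> X"
  shows "partial J f x $ \<sigma> = partial J (\<lambda>x. f x $ \<sigma>) x"
  using assms(3)
proof (induction J arbitrary: x \<sigma>)
  case (Cons i J)
  have "smooth_on X (\<lambda>x. partial J f x $ \<sigma>)" for \<sigma>
    using smooth_on_partial[OF f] by (rule smooth_on_cong[OF X, rotated]) (simp add: Cons.IH)
  then show ?case unfolding partial_Cons
    using dirderiv_component[of X "partial J f" x] dirderiv_cong[OF X Cons.IH Cons.prems] Cons.prems by simp
qed simp

lemma partial_mset_cong:
  fixes f :: "real^'n::finite \<Rightarrow> real"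
  assumes X: "open X" and f: "smooth_on X f" and x: "x \<in> X" and IJ: "mset I = mset J"
  shows "partial I f x = partial J f x"
proof -
  \<comment> \<open>Partial derivatives are known to commute on \<open>X\<close> only. Extended by
    zero they become operators that commute as functions, as \<open>foldr_mset_cong\<close>
    requires.\<close>
  define g where "g i F = (\<lambda>x. if x \<in> X then dirderiv (axis i 1) F x else 0)" for i :: 'n and F :: "real^'n \<Rightarrow> real"
  have g_smooth: "smooth_on X F \<Longrightarrow> smooth_on X (g i F)" for i F
    using smooth_on_dirderiv[where v = "axis i 1"]
    by (rule smooth_on_cong[OF X, rotated]) (simp_all add: g_def)
  have gg: "g i (g j F) = (\<lambda>x. if x \<in> X then dirderiv (axis i 1) (dirderiv (axis j 1) F) x else 0)" for i j F
    by (auto simp: fun_eq_iff g_def[of i] intro!: dirderiv_cong[OF X]) (simp add: g_def)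
  have "foldr g I f = foldr g J f"
  proof (rule foldr_mset_cong[where A = "{F. smooth_on X F}"])
    show "g i (g j F) = g j (g i F)" if "F \<in> {F. smooth_on X F}" for i j F
      unfolding gg using that dirderiv_commute[OF X] by (auto simp: fun_eq_iff)
  qed (use f IJ g_smooth in auto)
  moreover have "partial K f x = foldr g K f x" if "x \<in> X" for K x
    using that
  proof (induction K arbitrary: x)
    case (Cons k K)
    then show ?case using dirderiv_cong[OF X Cons.IH Cons.prems] by (simp add: partial_Cons g_def)
  qed simp
  ultimately show ?thesis using x by simp
qed

section \<open>Vertical fields as functions on jets, and the vanishing of the first form\<close>

context jets
begin

text \<open>The projection to order zero is linear, so directional derivatives of a pulled-back
  function are pulled-back directional derivatives, and the induction closes.\<close>

lemma Ck_on_base: "Ck_on k U f \<Longrightarrow> Ck_on k S (\<lambda>q. f (fst q, snd q {#}))"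
proof (induction k arbitrary: f)
  case 0
  have "continuous_on S (f \<circ> (\<lambda>q. (fst q, snd q {#})))"
    using 0 by (intro continuous_on_compose continuous_intros continuous_on_jet_coordinate)
      (auto simp: S_def intro: continuous_on_subset)
  then show ?case by (simp add: o_def)
next
  case (Suc k)
  have line: "(fst (p + t *\<^sub>R v), snd (p + t *\<^sub>R v) {#}) = (fst p, snd p {#}) + t *\<^sub>R (fst v, snd v {#})"
    for p v :: "('n, 'm) jet" and t
    by (simp add: scaleR_fun_def plus_fun_apply)
  have dir: "dirderiv v (\<lambda>q. f (fst q, snd q {#})) = (\<lambda>q. dirderiv (fst v, snd v {#}) f (fst q, snd q {#}))"
    for v :: "('n, 'm) jet"
    by (intro ext) (simp only: dirderiv_def line)
  have "continuous_on S (f \<circ> (\<lambda>q. (fst q, snd q {#})))"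
    using Suc.prems by (intro continuous_on_compose continuous_intros continuous_on_jet_coordinate)
      (auto simp: S_def intro: continuous_on_subset)
  moreover have "(\<lambda>t. f (fst (p + t *\<^sub>R v), snd (p + t *\<^sub>R v) {#})) differentiable at 0" if "p \<in> S" for p v
    using Suc.prems that unfolding line Ck_on.simps S_def by blast
  ultimately show ?case
    using Suc unfolding Ck_on.simps dir by (auto simp: o_def simp del: fst_add snd_add)
qed

definition field_component :: "((real^'n) \<times> (real^'m) \<Rightarrow> real^'m) \<Rightarrow> 'm \<Rightarrow> ('n, 'm) jet \<Rightarrow> real"
  where "field_component \<Xi> \<tau> = restr (\<lambda>q. \<Xi> (fst q, snd q {#}) $ \<tau>)"

lemma
  assumes "smooth_on U \<Xi>"
  shows field_component_jet_fns: "field_component \<Xi> \<tau> \<in> jet_fns" and vertical_order_field_component: "vertical_order 0 (field_component \<Xi> \<tau>)"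
proof -
  have "smooth_on S (\<lambda>q. \<Xi> (fst q, snd q {#}))"
    using assms Ck_on_base unfolding smooth_on_def by blast
  then have s: "smooth_on S (\<lambda>q. \<Xi> (fst q, snd q {#}) $ \<tau>)"
    by (rule smooth_on_bounded_linear[OF open_S bounded_linear_vec_nth])
  have o: "order_le 0 S (\<lambda>q. \<Xi> (fst q, snd q {#}) $ \<tau>)"
    by (auto simp: order_le_def)
  show jet_fns: "field_component \<Xi> \<tau> \<in> jet_fns" unfolding field_component_def by (rule restr_jet_fns[OF s o])
  have "order_le 0 S (field_component \<Xi> \<tau>)" unfolding field_component_def using o by (rule order_le_cong[rotated]) simp
  with jet_fns show "vertical_order 0 (field_component \<Xi> \<tau>)" by (rule order_le_vertical_order)
qed

text \<open>\<open>prolong\<close> uses vector-valued total derivatives, the calculus above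
  real-valued ones. The induction hypothesis also yields the smoothness that lets the next
  derivative be taken componentwise.\<close>

lemma total_deriv_component:
  fixes H :: "('n, 'm) jet \<Rightarrow> real^'m"
  assumes H: "\<And>\<tau>. restr (\<lambda>q. H q $ \<tau>) \<in> jet_fns" and "p \<in> S"
  shows "total_deriv I H p $ \<tau> = foldr T I (restr (\<lambda>q. H q $ \<tau>)) p"
  using assms(2)
proof (induction I arbitrary: p \<tau>)
  case (Cons i I)
  have jet_fns: "foldr T I (restr (\<lambda>q. H q $ \<tau>)) \<in> jet_fns" for \<tau>
    using H by (rule foldr_closed) auto
  have "smooth_on S (\<lambda>q. total_deriv I H q $ \<tau>)" for \<tau>
    using jet_fnsD(1)[OF jet_fns] by (rule smooth_on_cong[OF open_S, rotated]) (simp add: Cons.IH)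
  from dirderiv_component[OF this Cons.prems]
  have "total_deriv (i # I) H p $ \<tau> = dirderiv (total i p) (\<lambda>q. total_deriv I H q $ \<tau>) p"
    by (simp add: total_deriv_def)
  also have "\<dots> = dirderiv (total i p) (foldr T I (restr (\<lambda>q. H q $ \<tau>))) p"
    by (rule dirderiv_cong[OF open_S Cons.IH Cons.prems])
  finally show ?case by (simp add: deriv_along_in Cons.prems)
qed (simp add: total_deriv_def)

lemma prolong_evolutionary:
  assumes "smooth_on U \<Xi>" "p \<in> S"
  shows "prolong \<Xi> p = evolutionary (field_component \<Xi>) p"
proof -
  have "total_deriv (list_of M) (\<lambda>q. \<Xi> (fst q, snd q {#})) p $ \<tau> = total_mset M (field_component \<Xi> \<tau>) p" for M \<tau>
    using total_deriv_component[of "\<lambda>q. \<Xi> (fst q, snd q {#})" p "list_of M" \<tau>] field_component_jet_fns[OF assms(1)] assms(2)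
    by (simp add: field_component_def total_mset_def)
  then show ?thesis by (simp add: prolong_def evolutionary_def vec_eq_iff fun_eq_iff)
qed

lemma Jacobi_source_vanishes:
  assumes F: "F \<in> jet_fns" and \<mu>: "is_horizontal F \<mu>" and \<Xi>: "smooth_on U \<Xi>"
  shows "is_source_form (\<lambda>\<sigma>. 0) (interior_Euler 1 (contract (prolong \<Xi>) (dext (E_n \<mu>))))"
proof -
  obtain R where R: "vertical_order R F" by (rule vertical_order_exists[OF F])
  \<comment> \<open>\<open>D \<sigma> M F\<close> has vertical order at most \<open>R\<close>, and
    at most \<open>R\<close> total derivatives are applied to it. The resulting \<open>2 * R\<close>
    is a cutoff that \<open>Helmholtz\<close> admits.\<close>
  have Euler_expr: "vertical_order (2 * R) (Euler_expr R \<sigma> F)" for \<sigma>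
    unfolding Euler_expr_def by (rule vertical_order_sum)
      (use F R vertical_order_D vertical_order_neg_total_mset in \<open>auto intro: vertical_order_mono[OF vertical_order_neg_total_mset[OF _ vertical_order_D]]\<close>)
  have "is_source_form (\<lambda>\<sigma>. deriv_along (evolutionary (field_component \<Xi>)) (Euler_expr R \<sigma> F) - (\<Sum>\<tau>\<in>UNIV. Euler_pairing (2 * R) \<sigma> (Euler_expr R \<tau> F) (field_component \<Xi> \<tau>)))
    (interior_Euler 1 (contract (prolong \<Xi>) (dext (E_n \<mu>))))"
    using F Euler_expr E_n_rep[OF F R \<mu>] \<Xi>
    by (intro interior_Euler_contract_dext_source) (auto simp: field_component_jet_fns prolong_evolutionary)
  then show ?thesis
    by (simp add: Helmholtz[where Q = "field_component \<Xi>", OF F R field_component_jet_fns[OF \<Xi>] order_refl])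
qed

end

section \<open>Jet functions along a section, and self-adjointness\<close>

locale jet_section = jets U for U :: "((real^'n::finite) \<times> (real^'m::finite)) set" +
  fixes X :: "(real^'n) set" and g :: "real^'n \<Rightarrow> real^'m"
  assumes open_X: "open X" and smooth_g: "smooth_on X g" and graph: "x \<in> X \<Longrightarrow> (x, g x) \<in> U"
begin

abbreviation j :: "real^'n \<Rightarrow> ('n, 'm) jet"
  where "j \<equiv> jet_prolong g"

lemma smooth_g_component: "smooth_on X (\<lambda>x. g x $ \<sigma>)"
  by (rule smooth_on_bounded_linear[OF open_X bounded_linear_vec_nth smooth_g])

lemma j_in_S: "x \<in> X \<Longrightarrow> j x \<in> S"
  by (simp add: S_def jet_prolong_def graph)

lemma continuous_on_j: "continuous_on X j"
proof -
  have "continuous_on X (\<lambda>x. partial (list_of M) g x)" for M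
    by (intro smooth_on_continuous_on smooth_on_partial smooth_g)
  then show ?thesis unfolding jet_prolong_def
    by (intro continuous_intros continuous_on_coordinatewise_then_product) auto
qed

lemma has_real_derivative_along_section:
  assumes F: "F \<in> jet_fns" and x: "x \<in> X"
  shows "((\<lambda>t. F (j (x + t *\<^sub>R v))) has_real_derivative (\<Sum>i\<in>UNIV. v $ i * T i F (j x))) (at 0)"
proof -
  obtain r where r: "order_le r S F" by (rule jet_fns_order[OF F])
  \<comment> \<open>The velocity of the lifted curve is the horizontal lift of \<open>v\<close> at
    \<open>j x\<close>. The curve need not be a straight line in jet space, hence
    \<open>has_real_derivative_jet_curve\<close>.\<close>
  define w where "w = horiz (j x) (v, 0)"
  have y: "((\<lambda>t. snd (j (x + t *\<^sub>R v)) M $ \<sigma>) has_real_derivative snd w M $ \<sigma>) (at 0)" for M \<sigma>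
  proof -
    let ?f = "\<lambda>x. g x $ \<sigma>"
    have sm: "smooth_on X (partial (list_of M) ?f)" by (rule smooth_on_partial[OF smooth_g_component])
    have "((\<lambda>t. partial (list_of M) ?f (x + t *\<^sub>R v)) has_real_derivative dirderiv v (partial (list_of M) ?f) x) (at 0)"
      by (rule smooth_on_has_real_derivative0[OF sm x])
    moreover have "\<forall>\<^sub>F t in nhds 0. x + t *\<^sub>R v \<in> X"
      using eventually_line_in[OF open_X, of x 0 v] x by simp
    then have "\<forall>\<^sub>F t in nhds 0. snd (j (x + t *\<^sub>R v)) M $ \<sigma> = partial (list_of M) ?f (x + t *\<^sub>R v)"
      by eventually_elim (simp add: jet_prolong_def partial_component[OF open_X smooth_g_component])
    ultimately have 1: "((\<lambda>t. snd (j (x + t *\<^sub>R v)) M $ \<sigma>) has_real_derivative dirderiv v (partial (list_of M) ?f) x) (at 0)"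
      by (simp cong: DERIV_cong_ev)
    have "dirderiv v (partial (list_of M) ?f) x = dirderiv (\<Sum>i\<in>UNIV. v $ i *\<^sub>R axis i 1) (partial (list_of M) ?f) x"
      using basis_expansion[of v] by (simp add: scalar_mult_eq_scaleR)
    also have "\<dots> = (\<Sum>i\<in>UNIV. v $ i * partial (i # list_of M) ?f x)"
      unfolding partial_Cons by (rule dirderiv_sum_direction[OF open_X sm x]) simp
    \<comment> \<open>\<open>list_of\<close> picks an arbitrary enumeration, so
      \<open>list_of (add_mset i M)\<close> need not be \<open>i # list_of M\<close>; the order of
      partial derivatives has to be changed.\<close>
    also have "\<dots> = (\<Sum>i\<in>UNIV. v $ i * partial (list_of (add_mset i M)) ?f x)"
      by (intro sum.cong refl arg_cong2[where f = "(*)"] partial_mset_cong[OF open_X smooth_g_component x]) simp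
    also have "\<dots> = snd w M $ \<sigma>"
      by (simp add: w_def horiz_eq jet_prolong_def partial_component[OF open_X smooth_g_component x] mult.commute)
    finally show ?thesis using 1 by simp
  qed
  have x': "((\<lambda>t. fst (j (x + t *\<^sub>R v)) $ i) has_real_derivative fst w $ i) (at 0)" for i
    by (auto simp: jet_prolong_def w_def intro!: derivative_eq_intros)
  have p: "j (x + 0 *\<^sub>R v) = j x" by simp
  have "((\<lambda>t. F (j (x + t *\<^sub>R v))) has_real_derivative dirderiv w F (j x)) (at 0)"
    using has_real_derivative_jet_curve[OF F r _ x' y, unfolded p] j_in_S[OF x]
      dirderiv_expand[OF F r j_in_S[OF x], of w] by simp
  also have "dirderiv w F (j x) = (\<Sum>i\<in>UNIV. v $ i * dirderiv (total i (j x)) F (j x))"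
    unfolding w_def horiz_def fst_conv
    by (rule dirderiv_sum_direction[OF open_S jet_fnsD(1)[OF F] j_in_S[OF x]]) simp
  finally show ?thesis by (simp add: deriv_along_in j_in_S[OF x])
qed

lemma dirderiv_along_section:
  "F \<in> jet_fns \<Longrightarrow> x \<in> X \<Longrightarrow> dirderiv v (\<lambda>x. F (j x)) x = (\<Sum>i\<in>UNIV. v $ i * T i F (j x))"
  using has_real_derivative_along_section
  by (intro dirderiv_eqI) (simp add: has_real_derivative_iff_has_vector_derivative)

text \<open>On \<open>X\<close> a directional derivative of such a composite is again a jet function
  composed with \<open>j\<close>, so the induction on the class runs over all \<open>F\<close> at
  once.\<close>

lemma smooth_on_along_section: "F \<in> jet_fns \<Longrightarrow> smooth_on X (\<lambda>x. F (j x))"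
proof -
  have cont: "continuous_on X (\<lambda>x. F (j x))" if "F \<in> jet_fns" for F
    using continuous_on_compose2[OF smooth_on_continuous_on[OF jet_fnsD(1)[OF that]] continuous_on_j] j_in_S by blast
  have "Ck_on k X (\<lambda>x. F (j x))" if "F \<in> jet_fns" for k F
    using that
  proof (induction k arbitrary: F)
    case (Suc k)
    have "Ck_on k X (dirderiv v (\<lambda>x. F (j x)))" for v
    proof (rule Ck_on_cong[OF open_X])
      let ?G = "\<Sum>i\<in>UNIV. (\<lambda>p. v $ i * T i F p)"
      have "?G \<in> jet_fns" using Suc.prems by (intro sum_jet_fns cmult_jet_fns T_jet_fns)
      then show "Ck_on k X (\<lambda>x. ?G (j x))" by (rule Suc.IH)
      show "?G (j x) = dirderiv v (\<lambda>x. F (j x)) x" if "x \<in> X" for x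
        by (simp add: dirderiv_along_section[OF Suc.prems that] sum_fun_apply)
    qed
    then show ?case
      using cont[OF Suc.prems] has_real_derivative_along_section[OF Suc.prems]
      unfolding Ck_on.simps real_differentiable_def by blast
  qed (simp add: cont)
  then show "F \<in> jet_fns \<Longrightarrow> smooth_on X (\<lambda>x. F (j x))" by (simp add: smooth_on_def)
qed

lemma partial_along_section:
  assumes F: "F \<in> jet_fns" and "x \<in> X"
  shows "partial J (\<lambda>x. F (j x)) x = foldr T J F (j x)"
  using assms(2)
proof (induction J arbitrary: x)
  case (Cons i J)
  have jet_fns: "foldr T J F \<in> jet_fns" using F by (rule foldr_closed) auto
  have "partial (i # J) (\<lambda>x. F (j x)) x = dirderiv (axis i 1) (\<lambda>x. foldr T J F (j x)) x"
    unfolding partial_Cons by (rule dirderiv_cong[OF open_X Cons.IH Cons.prems])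
  also have "\<dots> = T i (foldr T J F) (j x)"
    by (simp add: dirderiv_along_section[OF jet_fns Cons.prems] axis_def if_distrib[of "\<lambda>x. x * _"] cong: if_cong)
  finally show ?case by simp
qed simp

theorem Jacobi_self_adjoint:
  assumes F: "F \<in> jet_fns" and \<mu>: "is_horizontal F \<mu>"
    and extremal: "\<And>x \<sigma>. x \<in> X \<Longrightarrow> source_coeff (E_n \<mu>) \<sigma> (j x) = 0"
  shows "self_adjoint_along U X g (\<lambda>\<Xi> \<sigma> x. source_coeff (Jacobi_morphism \<mu> \<Xi>) \<sigma> (j x))"
proof -
  obtain R where R: "vertical_order R F" by (rule vertical_order_exists[OF F])
  define N where "N = 2 * R"
  define E where "E \<sigma> = Euler_expr R \<sigma> F" for \<sigma>
  have E: "E \<sigma> \<in> jet_fns" for \<sigma> using F by (auto simp: E_def)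
  have EN: "vertical_order N (E \<sigma>)" for \<sigma>
    unfolding E_def Euler_expr_def N_def by (rule vertical_order_sum)
      (use F R vertical_order_D vertical_order_neg_total_mset in \<open>auto intro: vertical_order_mono[OF vertical_order_neg_total_mset[OF _ vertical_order_D]]\<close>)
  have src: "is_source_form E (E_n \<mu>)" unfolding E_def by (rule E_n_rep[OF F R \<mu>])
  have E0: "E \<sigma> (j x) = 0" if "x \<in> X" for x \<sigma>
    using extremal[OF that] source_coeff_source[OF src j_in_S[OF that]] by simp
  define w where "w J = (\<Prod>k\<in>UNIV. fact (count_list J k)) / (fact (length J) :: real)" for J :: "'n list"
  \<comment> \<open>These are the coefficients of the linearization of \<open>E \<sigma>\<close>
    along the section. \<open>diffop\<close> sums over lists, so \<open>w J\<close> spreads each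
    multi-index evenly over its enumerations.\<close>
  define A where "A J \<tau> \<sigma> x = w J * D \<tau> (mset J) (E \<sigma>) (j x)" for J :: "'n list" and \<tau> \<sigma> :: 'm and x
  have along: "\<Xi> (x, g x) $ \<tau> = field_component \<Xi> \<tau> (j x)" if "x \<in> X" for \<Xi> x \<tau>
    using j_in_S[OF that] by (simp add: field_component_def, simp add: jet_prolong_def)
  have P: "source_coeff (Jacobi_morphism \<mu> \<Xi>) \<sigma> (j x) = deriv_along (evolutionary (field_component \<Xi>)) (E \<sigma>) (j x)"
    if \<Xi>: "smooth_on U \<Xi>" and x: "x \<in> X" for \<Xi> \<sigma> x
  proof -
    let ?Q = "field_component \<Xi>"
    note Q = field_component_jet_fns[OF \<Xi>] vertical_order_field_component[OF \<Xi>]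
    let ?G = "\<Sum>\<tau>\<in>UNIV. ?Q \<tau> * E \<tau>"
    have G: "?G \<in> jet_fns" "vertical_order N ?G"
      using Q E EN by (auto intro!: sum_jet_fns mult_jet_fns vertical_order_sum vertical_order_mult intro: vertical_order_mono)
    have "is_horizontal ?G (contract (prolong \<Xi>) (E_n \<mu>))"
      by (rule contract_source[OF src prolong_evolutionary[OF \<Xi>]])
    then have "is_source_form (\<lambda>\<sigma>. Euler_expr N \<sigma> ?G) (Jacobi_morphism \<mu> \<Xi>)"
      unfolding Jacobi_morphism_def by (rule E_n_rep[OF G])
    then have "source_coeff (Jacobi_morphism \<mu> \<Xi>) \<sigma> (j x) = Euler_expr N \<sigma> ?G (j x)"
      by (rule source_coeff_source[OF _ j_in_S[OF x]])
    also have "Euler_expr N \<sigma> ?G = (\<Sum>\<tau>\<in>UNIV. Euler_pairing N \<sigma> (?Q \<tau>) (E \<tau>)) + (\<Sum>\<tau>\<in>UNIV. Euler_pairing N \<sigma> (E \<tau>) (?Q \<tau>))"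
      using Q E by (simp add: Euler_expr_sum mult_jet_fns Euler_expr_mult sum.distrib)
    also have "(\<Sum>\<tau>\<in>UNIV. Euler_pairing N \<sigma> (E \<tau>) (?Q \<tau>)) = deriv_along (evolutionary ?Q) (E \<sigma>)"
      unfolding E_def by (rule Helmholtz[where Q = ?Q, OF F R Q(1), symmetric]) (simp add: N_def)
    \<comment> \<open>\<open>?Q \<tau>\<close> has vertical order 0, so only the empty multi-index
      remains: no total derivative is left, and the factor \<open>E \<tau>\<close> is 0 at
      \<open>j x\<close> by the Euler-Lagrange equations.\<close>
    also have "Euler_pairing N \<sigma> (?Q \<tau>) (E \<tau>) (j x) = 0" for \<tau>
      using Euler_pairing_mono[OF Q(2), of N \<sigma> \<tau> "E \<tau>"] E0[OF x] by (simp add: Euler_pairing_def pointwise)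
    then have "((\<Sum>\<tau>\<in>UNIV. Euler_pairing N \<sigma> (?Q \<tau>) (E \<tau>)) + deriv_along (evolutionary ?Q) (E \<sigma>)) (j x) = deriv_along (evolutionary ?Q) (E \<sigma>) (j x)"
      by (simp add: pointwise sum_fun_apply)
    finally show ?thesis .
  qed
  have diff: "diffop N A g \<Xi> \<sigma> x = deriv_along (evolutionary (field_component \<Xi>)) (E \<sigma>) (j x)"
    if \<Xi>: "smooth_on U \<Xi>" and x: "x \<in> X" for \<Xi> \<sigma> x
  proof -
    have "partial J (\<lambda>z. \<Xi> (z, g z) $ \<tau>) x = total_mset (mset J) (field_component \<Xi> \<tau>) (j x)" for J \<tau>
    proof -
      have "partial J (\<lambda>z. \<Xi> (z, g z) $ \<tau>) x = partial J (\<lambda>z. field_component \<Xi> \<tau> (j z)) x"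
        by (rule partial_cong[OF open_X along x])
      then show ?thesis by (simp add: partial_along_section field_component_jet_fns[OF \<Xi>] x foldr_T_eq_total_mset)
    qed
    then have "diffop N A g \<Xi> \<sigma> x = (\<Sum>\<tau>\<in>UNIV. \<Sum>J | length J \<le> N.
        w J * (total_mset (mset J) (field_component \<Xi> \<tau>) (j x) * D \<tau> (mset J) (E \<sigma>) (j x)))"
      unfolding diffop_def by (subst sum.swap) (simp add: A_def mult_ac)
    also have "\<dots> = (\<Sum>\<tau>\<in>UNIV. \<Sum>K | size K \<le> N. total_mset K (field_component \<Xi> \<tau>) (j x) * D \<tau> K (E \<sigma>) (j x))"
      unfolding w_def by (intro sum.cong refl sum_lists_by_mset)
    finally show ?thesis by (simp add: evolutionary_expand[OF E EN] sum_fun_apply pointwise)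
  qed
  have adj: "adjoint_diffop N A g \<Xi> \<sigma> x = deriv_along (evolutionary (field_component \<Xi>)) (E \<sigma>) (j x)"
    if \<Xi>: "smooth_on U \<Xi>" and x: "x \<in> X" for \<Xi> \<sigma> x
  proof -
    note Q = field_component_jet_fns[OF \<Xi>]
    \<comment> \<open>Transposition exchanges the component indices:
      \<open>A J \<sigma> \<tau>\<close> carries the derivative in direction \<open>\<sigma>\<close>
      of \<open>E \<tau>\<close>, which is what \<open>Euler_pairing N \<sigma> (E \<tau>)\<close>
      sums.\<close>
    have p: "(-1) ^ length J * partial J (\<lambda>z. A J \<sigma> \<tau> z * \<Xi> (z, g z) $ \<tau>) x =
        w J * neg_total_mset (mset J) (D \<sigma> (mset J) (E \<tau>) * field_component \<Xi> \<tau>) (j x)" for J \<tau>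
    proof -
      let ?H = "D \<sigma> (mset J) (E \<tau>) * field_component \<Xi> \<tau>"
      have H: "?H \<in> jet_fns" using E Q by auto
      have "partial J (\<lambda>z. A J \<sigma> \<tau> z * \<Xi> (z, g z) $ \<tau>) x = partial J (\<lambda>z. (\<lambda>p. w J * ?H p) (j z)) x"
        by (rule partial_cong[OF open_X _ x]) (simp add: A_def along pointwise)
      also have "\<dots> = w J * foldr T J ?H (j x)"
        by (simp add: partial_along_section[OF cmult_jet_fns[OF H] x] foldr_T_cmult[OF H])
      finally show ?thesis by (simp add: neg_total_mset_eq_foldr_T[OF H])
    qed
    have "adjoint_diffop N A g \<Xi> \<sigma> x = (\<Sum>\<tau>\<in>UNIV. \<Sum>J | length J \<le> N.
        w J * neg_total_mset (mset J) (D \<sigma> (mset J) (E \<tau>) * field_component \<Xi> \<tau>) (j x))"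
      unfolding adjoint_diffop_def sum_distrib_left p by (rule sum.swap)
    also have "\<dots> = (\<Sum>\<tau>\<in>UNIV. \<Sum>K | size K \<le> N. neg_total_mset K (D \<sigma> K (E \<tau>) * field_component \<Xi> \<tau>) (j x))"
      unfolding w_def by (intro sum.cong refl sum_lists_by_mset)
    also have "\<dots> = (\<Sum>\<tau>\<in>UNIV. Euler_pairing N \<sigma> (E \<tau>) (field_component \<Xi> \<tau>)) (j x)"
      by (simp add: Euler_pairing_def sum_fun_apply)
    also have "(\<Sum>\<tau>\<in>UNIV. Euler_pairing N \<sigma> (E \<tau>) (field_component \<Xi> \<tau>)) = deriv_along (evolutionary (field_component \<Xi>)) (E \<sigma>)"
      unfolding E_def by (rule Helmholtz[where Q = "field_component \<Xi>", OF F R Q, symmetric]) (simp add: N_def)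
    finally show ?thesis .
  qed
  have "smooth_on X (A J \<tau> \<sigma>)" for J \<tau> \<sigma>
    unfolding A_def using E
    by (intro smooth_on_mult[OF open_X smooth_on_const] smooth_on_along_section deriv_along_const_jet_fns)
  then show ?thesis
    unfolding self_adjoint_along_def using P diff adj by (intro exI[of _ N] exI[of _ A]) simp
qed

end

section \<open>From the manifold to fibered charts\<close>

lemma smooth_manifold_chart: "smooth_manifold X A \<Longrightarrow> c \<in> A \<Longrightarrow> is_chart X c"
  by (simp add: smooth_manifold_def)

lemma fibered_chart_image_open:
  assumes "fibered_manifold X AX Y AY \<pi>" "c \<in> fibered_charts AX AY \<pi>"
  shows "open (chart_image c)"
proof -
  have "fst c \<in> AY" using assms(2) by (auto simp: fibered_charts_def)
  moreover have "smooth_manifold Y AY" using assms(1) by (simp add: fibered_manifold_def)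
  ultimately have "is_chart Y (fst c)" by (rule smooth_manifold_chart[rotated])
  then show ?thesis by (simp add: is_chart_def chart_image_def)
qed

lemma jet_section_section_rep:
  fixes c :: "('x, 'y, 'n::finite, 'm::finite) fchart"
  assumes fm: "fibered_manifold X AX Y AY \<pi>" and c: "c \<in> fibered_charts AX AY \<pi>"
    and \<gamma>: "local_section X AX Y AY \<pi> W \<gamma>"
  shows "jet_section (chart_image c) (section_dom c W \<gamma>) (section_rep c \<gamma>)"
proof -
  obtain V \<psi> B \<phi> where c_eq: "c = ((V, \<psi>), (B, \<phi>))" by (metis prod.exhaust)
  have V: "(V, \<psi>) \<in> AY" "(B, \<phi>) \<in> AX" "\<pi> ` V = B" "\<And>y. y \<in> V \<Longrightarrow> fst (\<psi> y) = \<phi> (\<pi> y)"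
    using c by (auto simp: fibered_charts_def c_eq)
  have "is_chart Y (V, \<psi>)" "is_chart X (B, \<phi>)"
    using fm V(1,2) by (auto simp: fibered_manifold_def intro: smooth_manifold_chart)
  then have oV: "openin Y V" and oB: "openin X B" and o\<phi>: "open (\<phi> ` B)"
    and hom: "homeomorphic_map (subtopology X B) (top_of_set (\<phi> ` B)) \<phi>"
    by (auto simp: is_chart_def)
  have W: "openin X W" "continuous_map (subtopology X W) Y \<gamma>" "\<And>x. x \<in> W \<Longrightarrow> \<pi> (\<gamma> x) = x"
    using \<gamma> by (auto simp: local_section_def)
  define N where "N = {x \<in> W. \<gamma> x \<in> V}"
  \<comment> \<open>\<open>\<pi>\<close> maps \<open>V\<close> into \<open>B\<close> and undoes
    \<open>\<gamma>\<close>, so \<open>N\<close> lies in the base chart. The homeomorphism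
    \<open>\<phi>\<close> can then carry the open set \<open>N\<close> to an open set of
    coordinates.\<close>
  have NB: "N \<subseteq> B" using V(3) W(3) by (force simp: N_def)
  have inj: "inj_on \<phi> B"
    using homeomorphic_imp_injective_map[OF hom] openin_subset[OF oB] by (simp add: inf.absorb2)
  have "openin (subtopology X W) {x \<in> topspace (subtopology X W). \<gamma> x \<in> V}"
    by (rule openin_continuous_map_preimage[OF W(2) oV])
  moreover have "{x \<in> topspace (subtopology X W). \<gamma> x \<in> V} = N"
    using openin_subset[OF W(1)] by (auto simp: N_def)
  ultimately have "openin X N" using W(1) openin_trans_full by metis
  then have "openin (subtopology X B) N" using NB unfolding openin_subtopology by blast
  then have "openin (top_of_set (\<phi> ` B)) (\<phi> ` N)"
    using homeomorphic_imp_open_map[OF hom] by (simp add: open_map_def)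
  then have oN: "open (\<phi> ` N)" using o\<phi> openin_open_eq by blast
  have dom: "section_dom c W \<gamma> = \<phi> ` N" by (simp add: section_dom_def c_eq N_def)
  have graph: "(x, section_rep c \<gamma> x) \<in> chart_image c" if "x \<in> section_dom c W \<gamma>" for x
  proof -
    from that obtain a where a: "a \<in> N" "x = \<phi> a" unfolding dom by (elim imageE)
    then have "inv_into B \<phi> x = a" using inj NB by (simp add: inv_into_f_f subset_iff)
    moreover have "fst (\<psi> (\<gamma> a)) = x" using a V(4) W(3) by (simp add: N_def)
    ultimately have "(x, section_rep c \<gamma> x) = \<psi> (\<gamma> a)" by (simp add: section_rep_def c_eq prod_eq_iff)
    then show ?thesis using a by (auto simp: chart_image_def c_eq N_def)
  qed
  have "smooth_on (section_dom c W \<gamma>) (section_rep c \<gamma>)"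
    using \<gamma> c by (simp add: local_section_def)
  then show ?thesis
    using fibered_chart_image_open[OF fm c] oN graph
    by unfold_locales (simp_all add: dom)
qed

theorem theorem2p2:
  fixes X :: "'x topology" and AX :: "('x, real^'n) chart set"
    and Y :: "'y topology" and AY :: "('y, (real^'n) \<times> (real^'m)) chart set"
    and \<pi> :: "'y \<Rightarrow> 'x" and r :: nat
    and L :: "('x, 'y, 'n::finite, 'm::finite) fchart \<Rightarrow> ('n, 'm) jet \<Rightarrow> real"
  assumes "fibered_manifold X AX Y AY \<pi>"
    and "lagrangian X AX Y AY \<pi> r L"
  shows "(\<forall>\<Xi>1 \<Xi>2. vertical_field AX AY \<pi> \<Xi>1 \<and> vertical_field AX AY \<pi> \<Xi>2 \<longrightarrow>
      (\<forall>c\<in>fibered_charts AX AY \<pi>. \<forall>p\<in>jet_domain c. \<forall>vs. length vs = CARD('n) \<longrightarrow>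
        contract (prolong (\<Xi>2 c))
          (interior_Euler 1 (contract (prolong (\<Xi>1 c))
            (dext (interior_Euler 1 (dext (lagrange_form (L c))))))) p vs = 0)) \<and>
    (\<forall>W \<gamma>. extremal X AX Y AY \<pi> L W \<gamma> \<longrightarrow>
      (\<forall>c\<in>fibered_charts AX AY \<pi>.
        self_adjoint_along (chart_image c) (section_dom c W \<gamma>) (section_rep c \<gamma>)
          (\<lambda>\<Xi> \<sigma> x. source_coeff (Jacobi_morphism (lagrange_form (L c)) \<Xi>) \<sigma>
            (jet_prolong (section_rep c \<gamma>) x))))"
proof (intro conjI allI impI ballI)
  fix \<Xi>1 \<Xi>2 c p and vs :: "('n, 'm) jet list"
  assume \<Xi>: "vertical_field AX AY \<pi> \<Xi>1 \<and> vertical_field AX AY \<pi> \<Xi>2"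
    and c: "c \<in> fibered_charts AX AY \<pi>" and p: "p \<in> jet_domain c" and len: "length vs = CARD('n)"
  interpret jets "chart_image c"
    by unfold_locales (rule fibered_chart_image_open[OF assms(1) c])
  have S: "S = jet_domain c" by (simp add: S_def jet_domain_def)
  \<comment> \<open>The zero extension agrees with \<open>L c\<close> on the jets over the chart, so
    it serves as the coefficient of \<open>lagrange_form (L c)\<close> there.\<close>
  have F: "restr (L c) \<in> jet_fns"
    using assms(2) c by (intro restr_jet_fns[of _ r]) (auto simp: lagrangian_def S)
  have "is_horizontal (restr (L c)) (lagrange_form (L c))"
    by (simp add: is_horizontal_def lagrange_form_def)
  moreover have "smooth_on (chart_image c) (\<Xi>1 c)"
    using \<Xi> c by (simp add: vertical_field_def)
  ultimately have "is_source_form (\<lambda>\<sigma>. 0) (interior_Euler 1 (contract (prolong (\<Xi>1 c))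
      (dext (interior_Euler 1 (dext (lagrange_form (L c)))))))"
    using Jacobi_source_vanishes[OF F] by (simp add: E_n_def)
  from is_source_form_vertical[OF this, of p vs "prolong (\<Xi>2 c) p"]
  show "contract (prolong (\<Xi>2 c)) (interior_Euler 1 (contract (prolong (\<Xi>1 c))
            (dext (interior_Euler 1 (dext (lagrange_form (L c))))))) p vs = 0"
    using p len by (simp add: S contract_def prolong_def zero_fun_apply)
next
  fix W \<gamma> c
  assume ext: "extremal X AX Y AY \<pi> L W \<gamma>" and c: "c \<in> fibered_charts AX AY \<pi>"
  interpret jet_section "chart_image c" "section_dom c W \<gamma>" "section_rep c \<gamma>"
    using ext by (intro jet_section_section_rep[OF assms(1) c]) (simp add: extremal_def)
  have S: "S = jet_domain c" by (simp add: S_def jet_domain_def)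
  have F: "restr (L c) \<in> jet_fns"
    using assms(2) c by (intro restr_jet_fns[of _ r]) (auto simp: lagrangian_def S)
  have "is_horizontal (restr (L c)) (lagrange_form (L c))"
    by (simp add: is_horizontal_def lagrange_form_def)
  then show "self_adjoint_along (chart_image c) (section_dom c W \<gamma>) (section_rep c \<gamma>)
          (\<lambda>\<Xi> \<sigma> x. source_coeff (Jacobi_morphism (lagrange_form (L c)) \<Xi>) \<sigma>
            (jet_prolong (section_rep c \<gamma>) x))"
    using ext c by (intro Jacobi_self_adjoint[OF F]) (auto simp: extremal_def)
qed

end
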